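(* Let $\alpha\in(3,4)$, let $X_{11}$ be symmetric with $\mathbb P(|X_{11}|>x)=x^{-\alpha}L(x)$, $x>0$, $L$ slowly varying at infinity, and let $p=p_n\to\infty$. Then, as $n\to\infty$, $$\frac{\operatorname{tr}(\mathbf R^2)-\mu_n}{2pn^{-1}}\ \longrightarrow\ N(0,1)\quad\text{in distribution.}$$
   Context: For each $n$, $(X_{ij})_{1\le i\le p,1\le j\le n}$ are iid copies of a non-degenerate real random variable $X_{11}$ which is symmetric and satisfies $\mathbb P(X_{11}=0)=0$. Put $Y_{ij}=X_{ij}/\sqrt{X_{i1}^2+\cdots+X_{in}^2}$, $\mathbf Y=(Y_{ij})\in\mathbb R^{p\times n}$ and $\mathbf R=\mathbf Y\mathbf Y^{\top}$ (sample correlation matrix). Let $\mu_n=p+p(p-1)/n$. *)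

theory Defs
  imports "HOL-Probability.Probability" "Jordan_Normal_Form.Matrix"
begin

text \<open>Positive and measurable near infinity, as is customary for slow variation.\<close>

definition slowly_varying :: "(real \<Rightarrow> real) \<Rightarrow> bool" where
  "slowly_varying L \<longleftrightarrow>
     (\<exists>a. (\<forall>x\<ge>a. L x > 0) \<and> L \<in> borel_measurable (restrict_space borel {a..})) \<and>
     (\<forall>c>0. ((\<lambda>x. L (c * x) / L x) \<longlongrightarrow> 1) at_top)"

definition mat_trace :: "'a :: comm_monoid_add mat \<Rightarrow> 'a" where
  "mat_trace A = (\<Sum>i<dim_row A. A $$ (i, i))"

text \<open>The data matrix is given by its entries \<open>x i j\<close>. Rows and columns are numbered
  from \<open>0\<close>, i.e. by \<open>i < p\<close> and \<open>j < n\<close>.\<close>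

definition self_normalized_mat :: "nat \<Rightarrow> nat \<Rightarrow> (nat \<Rightarrow> nat \<Rightarrow> real) \<Rightarrow> real mat" where
  "self_normalized_mat p n x = mat p n (\<lambda>(i, j). x i j / sqrt (\<Sum>k<n. (x i k)\<^sup>2))"

definition sample_correlation_mat :: "nat \<Rightarrow> nat \<Rightarrow> (nat \<Rightarrow> nat \<Rightarrow> real) \<Rightarrow> real mat" where
  "sample_correlation_mat p n x =
     self_normalized_mat p n x * transpose_mat (self_normalized_mat p n x)"

definition centering :: "nat \<Rightarrow> nat \<Rightarrow> real" where
  "centering p n = real p + real p * (real p - 1) / real n"

end

theory Submission
  imports Defs "HOL-Real_Asymp.Real_Asymp"
begin

text \<open>Write \<open>y i j\<close> for the self-normalised entries, \<open>a i j = (y i j)\<^sup>2\<close>, \<open>Q i k = (\<Sum>j. a i j * a k j)\<close> and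
\<open>H i k = (\<Sum>j \<noteq> l. y i j * y i l * y k j * y k l)\<close>. The squared correlation of rows \<open>i\<close> and \<open>k\<close> is
\<open>Q i k + H i k\<close>, so the standardised statistic is almost surely
\<open>T = n / (2 * p) * (\<Sum>i \<noteq> k. Q i k - 1 / n + H i k)\<close>. Everything is controlled by the single number
\<open>\<theta> = n * \<sigma>\<^sup>2\<close> with \<open>\<sigma> = n * E (y\<^sup>4)\<close>, where \<open>E (y\<^sup>4)\<close> is the fourth moment of an entry.

The index \<open>\<alpha> > 3\<close> enters through \<open>\<theta> \<longlonglongrightarrow> 0\<close>, that is, \<open>E (y\<^sup>4) = o(n powr (- 3 / 2))\<close>: a moment of
some order \<open>\<gamma> > 3\<close> is finite, and a row norm of order smaller than \<open>sqrt n\<close> is exponentially unlikely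
(\<open>theta_tendsto_0\<close>). Exchangeability within rows then gives
\<open>E ((n * Q i k - 1)\<^sup>2) \<le> 2 * \<theta>\<close> (\<open>expectation_Q_deviation\<close>), and the variables \<open>Q i k - 1 / n\<close>
of different pairs of rows are uncorrelated, so the \<open>Q\<close>-part of \<open>T\<close> vanishes in \<open>L\<^sup>2\<close>.

The \<open>H\<close>-part is a degenerate U-statistic in the rows, because the law of the array is
invariant under changing the sign of any one entry. The number \<open>p\<close> of rows may grow arbitrarily slowly,
and the fourth moment of \<open>H\<close> is then too large for a direct argument. It is therefore truncated to
\<open>h i k = n / p * H i k\<close> on the event \<open>Q i k \<le> 2 / n\<close>. The event depends on the absolute values only,
so the truncation keeps the degeneracy; the part removed is negligible in \<open>L\<^sup>2\<close> since \<open>n * Q\<close> is close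
to \<open>1\<close>; and on the event the fourth moment of \<open>n * H\<close> is bounded by a constant \<open>K8\<close>
(\<open>expectation_cut_H4\<close>), by sub-Gaussianity of a sum with independent random signs.

Asymptotic normality of \<open>W = 1/2 * (\<Sum>i. D i)\<close>, \<open>D i = (\<Sum>k \<noteq> i. h i k)\<close>, comes from the differential
equation \<open>\<phi>' t = - t * \<phi> t\<close> of the Gaussian characteristic function. Removing row \<open>i\<close> from \<open>W\<close> leaves
\<open>W - D i\<close>, to which \<open>D i\<close> is orthogonal; hence the equation holds approximately as soon as
\<open>1/2 * (\<Sum>i. (D i)\<^sup>2)\<close> is close to \<open>1\<close> in \<open>L\<^sup>1\<close> and the sum of the third absolute moments of the
\<open>D i\<close> is small (\<open>cf_normal_approximation\<close>). Both follow from moment computations in which all mixed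
moments vanish where some row occurs only once. The explicit bound \<open>cf_T\<close> tends to \<open>0\<close>, and
Levy's continuity theorem finishes the proof.\<close>

section \<open>Bounded random variables\<close>

text \<open>All variables built from self-normalised entries are bounded. Closure of this class under
arithmetic makes integrability automatic, hence the safe introduction rules.\<close>

definition bdd_rv :: "'a measure \<Rightarrow> ('a \<Rightarrow> real) \<Rightarrow> bool" where
  "bdd_rv M f \<longleftrightarrow> f \<in> borel_measurable M \<and> (\<exists>B. \<forall>x\<in>space M. \<bar>f x\<bar> \<le> B)"

lemma bdd_rvI: "f \<in> borel_measurable M \<Longrightarrow> (\<And>x. x \<in> space M \<Longrightarrow> \<bar>f x\<bar> \<le> B) \<Longrightarrow> bdd_rv M f"
  unfolding bdd_rv_def by blast

lemma bdd_rvE: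
  assumes "bdd_rv M f"
  obtains B where "f \<in> borel_measurable M" "B \<ge> 0" "\<And>x. x \<in> space M \<Longrightarrow> \<bar>f x\<bar> \<le> B"
proof -
  from assms obtain B where *: "f \<in> borel_measurable M" "\<forall>x\<in>space M. \<bar>f x\<bar> \<le> B"
    unfolding bdd_rv_def by blast
  show ?thesis
    by (rule that[of "max B 0"]) (use * in \<open>auto intro: max.coboundedI1\<close>)
qed

lemma bdd_rv_measurable: "bdd_rv M f \<Longrightarrow> f \<in> borel_measurable M"
  unfolding bdd_rv_def by blast

lemma bdd_rv_const [intro!]: "bdd_rv M (\<lambda>_. c)"
  by (rule bdd_rvI[where B = "\<bar>c\<bar>"]) auto

lemma bdd_rv_add [intro!]:
  assumes "bdd_rv M f" "bdd_rv M g" shows "bdd_rv M (\<lambda>x. f x + g x)"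
proof -
  obtain B C where "f \<in> borel_measurable M" "\<And>x. x \<in> space M \<Longrightarrow> \<bar>f x\<bar> \<le> B"
    "g \<in> borel_measurable M" "\<And>x. x \<in> space M \<Longrightarrow> \<bar>g x\<bar> \<le> C"
    using assms by (metis bdd_rvE)
  then show ?thesis
    by (intro bdd_rvI[where B = "B + C"]) (auto intro: order_trans[OF abs_triangle_ineq] add_mono)
qed

lemma bdd_rv_mult [intro!]:
  assumes "bdd_rv M f" "bdd_rv M g" shows "bdd_rv M (\<lambda>x. f x * g x)"
proof -
  obtain B C where "f \<in> borel_measurable M" "B \<ge> 0" "\<And>x. x \<in> space M \<Longrightarrow> \<bar>f x\<bar> \<le> B"
    "g \<in> borel_measurable M" "\<And>x. x \<in> space M \<Longrightarrow> \<bar>g x\<bar> \<le> C"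
    using assms by (metis bdd_rvE)
  then show ?thesis
    by (intro bdd_rvI[where B = "B * C"]) (auto simp: abs_mult intro!: mult_mono)
qed

lemma bdd_rv_uminus [intro!]: "bdd_rv M f \<Longrightarrow> bdd_rv M (\<lambda>x. - f x)"
  unfolding bdd_rv_def by auto

lemma bdd_rv_diff [intro!]: "bdd_rv M f \<Longrightarrow> bdd_rv M g \<Longrightarrow> bdd_rv M (\<lambda>x. f x - g x)"
  using bdd_rv_add[of M f "\<lambda>x. - g x"] by auto

lemma bdd_rv_divide [intro!]: "bdd_rv M f \<Longrightarrow> bdd_rv M (\<lambda>x. f x / c)"
  using bdd_rv_mult[of M f "\<lambda>_. 1 / c"] by auto

lemma bdd_rv_power [intro!]: "bdd_rv M f \<Longrightarrow> bdd_rv M (\<lambda>x. f x ^ k)"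
  by (induction k) auto

lemma bdd_rv_sum [intro!]: "(\<And>i. i \<in> A \<Longrightarrow> bdd_rv M (f i)) \<Longrightarrow> bdd_rv M (\<lambda>x. \<Sum>i\<in>A. f i x)"
  by (induction A rule: infinite_finite_induct) auto

lemma bdd_rv_abs [intro!]: "bdd_rv M f \<Longrightarrow> bdd_rv M (\<lambda>x. \<bar>f x\<bar>)"
  unfolding bdd_rv_def by auto

lemma bdd_rv_exp [intro!]:
  assumes "bdd_rv M f" shows "bdd_rv M (\<lambda>x. exp (f x))"
proof -
  obtain B where "f \<in> borel_measurable M" "\<And>x. x \<in> space M \<Longrightarrow> \<bar>f x\<bar> \<le> B"
    using assms by (metis bdd_rvE)
  then show ?thesis
    by (intro bdd_rvI[where B = "exp B"]) (auto simp: abs_le_iff)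
qed

lemma bdd_rv_cos [intro!]: "bdd_rv M f \<Longrightarrow> bdd_rv M (\<lambda>x. cos (f x))"
  by (rule bdd_rvI[where B = 1]) (auto dest: bdd_rv_measurable)

lemma bdd_rv_sin [intro!]: "bdd_rv M f \<Longrightarrow> bdd_rv M (\<lambda>x. sin (f x))"
  by (rule bdd_rvI[where B = 1]) (auto dest: bdd_rv_measurable)

context prob_space
begin

lemma bdd_rv_integrable [intro]: "bdd_rv M f \<Longrightarrow> integrable M f"
  by (elim bdd_rvE) (rule integrable_const_bound, auto)

lemma bdd_rv_integrable_cplx:
  assumes "bdd_rv M f" "g \<in> borel_measurable M" "\<And>x. cmod (g x) \<le> 1"
  shows "integrable M (\<lambda>x. complex_of_real (f x) * g x)"
proof -
  obtain B where B: "f \<in> borel_measurable M" "B \<ge> 0" "\<And>x. x \<in> space M \<Longrightarrow> \<bar>f x\<bar> \<le> B"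
    using assms by (metis bdd_rvE)
  note [measurable] = B(1) assms(2)
  show ?thesis
  proof (rule integrable_const_bound[where B = B])
    show "AE x in M. cmod (complex_of_real (f x) * g x) \<le> B"
      using B assms(3) mult_mono[OF B(3) assms(3) B(2)] by (auto simp: norm_mult)
  qed measurable
qed

lemma expectation_sum:
  assumes "\<And>i. i \<in> A \<Longrightarrow> bdd_rv M (f i)"
  shows "expectation (\<lambda>x. \<Sum>i\<in>A. f i x) = (\<Sum>i\<in>A. expectation (f i))"
  by (rule Bochner_Integration.integral_sum) (use assms in auto)

lemma expectation_mono:
  assumes "bdd_rv M f" "bdd_rv M g" "\<And>x. f x \<le> g x"
  shows "expectation f \<le> expectation g"
  by (rule integral_mono) (use assms in auto)

lemma norm_expectation_le:
  fixes f :: "'a \<Rightarrow> 'c::{banach, second_countable_topology}"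
  assumes "integrable M f" "integrable M g" "\<And>x. x \<in> space M \<Longrightarrow> norm (f x) \<le> g x"
  shows "norm (expectation f) \<le> expectation g"
proof -
  have "norm (expectation f) \<le> expectation (\<lambda>x. norm (f x))" by (rule integral_norm_bound)
  also have "\<dots> \<le> expectation g" by (rule integral_mono) (use assms in auto)
  finally show ?thesis .
qed

lemma expectation_abs_le_sqrt:
  assumes f: "bdd_rv M f" and B: "expectation (\<lambda>x. (f x)\<^sup>2) \<le> B"
  shows "expectation (\<lambda>x. \<bar>f x\<bar>) \<le> sqrt B"
proof -
  have "0 \<le> expectation (\<lambda>x. (\<bar>f x\<bar> - expectation (\<lambda>x. \<bar>f x\<bar>))\<^sup>2)" by simp
  also have "\<dots> = expectation (\<lambda>x. \<bar>f x\<bar>\<^sup>2) - (expectation (\<lambda>x. \<bar>f x\<bar>))\<^sup>2"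
    by (rule variance_eq) (use f in auto)
  finally have "(expectation (\<lambda>x. \<bar>f x\<bar>))\<^sup>2 \<le> B" using B by simp
  then show ?thesis by (rule real_le_rsqrt)
qed

section \<open>A normal approximation through characteristic functions\<close>

lemma quadratic_remainder: "\<bar>a * b\<bar> ^ Suc 1 / fact (Suc 1) = a\<^sup>2 / 2 * (b::real)\<^sup>2"
proof -
  have "\<bar>a * b\<bar> ^ Suc 1 = (a * b)\<^sup>2" by (simp only: Suc_1 power2_abs)
  moreover have "fact (Suc 1) = (2::real)" by simp
  ultimately show ?thesis by (simp add: power_mult_distrib)
qed

lemma abs_mult_quadratic_remainder: "\<bar>b\<bar> * (\<bar>- (a * b)\<bar> ^ Suc 1 / fact (Suc 1)) = a\<^sup>2 / 2 * \<bar>b::real\<bar> ^ 3"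
  unfolding abs_minus_cancel quadratic_remainder by (simp add: power3_eq_cube power2_eq_square)

lemma cf_has_derivative:
  assumes W: "bdd_rv M W"
  shows "((\<lambda>t. \<integral>x. iexp (t * W x) \<partial>M) has_vector_derivative
          (\<integral>x. \<i> * complex_of_real (W x) * iexp (t * W x) \<partial>M)) (at t within S)"
proof -
  note [measurable] = bdd_rv_measurable[OF W]
  define \<phi> where "\<phi> t = (\<integral>x. iexp (t * W x) \<partial>M)" for t
  define \<psi> where "\<psi> = (\<integral>x. \<i> * complex_of_real (W x) * iexp (t * W x) \<partial>M)"
  define C where "C = expectation (\<lambda>x. (W x)\<^sup>2)"
  have int1: "integrable M (\<lambda>x. iexp (s * W x))" for s
    by (rule integrable_const_bound[where B = 1]) auto
  have int2: "integrable M (\<lambda>x. \<i> * complex_of_real (W x) * iexp (t * W x))"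
    using bdd_rv_integrable_cplx[OF W, of "\<lambda>x. \<i> * iexp (t * W x)"]
    by (simp add: norm_mult mult_ac)
  have bound: "cmod (\<phi> s - \<phi> t - (s - t) *\<^sub>R \<psi>) \<le> C / 2 * (s - t)\<^sup>2" for s
  proof -
    have eq: "\<phi> s - \<phi> t - (s - t) *\<^sub>R \<psi> =
      (\<integral>x. iexp (s * W x) - iexp (t * W x) - (s - t) *\<^sub>R (\<i> * complex_of_real (W x) * iexp (t * W x)) \<partial>M)"
      unfolding \<phi>_def \<psi>_def using int1 int2 by simp
    have "cmod (\<phi> s - \<phi> t - (s - t) *\<^sub>R \<psi>) \<le> expectation (\<lambda>x. (s - t)\<^sup>2 / 2 * (W x)\<^sup>2)"
      unfolding eq
    proof (rule norm_expectation_le)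
      show "integrable M (\<lambda>x. (s - t)\<^sup>2 / 2 * (W x)\<^sup>2)" using W by (intro bdd_rv_integrable) auto
      fix x
      have 1: "iexp (s * W x) = iexp (t * W x) * iexp ((s - t) * W x)"
        by (simp add: exp_add[symmetric] algebra_simps)
      have "iexp (s * W x) - iexp (t * W x) - (s - t) *\<^sub>R (\<i> * complex_of_real (W x) * iexp (t * W x))
        = iexp (t * W x) * (iexp ((s - t) * W x) - (\<Sum>k\<le>1. (\<i> * ((s - t) * W x))^k / fact k))"
        unfolding 1 by (simp add: algebra_simps scaleR_conv_of_real)
      also have "cmod \<dots> \<le> 1 * (\<bar>(s - t) * W x\<bar> ^ Suc 1 / fact (Suc 1))"
        unfolding norm_mult using iexp_approx1[of "(s - t) * W x" 1] by simp
      finally show "cmod (iexp (s * W x) - iexp (t * W x) - (s - t) *\<^sub>R (\<i> * complex_of_real (W x) * iexp (t * W x)))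
         \<le> (s - t)\<^sup>2 / 2 * (W x)\<^sup>2"
        using quadratic_remainder[where a = "s - t" and b = "W x"] by simp
    qed (use int1 int2 in auto)
    also have "\<dots> = C / 2 * (s - t)\<^sup>2" unfolding C_def by simp
    finally show ?thesis .
  qed
  have "((\<lambda>s. (\<phi> s - \<phi> t - (s - t) *\<^sub>R \<psi>) /\<^sub>R norm (s - t)) \<longlongrightarrow> 0) (at t within S)"
  proof (rule Lim_null_comparison)
    show "\<forall>\<^sub>F s in at t within S. norm ((\<phi> s - \<phi> t - (s - t) *\<^sub>R \<psi>) /\<^sub>R norm (s - t)) \<le> C / 2 * \<bar>s - t\<bar>"
    proof (rule eventually_at_topological[THEN iffD2], intro exI[of _ UNIV] conjI ballI impI)
      fix s assume "s \<noteq> t"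
      then have "norm ((\<phi> s - \<phi> t - (s - t) *\<^sub>R \<psi>) /\<^sub>R norm (s - t)) \<le> (C / 2 * (s - t)\<^sup>2) / \<bar>s - t\<bar>"
        using bound[of s] by (simp add: divide_simps)
      also have "\<dots> = C / 2 * \<bar>s - t\<bar>"
        using \<open>s \<noteq> t\<close> power2_abs[of "s - t"] by (simp add: power2_eq_square field_simps)
      finally show "norm ((\<phi> s - \<phi> t - (s - t) *\<^sub>R \<psi>) /\<^sub>R norm (s - t)) \<le> C / 2 * \<bar>s - t\<bar>" .
    qed auto
    show "((\<lambda>s. C / 2 * \<bar>s - t\<bar>) \<longlongrightarrow> 0) (at t within S)"
      by (auto intro!: tendsto_eq_intros)
  qed
  then have "(\<phi> has_vector_derivative \<psi>) (at t within S)"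
    unfolding has_vector_derivative_def has_derivative_at_within
    by (auto simp: divide_inverse_commute bounded_linear_scaleR_left algebra_simps)
  then show ?thesis
    unfolding \<phi>_def[abs_def] \<psi>_def .
qed

text \<open>The derivative of the characteristic function \<open>\<phi>\<close> of \<open>W\<close> is \<open>\<i> * c * (\<Sum>i. E (D i * iexp (t * W)))\<close>.
Subtracting the vanishing term \<open>E (D i * iexp (t * (W - D i)))\<close> and expanding to second order replaces
the summand by \<open>\<i> * t * E ((D i)\<^sup>2 * iexp (t * W))\<close>; if \<open>c * (\<Sum>i. (D i)\<^sup>2)\<close> is close to \<open>1\<close>, this says
\<open>\<phi>' t \<approx> - t * \<phi> t\<close>, the equation satisfied by \<open>exp (- t\<^sup>2 / 2)\<close>. For independent \<open>D i\<close> and \<open>c = 1\<close>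
this is Lyapunov's theorem; a quadratic form in independent variables is the case \<open>c = 1 / 2\<close>,
since each term of the form occurs in two of the \<open>D i\<close>.\<close>

theorem cf_normal_approximation:
  fixes D :: "'i \<Rightarrow> 'a \<Rightarrow> real"
  assumes I: "finite I" and D: "\<And>i. i \<in> I \<Longrightarrow> bdd_rv M (D i)"
    and W: "\<And>x. W x = c * (\<Sum>i\<in>I. D i x)"
    and orth: "\<And>i t. i \<in> I \<Longrightarrow> (\<integral>x. complex_of_real (D i x) * iexp (t * (W x - D i x)) \<partial>M) = 0"
  shows "cmod ((\<integral>x. iexp (t * W x) \<partial>M) - exp (- t\<^sup>2 / 2)) \<le>
    t\<^sup>2 * expectation (\<lambda>x. \<bar>c * (\<Sum>i\<in>I. (D i x)\<^sup>2) - 1\<bar>) +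
    \<bar>t\<bar> ^ 3 / 2 * (\<bar>c\<bar> * (\<Sum>i\<in>I. expectation (\<lambda>x. \<bar>D i x\<bar> ^ 3)))"
proof -
  define \<phi> where "\<phi> t = (\<integral>x. iexp (t * W x) \<partial>M)" for t
  define V where "V x = c * (\<Sum>i\<in>I. (D i x)\<^sup>2)" for x
  define \<delta> where "\<delta> = expectation (\<lambda>x. \<bar>V x - 1\<bar>)"
  define \<gamma> where "\<gamma> = \<bar>c\<bar> * (\<Sum>i\<in>I. expectation (\<lambda>x. \<bar>D i x\<bar> ^ 3))"
  have bW: "bdd_rv M W" unfolding W[abs_def] using D by (intro bdd_rv_mult bdd_rv_sum) auto
  have bV: "bdd_rv M V" unfolding V_def[abs_def] using D by (intro bdd_rv_mult bdd_rv_sum) auto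
  note [measurable] = bdd_rv_measurable[OF bW]
  have \<delta>0: "\<delta> \<ge> 0" unfolding \<delta>_def by simp
  have \<gamma>0: "\<gamma> \<ge> 0" unfolding \<gamma>_def by (auto intro!: mult_nonneg_nonneg sum_nonneg)
  define \<phi>' where "\<phi>' t = (\<integral>x. \<i> * complex_of_real (W x) * iexp (t * W x) \<partial>M)" for t
  have der: "(\<phi> has_vector_derivative \<phi>' t) (at t within S)" for t S
    using cf_has_derivative[OF bW] unfolding \<phi>_def[abs_def] \<phi>'_def .
  have int: "integrable M (\<lambda>x. complex_of_real (f x) * iexp (t * W x))" if "bdd_rv M f" for f t
    by (rule bdd_rv_integrable_cplx[OF that]) auto
  have key: "cmod (\<phi>' t + t * \<phi> t) \<le> \<bar>t\<bar> * \<delta> + t\<^sup>2 / 2 * \<gamma>" for t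
  proof -
    define r where "r i x = complex_of_real (D i x) * iexp (t * W x) -
        complex_of_real (D i x) * iexp (t * (W x - D i x)) -
        \<i> * t * (complex_of_real ((D i x)\<^sup>2) * iexp (t * W x))" for i x
    have int_i: "integrable M (\<lambda>x. complex_of_real (D i x) * iexp (t * (W x - D i x)))" if "i \<in> I" for i
      by (rule bdd_rv_integrable_cplx) (use bdd_rv_measurable[OF D[OF that]] D[OF that] in auto)
    have int_r: "integrable M (r i)" if "i \<in> I" for i
      unfolding r_def[abs_def] using D[OF that] int_i[OF that]
      by (intro Bochner_Integration.integrable_diff int integrable_mult_right) auto
    have r_eq: "(\<integral>x. complex_of_real (D i x) * iexp (t * W x) \<partial>M) =
       \<i> * t * (\<integral>x. complex_of_real ((D i x)\<^sup>2) * iexp (t * W x) \<partial>M) + (\<integral>x. r i x \<partial>M)" if i: "i \<in> I" for i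
    proof -
      have "(\<integral>x. r i x \<partial>M) = (\<integral>x. complex_of_real (D i x) * iexp (t * W x) \<partial>M)
         - (\<integral>x. complex_of_real (D i x) * iexp (t * (W x - D i x)) \<partial>M)
         - \<i> * t * (\<integral>x. complex_of_real ((D i x)\<^sup>2) * iexp (t * W x) \<partial>M)"
        unfolding r_def[abs_def] using D[OF i] int_i[OF i]
        by (subst Bochner_Integration.integral_diff;
            (intro Bochner_Integration.integrable_diff int integrable_mult_right; fastforce)?)
           (subst Bochner_Integration.integral_diff;
            (intro Bochner_Integration.integrable_diff int integrable_mult_right)?, auto intro!: int)
      then show ?thesis using orth[OF i] by simp
    qed
    have r_bound: "cmod (\<integral>x. r i x \<partial>M) \<le> t\<^sup>2 / 2 * expectation (\<lambda>x. \<bar>D i x\<bar> ^ 3)" if i: "i \<in> I" for i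
    proof -
      have "cmod (\<integral>x. r i x \<partial>M) \<le> expectation (\<lambda>x. t\<^sup>2 / 2 * \<bar>D i x\<bar> ^ 3)"
      proof (rule norm_expectation_le)
        show "integrable M (\<lambda>x. t\<^sup>2 / 2 * \<bar>D i x\<bar> ^ 3)" using D[OF i] by (intro bdd_rv_integrable) auto
        fix x
        have 1: "iexp (t * (W x - D i x)) = iexp (t * W x) * iexp (- (t * D i x))"
          by (simp add: exp_add[symmetric] algebra_simps)
        have "r i x = - (complex_of_real (D i x) * iexp (t * W x) *
           (iexp (- (t * D i x)) - (\<Sum>k\<le>1. (\<i> * (- (t * D i x)))^k / fact k)))"
          unfolding r_def 1 by (simp add: algebra_simps power2_eq_square)
        also have "cmod \<dots> = \<bar>D i x\<bar> * cmod (iexp (- (t * D i x)) - (\<Sum>k\<le>1. (\<i> * complex_of_real (- (t * D i x)))^k / fact k))"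
          by (simp add: norm_mult)
        also have "\<dots> \<le> \<bar>D i x\<bar> * (\<bar>- (t * D i x)\<bar> ^ Suc 1 / fact (Suc 1))"
          by (intro mult_left_mono iexp_approx1) auto
        also have "\<dots> = t\<^sup>2 / 2 * \<bar>D i x\<bar> ^ 3"
          using abs_mult_quadratic_remainder[where a = t and b = "D i x"] .
        finally show "cmod (r i x) \<le> t\<^sup>2 / 2 * \<bar>D i x\<bar> ^ 3" .
      qed (use int_r i in auto)
      then show ?thesis by simp
    qed
    have "\<phi>' t = \<i> * c * (\<Sum>i\<in>I. (\<integral>x. complex_of_real (D i x) * iexp (t * W x) \<partial>M))"
    proof -
      have "\<phi>' t = (\<integral>x. \<i> * c * (\<Sum>i\<in>I. complex_of_real (D i x) * iexp (t * W x)) \<partial>M)"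
        unfolding \<phi>'_def W[of "_"] by (simp add: sum_distrib_right sum_distrib_left mult_ac)
      also have "\<dots> = \<i> * c * (\<integral>x. (\<Sum>i\<in>I. complex_of_real (D i x) * iexp (t * W x)) \<partial>M)" by simp
      also have "(\<integral>x. (\<Sum>i\<in>I. complex_of_real (D i x) * iexp (t * W x)) \<partial>M) =
         (\<Sum>i\<in>I. (\<integral>x. complex_of_real (D i x) * iexp (t * W x) \<partial>M))"
        by (rule Bochner_Integration.integral_sum) (use D int in auto)
      finally show ?thesis .
    qed
    also have "\<dots> = - t * (c * (\<Sum>i\<in>I. (\<integral>x. complex_of_real ((D i x)\<^sup>2) * iexp (t * W x) \<partial>M)))
         + \<i> * c * (\<Sum>i\<in>I. (\<integral>x. r i x \<partial>M))"
    proof -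
      have "(\<Sum>i\<in>I. (\<integral>x. complex_of_real (D i x) * iexp (t * W x) \<partial>M)) =
        (\<Sum>i\<in>I. \<i> * t * (\<integral>x. complex_of_real ((D i x)\<^sup>2) * iexp (t * W x) \<partial>M) + (\<integral>x. r i x \<partial>M))"
        by (rule sum.cong[OF refl r_eq])
      also have "\<dots> = \<i> * t * (\<Sum>i\<in>I. (\<integral>x. complex_of_real ((D i x)\<^sup>2) * iexp (t * W x) \<partial>M))
          + (\<Sum>i\<in>I. (\<integral>x. r i x \<partial>M))"
        by (simp only: sum.distrib sum_distrib_left)
      finally show ?thesis by (simp only: algebra_simps) simp
    qed
    also have "c * (\<Sum>i\<in>I. (\<integral>x. complex_of_real ((D i x)\<^sup>2) * iexp (t * W x) \<partial>M)) =
        (\<integral>x. complex_of_real (V x) * iexp (t * W x) \<partial>M)"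
    proof -
      have "(\<integral>x. complex_of_real (V x) * iexp (t * W x) \<partial>M) =
         (\<integral>x. c * (\<Sum>i\<in>I. complex_of_real ((D i x)\<^sup>2) * iexp (t * W x)) \<partial>M)"
        unfolding V_def by (simp add: sum_distrib_right sum_distrib_left mult_ac)
      also have "\<dots> = c * (\<integral>x. (\<Sum>i\<in>I. complex_of_real ((D i x)\<^sup>2) * iexp (t * W x)) \<partial>M)" by simp
      also have "(\<integral>x. (\<Sum>i\<in>I. complex_of_real ((D i x)\<^sup>2) * iexp (t * W x)) \<partial>M) =
         (\<Sum>i\<in>I. (\<integral>x. complex_of_real ((D i x)\<^sup>2) * iexp (t * W x) \<partial>M))"
        by (rule Bochner_Integration.integral_sum) (use D int in blast)
      finally show ?thesis by simp
    qed
    finally have "\<phi>' t + t * \<phi> t = - t * ((\<integral>x. complex_of_real (V x) * iexp (t * W x) \<partial>M) - \<phi> t)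
        + \<i> * c * (\<Sum>i\<in>I. (\<integral>x. r i x \<partial>M))"
      by (simp add: algebra_simps)
    also have "(\<integral>x. complex_of_real (V x) * iexp (t * W x) \<partial>M) - \<phi> t =
       (\<integral>x. complex_of_real (V x - 1) * iexp (t * W x) \<partial>M)"
      unfolding \<phi>_def using int[OF bV, of t] int[of "\<lambda>_. 1" t]
      by (subst Bochner_Integration.integral_diff[symmetric]) (auto simp: algebra_simps)
    finally have "cmod (\<phi>' t + t * \<phi> t) \<le> \<bar>t\<bar> * cmod (\<integral>x. complex_of_real (V x - 1) * iexp (t * W x) \<partial>M)
        + \<bar>c\<bar> * cmod (\<Sum>i\<in>I. (\<integral>x. r i x \<partial>M))"
      by (simp only:) (rule order_trans[OF norm_triangle_ineq], simp add: norm_mult)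
    also have "cmod (\<integral>x. complex_of_real (V x - 1) * iexp (t * W x) \<partial>M) \<le> \<delta>"
      unfolding \<delta>_def
      by (rule norm_expectation_le[OF int]) (use bV in \<open>auto simp: norm_mult simp flip: of_real_diff\<close>)
    also have "cmod (\<Sum>i\<in>I. (\<integral>x. r i x \<partial>M)) \<le> (\<Sum>i\<in>I. t\<^sup>2 / 2 * expectation (\<lambda>x. \<bar>D i x\<bar> ^ 3))"
      by (rule sum_norm_le) (use r_bound in auto)
    also have "\<bar>c\<bar> * (\<Sum>i\<in>I. t\<^sup>2 / 2 * expectation (\<lambda>x. \<bar>D i x\<bar> ^ 3)) = t\<^sup>2 / 2 * \<gamma>"
      unfolding \<gamma>_def by (simp add: sum_distrib_left mult_ac)
    finally show ?thesis by (simp add: mult_left_mono)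
  qed
  \<comment> \<open>The approximate differential equation makes the quotient of \<open>\<phi>\<close> and the Gaussian almost constant.\<close>
  define g where "g s = exp (s\<^sup>2 / 2) *\<^sub>R \<phi> s" for s :: real
  define B where "B = exp (t\<^sup>2 / 2) * (\<bar>t\<bar> * \<delta> + t\<^sup>2 / 2 * \<gamma>)"
  have "cmod (g t - g 0) \<le> B * norm (t - 0)"
  proof (rule differentiable_bound)
    show "convex {- \<bar>t\<bar> .. \<bar>t\<bar>}" "t \<in> {- \<bar>t\<bar> .. \<bar>t\<bar>}" "0 \<in> {- \<bar>t\<bar> .. \<bar>t\<bar>}" by auto
    show "(g has_derivative (\<lambda>h. h *\<^sub>R (exp (s\<^sup>2 / 2) *\<^sub>R (\<phi>' s + s * \<phi> s)))) (at s within {- \<bar>t\<bar> .. \<bar>t\<bar>})" for s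
      unfolding has_vector_derivative_def[symmetric] g_def[abs_def]
      by (rule has_vector_derivative_eq_rhs, rule has_vector_derivative_scaleR[OF _ der])
         (auto intro!: derivative_eq_intros simp: scaleR_conv_of_real algebra_simps)
    fix s assume s: "s \<in> {- \<bar>t\<bar> .. \<bar>t\<bar>}"
    then have "\<bar>s\<bar> \<le> \<bar>t\<bar>" by auto
    then have st: "s\<^sup>2 \<le> t\<^sup>2" by (simp add: abs_le_square_iff)
    have "cmod (exp (s\<^sup>2 / 2) *\<^sub>R (\<phi>' s + s * \<phi> s)) \<le> exp (s\<^sup>2 / 2) * (\<bar>s\<bar> * \<delta> + s\<^sup>2 / 2 * \<gamma>)"
      using key[of s] by simp
    also have "\<dots> \<le> B" unfolding B_def
      using st \<open>\<bar>s\<bar> \<le> \<bar>t\<bar>\<close> \<delta>0 \<gamma>0 by (intro mult_mono add_mono) auto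
    finally have le: "cmod (exp (s\<^sup>2 / 2) *\<^sub>R (\<phi>' s + s * \<phi> s)) \<le> B" .
    show "onorm (\<lambda>h. h *\<^sub>R (exp (s\<^sup>2 / 2) *\<^sub>R (\<phi>' s + s * \<phi> s))) \<le> B"
    proof (rule onorm_le)
      show "norm (h *\<^sub>R (exp (s\<^sup>2 / 2) *\<^sub>R (\<phi>' s + s * \<phi> s))) \<le> B * norm h" for h
        unfolding norm_scaleR[of h] using mult_right_mono[OF le, of "norm h"] by (simp only: mult.commute real_norm_def abs_ge_zero)
    qed
  qed
  moreover have "g 0 = 1" unfolding g_def \<phi>_def by (simp add: prob_space)
  ultimately have *: "cmod (g t - 1) \<le> B * \<bar>t\<bar>" by simp
  have ee: "exp (- t\<^sup>2 / 2) * exp (t\<^sup>2 / 2) = (1::real)" by (simp flip: exp_add)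
  have "\<phi> t - complex_of_real (exp (- t\<^sup>2 / 2)) = exp (- t\<^sup>2 / 2) *\<^sub>R (g t - 1)"
    unfolding g_def scaleR_diff_right scaleR_scaleR ee by (simp add: scaleR_conv_of_real)
  then have "cmod (\<phi> t - complex_of_real (exp (- t\<^sup>2 / 2))) \<le> exp (- t\<^sup>2 / 2) * (B * \<bar>t\<bar>)"
    using * by simp
  also have "\<dots> = (exp (- t\<^sup>2 / 2) * exp (t\<^sup>2 / 2)) * (\<bar>t\<bar> * \<bar>t\<bar> * \<delta> + \<bar>t\<bar> * t\<^sup>2 / 2 * \<gamma>)"
    unfolding B_def by (simp only: algebra_simps) simp
  also have "\<dots> = t\<^sup>2 * \<delta> + \<bar>t\<bar> ^ 3 / 2 * \<gamma>"
    unfolding ee by (simp add: power2_eq_square power3_eq_cube)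
  finally show ?thesis unfolding \<phi>_def \<delta>_def \<gamma>_def V_def by (simp add: exp_of_real)
qed

end

section \<open>Symmetries of an array of independent symmetric variables\<close>

definition flip :: "nat \<times> nat \<Rightarrow> (nat \<times> nat \<Rightarrow> real) \<Rightarrow> nat \<times> nat \<Rightarrow> real" where
  "flip e x = x(e := - x e)"

definition offdiag :: "nat set \<Rightarrow> (nat \<times> nat) set" where
  "offdiag A = {(k, l). k \<in> A \<and> l \<in> A \<and> k \<noteq> l}"

lemma finite_offdiag [simp]: "finite A \<Longrightarrow> finite (offdiag A)"
  by (rule finite_subset[of _ "A \<times> A"]) (auto simp: offdiag_def)

lemma square_sum_offdiag:
  fixes f :: "nat \<Rightarrow> real"
  assumes A: "finite A"
  shows "(\<Sum>k\<in>A. f k)\<^sup>2 = (\<Sum>k\<in>A. (f k)\<^sup>2) + (\<Sum>e\<in>offdiag A. f (fst e) * f (snd e))"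
proof -
  have "(\<Sum>k\<in>A. f k)\<^sup>2 = (\<Sum>e\<in>A \<times> A. f (fst e) * f (snd e))"
    by (simp add: power2_eq_square sum_product sum.cartesian_product case_prod_unfold)
  also have "A \<times> A = (\<lambda>k. (k, k)) ` A \<union> offdiag A"
    by (auto simp: offdiag_def)
  also have "(\<Sum>e\<in>\<dots>. f (fst e) * f (snd e)) =
      (\<Sum>e\<in>(\<lambda>k. (k, k)) ` A. f (fst e) * f (snd e)) + (\<Sum>e\<in>offdiag A. f (fst e) * f (snd e))"
    by (rule sum.union_disjoint) (use A in simp, use A in simp, auto simp: offdiag_def)
  also have "(\<Sum>e\<in>(\<lambda>k. (k, k)) ` A. f (fst e) * f (snd e)) = (\<Sum>k\<in>A. (f k)\<^sup>2)"
    by (subst sum.reindex) (auto simp: inj_on_def power2_eq_square)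
  finally show ?thesis .
qed

lemma card_offdiag: "real (card (offdiag {..<m})) = real m * (real m - 1)"
proof -
  have "offdiag {..<m} = ({..<m} \<times> {..<m}) - (\<lambda>j. (j, j)) ` {..<m}"
    by (auto simp: offdiag_def)
  then have "card (offdiag {..<m}) = m * m - m"
    by (simp add: card_Diff_subset image_subset_iff card_image inj_on_def)
  then show ?thesis by (cases m) (auto simp: of_nat_diff algebra_simps)
qed

lemma sum_offdiag: "(\<Sum>e\<in>offdiag {..<m}. f (fst e) (snd e)) = (\<Sum>j<m. \<Sum>l\<in>{..<m} - {j}. f j l)"
proof -
  have "offdiag {..<m} = Sigma {..<m} (\<lambda>j. {..<m} - {j})" by (auto simp: offdiag_def)
  then show ?thesis by (simp add: sum.Sigma case_prod_unfold)
qed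

text \<open>One infinite array with law \<open>\<mu>\<close> for every entry serves all sample sizes at once: the statistic
for given \<open>n\<close> and \<open>p\<close> reads only the entries with \<open>i < p\<close> and \<open>j < n\<close>.\<close>

locale symmetric_array =
  fixes \<mu> :: "real measure"
  assumes prob_mu: "prob_space \<mu>"
    and sets_mu: "sets \<mu> = sets borel"
    and symmetric_mu: "distr \<mu> borel uminus = \<mu>"
    and null_mu: "measure \<mu> {0} = 0"
begin

definition N :: "(nat \<times> nat \<Rightarrow> real) measure" where
  "N = (\<Pi>\<^sub>M e\<in>UNIV. \<mu>)"

lemma prob_N: "prob_space N"
  unfolding N_def by (intro prob_space_PiM prob_mu)

sublocale prob_space N by (rule prob_N)

lemma sets_N: "sets N = sets (\<Pi>\<^sub>M e\<in>UNIV. borel)"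
  unfolding N_def by (intro sets_PiM_cong) (auto simp: sets_mu)

lemma coord_measurable [measurable]: "(\<lambda>x. x e) \<in> borel_measurable N"
proof -
  have "(\<lambda>x. x e) \<in> borel_measurable (\<Pi>\<^sub>M e\<in>UNIV. (borel :: real measure))" by measurable
  then show ?thesis by (simp cong: measurable_cong_sets add: measurable_cong_sets[OF sets_N refl])
qed

lemma measurable_into_N:
  assumes "\<And>e. (\<lambda>z. f z e) \<in> borel_measurable K"
  shows "f \<in> measurable K N"
proof -
  have "f \<in> measurable K (\<Pi>\<^sub>M e\<in>UNIV. (borel :: real measure))"
    using measurable_restrict[of UNIV "\<lambda>e z. f z e" K "\<lambda>_. borel"] assms by (simp add: restrict_def)
  then show ?thesis by (simp add: measurable_cong_sets[OF refl sets_N])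
qed

lemma distr_coord: "distr N borel (\<lambda>x. x e) = \<mu>"
proof -
  have "distr N borel (\<lambda>x. x e) = distr N \<mu> (\<lambda>x. x e)"
    by (rule distr_cong) (auto simp: sets_mu)
  also have "\<dots> = \<mu>" unfolding N_def
    by (rule distr_PiM_component) (auto intro: prob_mu)
  finally show ?thesis .
qed

lemma expectation_coord:
  fixes f :: "real \<Rightarrow> real"
  assumes "f \<in> borel_measurable borel"
  shows "expectation (\<lambda>x. f (x e)) = integral\<^sup>L \<mu> f"
  using integral_distr[of "\<lambda>x. x e" N borel f] assms by (simp add: distr_coord)

lemma indep_coords: "indep_vars (\<lambda>_. borel) (\<lambda>e x. x e) (UNIV :: (nat \<times> nat) set)"
proof (subst indep_vars_iff_distr_eq_PiM')
  have "distr N (\<Pi>\<^sub>M i\<in>UNIV. borel) (\<lambda>x. \<lambda>i\<in>UNIV. x i) = distr N N (\<lambda>x. x)"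
    by (rule distr_cong) (auto simp: sets_N)
  also have "\<dots> = N" by (rule distr_id)
  finally show "distr N (\<Pi>\<^sub>M i\<in>UNIV. borel) (\<lambda>x. \<lambda>i\<in>UNIV. x i) = (\<Pi>\<^sub>M i\<in>UNIV. distr N borel (\<lambda>x. x i))"
    by (simp add: distr_coord N_def[symmetric])
qed auto

lemma distr_flip: "distr N N (flip e) = N"
proof -
  define Y :: "nat \<times> nat \<Rightarrow> real \<Rightarrow> real" where "Y = (\<lambda>e'. if e' = e then uminus else id)"
  have Y [measurable]: "Y e' \<in> borel_measurable borel" for e' unfolding Y_def by simp
  have "indep_vars (\<lambda>_. borel) (\<lambda>e' x. Y e' (x e')) UNIV"
    by (rule indep_vars_compose2[OF indep_coords]) auto
  then have joint: "distr N (\<Pi>\<^sub>M i\<in>UNIV. borel) (\<lambda>x. \<lambda>e'\<in>UNIV. Y e' (x e')) = (\<Pi>\<^sub>M i\<in>UNIV. distr N borel (\<lambda>x. Y i (x i)))"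
    by (subst (asm) indep_vars_iff_distr_eq_PiM') auto
  have eq: "(\<lambda>x. \<lambda>e'\<in>UNIV. Y e' (x e')) = flip e"
    by (auto simp: fun_eq_iff Y_def flip_def)
  have "distr N borel (\<lambda>x. Y i (x i)) = \<mu>" for i
  proof -
    have "distr N borel (\<lambda>x. Y i (x i)) = distr (distr N borel (\<lambda>x. x i)) borel (Y i)"
      by (subst distr_distr) (auto simp: comp_def)
    also have "\<dots> = \<mu>"
      using sets_mu symmetric_mu by (auto simp: Y_def distr_coord id_def intro: distr_id2)
    finally show ?thesis .
  qed
  then have "distr N (\<Pi>\<^sub>M i\<in>UNIV. borel) (flip e) = N"
    using joint unfolding eq by (simp add: N_def)
  moreover have "distr N N (flip e) = distr N (\<Pi>\<^sub>M i\<in>UNIV. borel) (flip e)"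
    by (rule distr_cong) (auto simp: sets_N)
  ultimately show ?thesis by simp
qed

lemma distr_reindex:
  assumes "inj \<pi>"
  shows "distr N N (\<lambda>x. x \<circ> \<pi>) = N"
proof -
  have "distr (Pi\<^sub>M UNIV (\<lambda>_. \<mu>)) (\<Pi>\<^sub>M i\<in>UNIV. \<mu>) (\<lambda>\<omega>. \<lambda>n\<in>UNIV. \<omega> (\<pi> n)) = (\<Pi>\<^sub>M i\<in>UNIV. \<mu>)"
    by (rule distr_PiM_reindex) (use assms in \<open>auto intro: prob_mu\<close>)
  also have "(\<lambda>\<omega>. \<lambda>n\<in>UNIV. \<omega> (\<pi> n)) = (\<lambda>x. x \<circ> \<pi>)"
    by (auto simp: fun_eq_iff)
  finally show ?thesis by (simp add: N_def comp_def)
qed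

lemma flip_measurable [measurable]: "flip e \<in> measurable N N"
  by (rule measurable_into_N) (unfold flip_def fun_upd_apply, measurable)

lemma reindex_measurable [measurable]: "(\<lambda>x. x \<circ> \<pi>) \<in> measurable N N"
  by (rule measurable_into_N) (unfold comp_def, measurable)

lemma expectation_flip: "f \<in> borel_measurable N \<Longrightarrow> expectation (\<lambda>x. f (flip e x)) = (expectation f :: real)"
  using integral_distr[OF flip_measurable, of f e] by (simp add: distr_flip)

lemma expectation_reindex:
  "f \<in> borel_measurable N \<Longrightarrow> inj \<pi> \<Longrightarrow> expectation (\<lambda>x. f (x \<circ> \<pi>)) = (expectation f :: real)"
  using integral_distr[OF reindex_measurable, of f \<pi>] by (simp add: distr_reindex)

text \<open>All moments that vanish by sign symmetry are instances of this.\<close>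

lemma expectation_odd:
  fixes f :: "_ \<Rightarrow> real"
  assumes "f \<in> borel_measurable N" "\<And>x. f (flip e x) = - f x"
  shows "expectation f = 0"
  using expectation_flip[OF assms(1), of e] assms(2) by simp

lemma AE_coord_nonzero: "AE x in N. x e \<noteq> 0"
proof -
  interpret mu: prob_space \<mu> by (rule prob_mu)
  have "AE z in \<mu>. z \<noteq> 0"
    using AE_not_in[of "{0}" \<mu>] null_mu by (auto simp: null_sets_def sets_mu mu.emeasure_eq_measure)
  then have "AE z in distr N borel (\<lambda>x. x e). z \<noteq> 0" unfolding distr_coord .
  then show ?thesis by (subst (asm) AE_distr_iff) auto
qed

end

section \<open>Self-normalised rows and their correlations\<close>

locale correlation_array = symmetric_array +
  fixes n p :: nat
  assumes n2: "n \<ge> 2" and p2: "p \<ge> 2"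
begin

definition rsq :: "nat \<Rightarrow> (nat \<times> nat \<Rightarrow> real) \<Rightarrow> real" where
  "rsq i x = (\<Sum>k<n. (x (i, k))\<^sup>2)"

definition y :: "nat \<Rightarrow> nat \<Rightarrow> (nat \<times> nat \<Rightarrow> real) \<Rightarrow> real" where
  "y i j x = x (i, j) / sqrt (rsq i x)"

definition a :: "nat \<Rightarrow> nat \<Rightarrow> (nat \<times> nat \<Rightarrow> real) \<Rightarrow> real" where
  "a i j x = (y i j x)\<^sup>2"

definition Q :: "nat \<Rightarrow> nat \<Rightarrow> (nat \<times> nat \<Rightarrow> real) \<Rightarrow> real" where
  "Q i k x = (\<Sum>j<n. a i j x * a k j x)"

definition q :: "nat \<Rightarrow> nat \<Rightarrow> (nat \<times> nat \<Rightarrow> real) \<Rightarrow> real" where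
  "q i k x = (\<Sum>j<n. (a i j x)\<^sup>2 * (a k j x)\<^sup>2)"

definition Z :: "nat \<Rightarrow> nat \<times> nat \<Rightarrow> (nat \<times> nat \<Rightarrow> real) \<Rightarrow> real" where
  "Z i e x = y i (fst e) x * y i (snd e) x"

definition H :: "nat \<Rightarrow> nat \<Rightarrow> (nat \<times> nat \<Rightarrow> real) \<Rightarrow> real" where
  "H i k x = (\<Sum>e\<in>offdiag {..<n}. Z i e x * Z k e x)"

text \<open>The indicator of the truncation event. It depends on the absolute values of the entries only, so
it does not interfere with sign arguments; typically \<open>Q i k\<close> is close to \<open>1 / n\<close>.\<close>

definition cut :: "nat \<Rightarrow> nat \<Rightarrow> (nat \<times> nat \<Rightarrow> real) \<Rightarrow> real" where
  "cut i k x = (if Q i k x \<le> 2 / real n then 1 else 0)"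

lemma n_pos: "real n > 0" and p_pos: "real p > 0" using n2 p2 by auto

lemma rsq_nonneg [simp]: "rsq i x \<ge> 0"
  unfolding rsq_def by (intro sum_nonneg) auto

lemma rsq_measurable [measurable]: "rsq i \<in> borel_measurable N"
  unfolding rsq_def[abs_def] by measurable

lemma y_measurable [measurable]: "y i j \<in> borel_measurable N"
  unfolding y_def[abs_def] by measurable

lemma a_nonneg [simp]: "a i j x \<ge> 0"
  unfolding a_def by simp

lemma a_eq: "a i j x = (x (i, j))\<^sup>2 / rsq i x"
  unfolding a_def y_def by (simp add: power_divide)

lemma sum_a_le_1: "(\<Sum>j<n. a i j x) \<le> 1"
  unfolding a_eq sum_divide_distrib[symmetric] rsq_def[symmetric] by simp

lemma sum_a_eq_1: "rsq i x \<noteq> 0 \<Longrightarrow> (\<Sum>j<n. a i j x) = 1"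
  unfolding a_eq sum_divide_distrib[symmetric] rsq_def[symmetric] by simp

lemma a_le_1: "j < n \<Longrightarrow> a i j x \<le> 1"
  using member_le_sum[of j "{..<n}" "\<lambda>j. a i j x"] sum_a_le_1[of i x] by auto

lemma y_le_1: "j < n \<Longrightarrow> \<bar>y i j x\<bar> \<le> 1"
  using a_le_1[of j i x] unfolding a_def by (simp add: abs_square_le_1)

lemma AE_rsq: "AE x in N. rsq i x \<noteq> 0"
  using AE_coord_nonzero[of "(i, 0)"]
proof eventually_elim
  case (elim x)
  have "0 < (x (i, 0))\<^sup>2" using elim by simp
  also have "\<dots> \<le> rsq i x" unfolding rsq_def using n2 by (intro member_le_sum) auto
  finally show ?case by simp
qed

lemma bdd_y [intro!]: "j < n \<Longrightarrow> bdd_rv N (y i j)"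
  by (rule bdd_rvI[where B = 1]) (auto intro: y_le_1)

lemma bdd_a [intro!]: "j < n \<Longrightarrow> bdd_rv N (a i j)"
  unfolding a_def[abs_def] by auto

lemma bdd_Z [intro!]: "e \<in> offdiag {..<n} \<Longrightarrow> bdd_rv N (Z i e)"
  unfolding Z_def[abs_def] by (auto simp: offdiag_def)

lemma bdd_Q [intro!]: "bdd_rv N (Q i k)"
  unfolding Q_def[abs_def] by auto

lemma bdd_q [intro!]: "bdd_rv N (q i k)"
  unfolding q_def[abs_def] by auto

lemma bdd_H [intro!]: "bdd_rv N (H i k)"
  unfolding H_def[abs_def] by (intro bdd_rv_sum bdd_rv_mult bdd_Z)

lemma bdd_cut [intro!]: "bdd_rv N (cut i k)"
proof -
  have [measurable]: "Q i k \<in> borel_measurable N" by (rule bdd_rv_measurable) auto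
  show ?thesis
    by (rule bdd_rvI[where B = 1]) (auto simp: cut_def[abs_def])
qed

lemma rsq_flip [simp]: "rsq i (flip e x) = rsq i x"
  unfolding rsq_def flip_def by (intro sum.cong) auto

lemma y_flip: "y i j (flip e x) = (if e = (i, j) then - y i j x else y i j x)"
  unfolding y_def rsq_flip by (auto simp: flip_def)

lemma y_flip_other [simp]: "r \<noteq> i \<Longrightarrow> y i j (flip (r, l) x) = y i j x"
  by (simp add: y_flip)

lemma Z_flip_other [simp]: "r \<noteq> i \<Longrightarrow> Z i e (flip (r, l) x) = Z i e x"
  by (simp add: Z_def)

lemma H_flip_other [simp]: "r \<noteq> i \<Longrightarrow> r \<noteq> k \<Longrightarrow> H i k (flip (r, l) x) = H i k x"
  by (simp add: H_def)

lemma a_flip [simp]: "a i j (flip e x) = a i j x"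
  by (simp add: a_def y_flip)

lemma Q_flip [simp]: "Q i k (flip e x) = Q i k x"
  by (simp add: Q_def)

lemma q_flip [simp]: "q i k (flip e x) = q i k x"
  by (simp add: q_def)

lemma cut_flip [simp]: "cut i k (flip e x) = cut i k x"
  by (simp add: cut_def)

lemma H_sym: "H i k x = H k i x" unfolding H_def by (simp add: mult.commute)
lemma Q_sym: "Q i k x = Q k i x" unfolding Q_def by (simp add: mult.commute)
lemma q_sym: "q i k x = q k i x" unfolding q_def by (simp add: mult.commute)
lemma cut_sym: "cut i k x = cut k i x" unfolding cut_def by (simp add: Q_sym)

lemma Q_nonneg [simp]: "Q i k x \<ge> 0" unfolding Q_def by (intro sum_nonneg) auto
lemma q_nonneg [simp]: "q i k x \<ge> 0" unfolding q_def by (intro sum_nonneg) auto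
lemma cut_nonneg [simp]: "cut i k x \<ge> 0" and cut_le_1 [simp]: "cut i k x \<le> 1"
  and cut_idem [simp]: "cut i k x * cut i k x = cut i k x"
  unfolding cut_def by auto

lemma correlation_square: "(\<Sum>j<n. y i j x * y k j x)\<^sup>2 = Q i k x + H i k x"
  unfolding square_sum_offdiag[OF finite_lessThan] Q_def H_def Z_def a_def by (simp add: power_mult_distrib mult_ac)

lemma sum_Z_squares: "(\<Sum>e\<in>offdiag {..<n}. (Z i e x)\<^sup>2 * (Z k e x)\<^sup>2) = (Q i k x)\<^sup>2 - q i k x"
proof -
  have "(Z i e x)\<^sup>2 * (Z k e x)\<^sup>2 = (a i (fst e) x * a k (fst e) x) * (a i (snd e) x * a k (snd e) x)" for e
    unfolding Z_def a_def power_mult_distrib by (simp only: mult_ac)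
  then show ?thesis
    unfolding Q_def square_sum_offdiag[OF finite_lessThan] q_def power_mult_distrib by simp
qed

lemma q_le_Q: "q i k x \<le> (Q i k x)\<^sup>2"
  using sum_Z_squares[of i x k] sum_nonneg[of "offdiag {..<n}" "\<lambda>e. (Z i e x)\<^sup>2 * (Z k e x)\<^sup>2"] by simp

lemma cut_Q_le: "cut i k x * (Q i k x)\<^sup>2 \<le> 4 / (real n)\<^sup>2"
proof (cases "Q i k x \<le> 2 / real n")
  case True
  then have "(Q i k x)\<^sup>2 \<le> (2 / real n)\<^sup>2" by (intro power_mono) auto
  then show ?thesis by (simp add: cut_def power_divide)
qed (simp add: cut_def)

text \<open>Invariance under the sign changes in row \<open>i\<close>. It holds for everything that does not involve row
\<open>i\<close>, but also for what depends on row \<open>i\<close> through absolute values only.\<close>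

definition flip_inv :: "nat \<Rightarrow> ((nat \<times> nat \<Rightarrow> real) \<Rightarrow> real) \<Rightarrow> bool" where
  "flip_inv i G \<longleftrightarrow> (\<forall>j x. G (flip (i, j) x) = G x)"

lemma Z_flip:
  "e \<in> offdiag {..<n} \<Longrightarrow> Z i e (flip (i, j) x) = (if j = fst e \<or> j = snd e then - Z i e x else Z i e x)"
  by (auto simp: Z_def y_flip offdiag_def)

lemma expectation_Z_zero:
  assumes e: "e \<in> offdiag {..<n}" and G: "bdd_rv N G" "flip_inv i G"
  shows "expectation (\<lambda>x. Z i e x * G x) = 0"
proof (rule expectation_odd[where e = "(i, fst e)"])
  show "(\<lambda>x. Z i e x * G x) \<in> borel_measurable N"
    using e G by (intro bdd_rv_measurable bdd_rv_mult bdd_Z)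
  show "Z i e (flip (i, fst e) x) * G (flip (i, fst e) x) = - (Z i e x * G x)" for x
    using e G(2) by (auto simp: Z_def y_flip flip_inv_def offdiag_def)
qed

text \<open>Two different unordered pairs of columns have an index in exactly one of them; changing the sign of that entry
changes the sign of the product.\<close>

lemma expectation_Z_Z_zero:
  assumes e: "e \<in> offdiag {..<n}" "e' \<in> offdiag {..<n}" "e' \<noteq> e" "e' \<noteq> prod.swap e" and G: "bdd_rv N G" "flip_inv i G"
  shows "expectation (\<lambda>x. Z i e x * Z i e' x * G x) = 0"
proof -
  \<comment> \<open>The column that occurs in \<open>e\<close> but not in \<open>e'\<close>.\<close>
  define j where "j = (if fst e \<noteq> fst e' \<and> fst e \<noteq> snd e' then fst e else snd e)"
  show ?thesis
  proof (rule expectation_odd[where e = "(i, j)"])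
    show "(\<lambda>x. Z i e x * Z i e' x * G x) \<in> borel_measurable N"
      using e G by (intro bdd_rv_measurable bdd_rv_mult bdd_Z)
    show "Z i e (flip (i, j) x) * Z i e' (flip (i, j) x) * G (flip (i, j) x) = - (Z i e x * Z i e' x * G x)" for x
    proof -
      have "j = fst e \<or> j = snd e" "\<not> (j = fst e' \<or> j = snd e')"
        using e by (cases e; cases e'; auto simp: j_def offdiag_def split: if_splits)+
      moreover have "G (flip (i, j) x) = G x" using G(2) by (simp add: flip_inv_def)
      ultimately show ?thesis using e by (simp only: Z_flip if_True if_False mult_minus_left)
    qed
  qed
qed

lemma Z_swap: "Z i (prod.swap e) x = Z i e x"
  unfolding Z_def by (simp add: mult.commute)

text \<open>Averaging over the signs in row \<open>i\<close> retains from \<open>H i k\<close> only the terms \<open>e\<close> and \<open>prod.swap e\<close>,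
which coincide.\<close>

lemma expectation_Z_H:
  assumes e: "e \<in> offdiag {..<n}" and ik: "i \<noteq> k" and G: "bdd_rv N G" "flip_inv i G"
  shows "expectation (\<lambda>x. Z i e x * H i k x * G x) = 2 * expectation (\<lambda>x. (Z i e x)\<^sup>2 * Z k e x * G x)"
proof -
  have "expectation (\<lambda>x. Z i e x * H i k x * G x) =
      expectation (\<lambda>x. \<Sum>e'\<in>offdiag {..<n}. Z i e x * Z i e' x * (Z k e' x * G x))"
    unfolding H_def by (simp add: sum_distrib_left sum_distrib_right mult_ac)
  also have "\<dots> = (\<Sum>e'\<in>offdiag {..<n}. expectation (\<lambda>x. Z i e x * Z i e' x * (Z k e' x * G x)))"
    by (rule expectation_sum) (use e G in \<open>auto\<close>)
  also have "\<dots> = (\<Sum>e'\<in>{e, prod.swap e}. expectation (\<lambda>x. Z i e x * Z i e' x * (Z k e' x * G x)))"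
  proof (rule sum.mono_neutral_right)
    show "{e, prod.swap e} \<subseteq> offdiag {..<n}" using e by (auto simp: offdiag_def)
    show "\<forall>e'\<in>offdiag {..<n} - {e, prod.swap e}. expectation (\<lambda>x. Z i e x * Z i e' x * (Z k e' x * G x)) = 0"
      using e G ik by (auto intro!: expectation_Z_Z_zero simp: flip_inv_def)
  qed simp
  also have "\<dots> = 2 * expectation (\<lambda>x. (Z i e x)\<^sup>2 * Z k e x * G x)"
    using e by (subst sum.insert) (auto simp: Z_swap power2_eq_square mult_ac offdiag_def)
  finally show ?thesis .
qed

text \<open>Conditionally on the absolute values, \<open>H i k\<close> has variance \<open>2 * ((Q i k)\<^sup>2 - q i k)\<close>.\<close>

lemma expectation_H_sq:
  assumes ik: "i \<noteq> k" and G: "bdd_rv N G" "flip_inv i G"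
  shows "expectation (\<lambda>x. (H i k x)\<^sup>2 * G x) = 2 * expectation (\<lambda>x. ((Q i k x)\<^sup>2 - q i k x) * G x)"
proof -
  have "expectation (\<lambda>x. (H i k x)\<^sup>2 * G x) = expectation (\<lambda>x. \<Sum>e\<in>offdiag {..<n}. Z i e x * H i k x * (Z k e x * G x))"
    unfolding power2_eq_square by (subst H_def) (simp add: sum_distrib_left sum_distrib_right mult_ac)
  also have "\<dots> = (\<Sum>e\<in>offdiag {..<n}. expectation (\<lambda>x. Z i e x * H i k x * (Z k e x * G x)))"
    by (rule expectation_sum) (use G in auto)
  also have "\<dots> = (\<Sum>e\<in>offdiag {..<n}. 2 * expectation (\<lambda>x. (Z i e x)\<^sup>2 * Z k e x * (Z k e x * G x)))"
    using G ik by (intro sum.cong refl expectation_Z_H) (auto simp: flip_inv_def)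
  also have "\<dots> = 2 * (\<Sum>e\<in>offdiag {..<n}. expectation (\<lambda>x. (Z i e x)\<^sup>2 * Z k e x * (Z k e x * G x)))"
    by (simp add: sum_distrib_left)
  also have "(\<Sum>e\<in>offdiag {..<n}. expectation (\<lambda>x. (Z i e x)\<^sup>2 * Z k e x * (Z k e x * G x))) =
      expectation (\<lambda>x. \<Sum>e\<in>offdiag {..<n}. (Z i e x)\<^sup>2 * Z k e x * (Z k e x * G x))"
    by (rule expectation_sum[symmetric]) (use G in auto)
  also have "\<dots> = expectation (\<lambda>x. ((Q i k x)\<^sup>2 - q i k x) * G x)"
    unfolding sum_Z_squares[symmetric] by (simp add: power2_eq_square sum_distrib_left sum_distrib_right mult_ac)
  finally show ?thesis .
qed

text \<open>Along the cycle \<open>i - k - i' - l - i\<close> the sign averages over the rows \<open>i\<close>, \<open>l\<close>, \<open>i'\<close> force the same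
unordered pair of columns on all four edges, so only a single sum over pairs remains instead of four.\<close>

lemma expectation_H_cycle:
  assumes d: "distinct [i, i', k, l]" and G: "bdd_rv N G" "\<And>r. flip_inv r G"
  shows "expectation (\<lambda>x. H i k x * H i l x * H i' k x * H i' l x * G x) =
    8 * (\<Sum>e\<in>offdiag {..<n}. expectation (\<lambda>x. (Z i e x * Z k e x)\<^sup>2 * (Z i' e x * Z l e x)\<^sup>2 * G x))"
proof -
  have G': "G (flip e x) = G x" for e x using G(2) by (cases e) (simp add: flip_inv_def)
  have "expectation (\<lambda>x. H i k x * H i l x * H i' k x * H i' l x * G x) =
     expectation (\<lambda>x. \<Sum>e\<in>offdiag {..<n}. Z i e x * H i l x * (Z k e x * H i' k x * H i' l x * G x))"
    by (subst H_def[of i k]) (simp add: sum_distrib_left sum_distrib_right mult_ac)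
  also have "\<dots> = (\<Sum>e\<in>offdiag {..<n}. expectation (\<lambda>x. Z i e x * H i l x * (Z k e x * H i' k x * H i' l x * G x)))"
    by (rule expectation_sum) (use G in auto)
  also have "\<dots> = (\<Sum>e\<in>offdiag {..<n}. 8 * expectation (\<lambda>x. (Z i e x * Z k e x)\<^sup>2 * (Z i' e x * Z l e x)\<^sup>2 * G x))"
  proof (rule sum.cong[OF refl])
    fix e assume e: "e \<in> offdiag {..<n}"
    have "expectation (\<lambda>x. Z i e x * H i l x * (Z k e x * H i' k x * H i' l x * G x)) =
      2 * expectation (\<lambda>x. (Z i e x)\<^sup>2 * Z l e x * (Z k e x * H i' k x * H i' l x * G x))"
      using d G e by (intro expectation_Z_H) (auto simp: flip_inv_def)
    also have "expectation (\<lambda>x. (Z i e x)\<^sup>2 * Z l e x * (Z k e x * H i' k x * H i' l x * G x)) =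
      expectation (\<lambda>x. Z l e x * H l i' x * ((Z i e x)\<^sup>2 * Z k e x * H i' k x * G x))"
      by (simp add: H_sym[of l i'] mult_ac)
    also have "\<dots> = 2 * expectation (\<lambda>x. (Z l e x)\<^sup>2 * Z i' e x * ((Z i e x)\<^sup>2 * Z k e x * H i' k x * G x))"
      using d G e by (intro expectation_Z_H) (auto simp: flip_inv_def)
    also have "expectation (\<lambda>x. (Z l e x)\<^sup>2 * Z i' e x * ((Z i e x)\<^sup>2 * Z k e x * H i' k x * G x)) =
      expectation (\<lambda>x. Z i' e x * H i' k x * ((Z l e x)\<^sup>2 * (Z i e x)\<^sup>2 * Z k e x * G x))"
      by (simp add: mult_ac)
    also have "\<dots> = 2 * expectation (\<lambda>x. (Z i' e x)\<^sup>2 * Z k e x * ((Z l e x)\<^sup>2 * (Z i e x)\<^sup>2 * Z k e x * G x))"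
      using d G e by (intro expectation_Z_H) (auto simp: flip_inv_def)
    finally show "expectation (\<lambda>x. Z i e x * H i l x * (Z k e x * H i' k x * H i' l x * G x)) =
       8 * expectation (\<lambda>x. (Z i e x * Z k e x)\<^sup>2 * (Z i' e x * Z l e x)\<^sup>2 * G x)"
      by (simp add: power2_eq_square mult_ac)
  qed
  finally show ?thesis by (simp add: sum_distrib_left)
qed

end

section \<open>Auxiliary inequalities\<close>

lemma cosh_le_exp_square: "exp u + exp (- u) \<le> 2 * exp (u\<^sup>2 / 2)" for u :: real
proof -
  have *: "cosh u \<le> exp (u\<^sup>2 / 2)" if "u \<ge> 0" for u :: real
  proof -
    define g where "g v = v\<^sup>2 / 2 - ln (cosh v)" for v :: real
    have "g 0 \<le> g u"
    proof (rule DERIV_nonneg_imp_nondecreasing[OF that])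
      fix v :: real assume v: "0 \<le> v" "v \<le> u"
      have "(g has_real_derivative (v - tanh v)) (at v)"
        unfolding g_def[abs_def] by (auto intro!: derivative_eq_intros simp: tanh_def)
      moreover have "tanh v \<le> v"
      proof -
        have "0 - tanh 0 \<le> v - tanh v"
        proof (rule DERIV_nonneg_imp_nondecreasing[OF v(1), where f = "\<lambda>v. v - tanh v"])
          fix w :: real
          have "((\<lambda>v. v - tanh v) has_real_derivative (1 - (1 - tanh w ^ 2))) (at w)"
            by (auto intro!: derivative_eq_intros)
          then show "\<exists>D. ((\<lambda>v. v - tanh v) has_real_derivative D) (at w) \<and> 0 \<le> D"
            by (intro exI[of _ "1 - (1 - tanh w ^ 2)"]) auto
        qed
        then show ?thesis by simp
      qed
      ultimately show "\<exists>D. (g has_real_derivative D) (at v) \<and> 0 \<le> D"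
        by (intro exI[of _ "v - tanh v"]) auto
    qed
    then have "ln (cosh u) \<le> u\<^sup>2 / 2" by (simp add: g_def)
    then have "exp (ln (cosh u)) \<le> exp (u\<^sup>2 / 2)" by (simp only: exp_le_cancel_iff)
    then show ?thesis by simp
  qed
  have "cosh u \<le> exp (u\<^sup>2 / 2)"
    using *[of u] *[of "- u"] by (cases "u \<ge> 0") auto
  then show ?thesis by (simp add: cosh_def)
qed

text \<open>The eighth moment is needed because \<open>H\<close> is quadratic in the correlation of two rows.\<close>

lemma power8_le_exp: "u ^ 8 \<le> fact 8 * (exp u + exp (- u))" for u :: real
proof -
  have *: "u ^ 8 / fact 8 \<le> exp u" if "u \<ge> 0" for u :: real
  proof -
    have "(\<Sum>k\<in>{8}. u ^ k /\<^sub>R fact k) \<le> (\<Sum>k. u ^ k /\<^sub>R fact k)"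
      using that sums_summable[OF exp_converges[of u]] by (intro sum_le_suminf) auto
    also have "\<dots> = exp u" using exp_converges[of u] by (simp add: sums_iff)
    finally have "(\<Sum>k\<in>{8}. u ^ k /\<^sub>R fact k) \<le> exp u" .
    then show ?thesis by (simp add: divide_inverse mult.commute)
  qed
  have "u ^ 8 / fact 8 \<le> exp u + exp (- u)"
  proof (cases "u \<ge> 0")
    case True
    then show ?thesis using *[of u] by (smt (verit) exp_ge_zero)
  next
    case False
    then show ?thesis using *[of "- u"] by (smt (verit) exp_ge_zero power_minus_even even_numeral)
  qed
  then show ?thesis by (simp add: pos_divide_le_eq mult.commute)
qed

context prob_space
begin

lemma expectation_cong_AE:
  assumes "bdd_rv M f" "bdd_rv M g" "AE x in M. f x = g x"
  shows "expectation f = expectation g"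
  by (rule integral_cong_AE) (use assms bdd_rv_measurable in auto)

text \<open>Terms belonging to different unordered pairs are uncorrelated; by symmetry of \<open>f\<close> it suffices to
know this when the first index of one pair is absent from the other.\<close>

lemma pair_sum_second_moment:
  fixes f :: "nat \<Rightarrow> nat \<Rightarrow> 'a \<Rightarrow> real"
  assumes bdd: "\<And>i k. bdd_rv M (f i k)" and sym: "\<And>i k x. f i k x = f k i x"
    and orth: "\<And>i k i' k'. i \<noteq> k \<Longrightarrow> i' \<noteq> k' \<Longrightarrow> i \<noteq> i' \<Longrightarrow> i \<noteq> k' \<Longrightarrow> i < m \<Longrightarrow> k < m \<Longrightarrow> i' < m \<Longrightarrow> k' < m \<Longrightarrow>
      expectation (\<lambda>x. f i k x * f i' k' x) = 0"
    and le: "\<And>i k. i \<noteq> k \<Longrightarrow> i < m \<Longrightarrow> k < m \<Longrightarrow> expectation (\<lambda>x. (f i k x)\<^sup>2) \<le> B"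
    and B: "B \<ge> 0"
  shows "expectation (\<lambda>x. (\<Sum>e\<in>offdiag {..<m}. f (fst e) (snd e) x)\<^sup>2) \<le> 2 * (real m)\<^sup>2 * B"
proof -
  let ?F = "\<lambda>e. f (fst e) (snd e)"
  have inner: "(\<Sum>e'\<in>offdiag {..<m}. expectation (\<lambda>x. ?F e x * ?F e' x)) \<le> 2 * B" if e: "e \<in> offdiag {..<m}" for e
  proof -
    have zero: "expectation (\<lambda>x. ?F e x * ?F e' x) = 0" if e': "e' \<in> offdiag {..<m} - {e, prod.swap e}" for e'
    proof (cases "fst e = fst e' \<or> fst e = snd e'")
      case False
      then show ?thesis using e e' by (intro orth) (auto simp: offdiag_def)
    next
      case True
      then have "expectation (\<lambda>x. f (snd e) (fst e) x * ?F e' x) = 0"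
        using e e' by (cases e; cases e') (intro orth; auto simp: offdiag_def)
      then show ?thesis by (simp add: sym[of "fst e" "snd e"])
    qed
    have sq: "expectation (\<lambda>x. ?F e x * ?F e' x) \<le> B" if "e' \<in> {e, prod.swap e}" for e'
    proof -
      have "?F e' = ?F e" using that by (auto simp: sym fun_eq_iff)
      then show ?thesis using le[of "fst e" "snd e"] e by (auto simp: offdiag_def power2_eq_square)
    qed
    have "(\<Sum>e'\<in>offdiag {..<m}. expectation (\<lambda>x. ?F e x * ?F e' x)) = (\<Sum>e'\<in>{e, prod.swap e}. expectation (\<lambda>x. ?F e x * ?F e' x))"
    proof (rule sum.mono_neutral_right)
      show "{e, prod.swap e} \<subseteq> offdiag {..<m}" using e by (auto simp: offdiag_def)
    qed (use zero in auto)
    also have "\<dots> \<le> of_nat (card {e, prod.swap e}) * B"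
      by (rule sum_bounded_above) (use sq in auto)
    also have "\<dots> \<le> 2 * B"
      using B by (intro mult_right_mono) (auto simp: card_insert_if)
    finally show ?thesis .
  qed
  have "expectation (\<lambda>x. (\<Sum>e\<in>offdiag {..<m}. ?F e x)\<^sup>2) = expectation (\<lambda>x. \<Sum>e\<in>offdiag {..<m}. \<Sum>e'\<in>offdiag {..<m}. ?F e x * ?F e' x)"
    by (simp add: power2_eq_square sum_product)
  also have "\<dots> = (\<Sum>e\<in>offdiag {..<m}. \<Sum>e'\<in>offdiag {..<m}. expectation (\<lambda>x. ?F e x * ?F e' x))"
    using bdd by (subst expectation_sum; (intro sum.cong refl expectation_sum)?) auto
  also have "\<dots> \<le> (\<Sum>e\<in>offdiag {..<m}. 2 * B)"
    by (rule sum_mono) (rule inner)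
  also have "\<dots> = real m * (real m - 1) * (2 * B)" by (simp add: card_offdiag)
  also have "\<dots> \<le> real m * real m * (2 * B)"
    using B by (intro mult_right_mono mult_left_mono) auto
  finally show ?thesis by (simp add: power2_eq_square)
qed

end

context correlation_array
begin

section \<open>Exchangeability within rows\<close>

definition s :: "nat \<Rightarrow> (nat \<times> nat \<Rightarrow> real) \<Rightarrow> real" where
  "s i x = (\<Sum>j<n. (a i j x)\<^sup>2)"

definition \<sigma> :: real where "\<sigma> = expectation (s 0)"

definition \<theta> :: real where "\<theta> = real n * \<sigma>\<^sup>2"

lemma bdd_s [intro!]: "bdd_rv N (s i)"
  unfolding s_def[abs_def] by auto

text \<open>Exchanging two entries of row \<open>i\<close> preserves the law of the array and permutes the weights \<open>a i j\<close>,
because the row norm is unchanged.\<close>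

definition colswap :: "nat \<Rightarrow> nat \<Rightarrow> nat \<Rightarrow> nat \<times> nat \<Rightarrow> nat \<times> nat" where
  "colswap i j l = Transposition.transpose (i, j) (i, l)"

lemma inj_colswap [simp]: "inj (colswap i j l)"
  unfolding colswap_def by simp

lemma colswap_apply: "colswap i j l (r, m) = (if r = i then (i, Transposition.transpose j l m) else (r, m))"
  by (auto simp: colswap_def Transposition.transpose_def)

definition swap_inv :: "nat \<Rightarrow> ((nat \<times> nat \<Rightarrow> real) \<Rightarrow> real) \<Rightarrow> bool" where
  "swap_inv i G \<longleftrightarrow> (\<forall>j<n. \<forall>l<n. \<forall>x. G (x \<circ> colswap i j l) = G x)"

lemma bij_swap_lessThan: "j < n \<Longrightarrow> l < n \<Longrightarrow> bij_betw (Transposition.transpose j l) {..<n} {..<n}"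
  by (intro bij_betw_byWitness[where f' = "Transposition.transpose j l"]) (auto simp: Transposition.transpose_def)

lemma rsq_colswap:
  assumes "j < n" "l < n"
  shows "rsq r (x \<circ> colswap i j l) = rsq r x"
proof (cases "r = i")
  case True
  then show ?thesis
    unfolding rsq_def using sum.reindex_bij_betw[OF bij_swap_lessThan[OF assms], of "\<lambda>k. (x (r, k))\<^sup>2"]
    by (simp add: colswap_apply)
qed (simp add: rsq_def colswap_apply)

lemma a_colswap:
  assumes "j < n" "l < n"
  shows "a r m (x \<circ> colswap i j l) = a r (if r = i then Transposition.transpose j l m else m) x"
  unfolding a_eq rsq_colswap[OF assms] by (simp add: colswap_apply)

lemma expectation_a_power:
  assumes j: "j < n" and G: "bdd_rv N G" "swap_inv i G"
  shows "expectation (\<lambda>x. a i j x ^ d * G x) = expectation (\<lambda>x. (\<Sum>l<n. a i l x ^ d) * G x) / n"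
proof -
  have eq: "expectation (\<lambda>x. a i l x ^ d * G x) = expectation (\<lambda>x. a i j x ^ d * G x)" if l: "l < n" for l
  proof -
    have "expectation (\<lambda>x. a i j x ^ d * G x) =
        expectation (\<lambda>x. a i j (x \<circ> colswap i j l) ^ d * G (x \<circ> colswap i j l))"
      by (rule expectation_reindex[symmetric]) (use j G in \<open>auto intro!: bdd_rv_measurable\<close>)
    also have "\<dots> = expectation (\<lambda>x. a i l x ^ d * G x)"
      using G(2) j l by (simp add: swap_inv_def a_colswap)
    finally show ?thesis by simp
  qed
  have "expectation (\<lambda>x. (\<Sum>l<n. a i l x ^ d) * G x) = (\<Sum>l<n. expectation (\<lambda>x. a i l x ^ d * G x))"
    unfolding sum_distrib_right by (rule expectation_sum) (use G in auto)
  also have "\<dots> = n * expectation (\<lambda>x. a i j x ^ d * G x)"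
    using eq by simp
  finally show ?thesis using n_pos by simp
qed

text \<open>The weights of a row are exchangeable and add up to \<open>1\<close>.\<close>

lemma expectation_a:
  assumes j: "j < n" and G: "bdd_rv N G" "swap_inv i G"
  shows "expectation (\<lambda>x. a i j x * G x) = expectation G / n"
proof -
  have "expectation (\<lambda>x. (\<Sum>l<n. a i l x) * G x) = expectation G"
    by (rule expectation_cong_AE) (use G AE_rsq[of i] in \<open>auto simp: sum_a_eq_1 elim!: eventually_mono\<close>)
  then show ?thesis using expectation_a_power[OF assms, of 1] by simp
qed

lemma expectation_a_sq:
  assumes j: "j < n" and G: "bdd_rv N G" "swap_inv i G"
  shows "expectation (\<lambda>x. (a i j x)\<^sup>2 * G x) = expectation (\<lambda>x. s i x * G x) / n"
  unfolding s_def by (rule expectation_a_power[OF assms])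

text \<open>For fixed \<open>j\<close> the products \<open>a i j * a i l\<close>, \<open>l \<noteq> j\<close>, are exchangeable in \<open>l\<close> and add up to
\<open>a i j * (1 - a i j)\<close>; the latter are exchangeable in \<open>j\<close> and add up to \<open>1 - s i\<close>.\<close>

lemma expectation_a_a:
  assumes j: "j < n" "l < n" "j \<noteq> l" and G: "bdd_rv N G" "swap_inv i G"
  shows "expectation (\<lambda>x. a i j x * a i l x * G x) = expectation (\<lambda>x. (1 - s i x) * G x) / (real n * (real n - 1))"
proof -
  have eq: "expectation (\<lambda>x. a i j x * a i m x * G x) = expectation (\<lambda>x. a i j x * a i l x * G x)"
    if m: "m \<in> {..<n} - {j}" for m
  proof -
    have "expectation (\<lambda>x. a i j x * a i m x * G x) =
        expectation (\<lambda>x. a i j (x \<circ> colswap i m l) * a i m (x \<circ> colswap i m l) * G (x \<circ> colswap i m l))"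
      by (rule expectation_reindex[symmetric]) (use j m G in \<open>auto intro!: bdd_rv_measurable\<close>)
    also have "\<dots> = expectation (\<lambda>x. a i j x * a i l x * G x)"
      using G(2) j m by (simp add: swap_inv_def a_colswap)
    finally show ?thesis .
  qed
  have "expectation (\<lambda>x. a i j x * G x - (a i j x)\<^sup>2 * G x) = expectation (\<lambda>x. \<Sum>m\<in>{..<n} - {j}. a i j x * a i m x * G x)"
  proof (rule expectation_cong_AE)
    show "AE x in N. a i j x * G x - (a i j x)\<^sup>2 * G x = (\<Sum>m\<in>{..<n} - {j}. a i j x * a i m x * G x)"
      using AE_rsq[of i]
    proof eventually_elim
      case (elim x)
      have "(\<Sum>m<n. a i m x) = a i j x + (\<Sum>m\<in>{..<n} - {j}. a i m x)"
        using j by (intro sum.remove) auto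
      then have "(\<Sum>m\<in>{..<n} - {j}. a i m x) = 1 - a i j x" using sum_a_eq_1[OF elim] by simp
      moreover have "(\<Sum>m\<in>{..<n} - {j}. a i j x * a i m x * G x) = a i j x * G x * (\<Sum>m\<in>{..<n} - {j}. a i m x)"
        unfolding sum_distrib_left by (intro sum.cong) auto
      ultimately have eq: "(\<Sum>m\<in>{..<n} - {j}. a i j x * a i m x * G x) = a i j x * G x * (1 - a i j x)"
        by (simp only:)
      show ?case unfolding eq power2_eq_square by (simp only: algebra_simps mult_1_right)
    qed
  qed (use j G in auto)
  also have "\<dots> = (\<Sum>m\<in>{..<n} - {j}. expectation (\<lambda>x. a i j x * a i m x * G x))"
    by (rule expectation_sum) (use j G in auto)
  also have "\<dots> = (real n - 1) * expectation (\<lambda>x. a i j x * a i l x * G x)"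
  proof -
    have "(\<Sum>m\<in>{..<n} - {j}. expectation (\<lambda>x. a i j x * a i m x * G x)) =
        (\<Sum>m\<in>{..<n} - {j}. expectation (\<lambda>x. a i j x * a i l x * G x))"
      by (rule sum.cong[OF refl eq])
    also have "\<dots> = real (card ({..<n} - {j})) * expectation (\<lambda>x. a i j x * a i l x * G x)"
      by (rule sum_constant)
    also have "card ({..<n} - {j}) = n - 1" using j by simp
    finally show ?thesis using n2 by (simp only: of_nat_diff of_nat_1)
  qed
  also have "expectation (\<lambda>x. a i j x * G x - (a i j x)\<^sup>2 * G x) = (expectation G - expectation (\<lambda>x. s i x * G x)) / n"
    using j G by (subst Bochner_Integration.integral_diff) (auto simp: expectation_a expectation_a_sq diff_divide_distrib)
  also have "expectation G - expectation (\<lambda>x. s i x * G x) = expectation (\<lambda>x. (1 - s i x) * G x)"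
    using G by (subst Bochner_Integration.integral_diff[symmetric]) (auto simp: algebra_simps)
  finally show ?thesis using n2 by (simp add: field_simps)
qed

lemma s_colswap: "j < n \<Longrightarrow> l < n \<Longrightarrow> s r (x \<circ> colswap i j l) = s r x"
  unfolding s_def using sum.reindex_bij_betw[OF bij_swap_lessThan[of j l], of "\<lambda>m. (a r m x)\<^sup>2"]
  by (cases "r = i") (simp_all add: a_colswap)

lemma s_swap_inv: "swap_inv i (s r)"
  unfolding swap_inv_def by (simp add: s_colswap)

lemma expectation_s: "expectation (s i) = \<sigma>"
proof -
  \<comment> \<open>Exchange the rows \<open>0\<close> and \<open>i\<close>.\<close>
  define \<pi> where "\<pi> = map_prod (Transposition.transpose 0 i) (id :: nat \<Rightarrow> nat)"
  have "s i x = s 0 (x \<circ> \<pi>)" for x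
    unfolding s_def a_eq rsq_def \<pi>_def by simp
  moreover have "inj \<pi>" unfolding \<pi>_def by (auto intro!: prod.inj_map)
  ultimately show ?thesis unfolding \<sigma>_def
    using expectation_reindex[of "s 0" \<pi>] bdd_rv_measurable[OF bdd_s[of 0]] by presburger
qed

text \<open>Independence of two rows enters their joint moments through this identity.\<close>

lemma expectation_s_s:
  assumes ik: "i \<noteq> k"
  shows "expectation (\<lambda>x. s i x * s k x) = \<sigma>\<^sup>2"
proof -
  define F :: "nat \<Rightarrow> (nat \<times> nat \<Rightarrow> real) \<Rightarrow> real"
    where "F i z = (\<Sum>j<n. ((z (i, j))\<^sup>2 / (\<Sum>k<n. (z (i, k))\<^sup>2))\<^sup>2)" for i z
  have "indep_vars (\<lambda>i. \<Pi>\<^sub>M e\<in>{i} \<times> UNIV. borel) (\<lambda>i x. restrict x ({i} \<times> UNIV)) {i, k}"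
    by (rule indep_vars_restrict[OF indep_coords]) (auto simp: disjoint_family_on_def)
  then have "indep_vars (\<lambda>_. borel) (\<lambda>i x. F i (restrict x ({i} \<times> UNIV))) {i, k}"
  proof (rule indep_vars_compose2)
    fix r :: nat
    have [measurable]: "(\<lambda>z. z (r, j)) \<in> borel_measurable (\<Pi>\<^sub>M e\<in>{r} \<times> UNIV. (borel :: real measure))" for j :: nat
      by (rule measurable_component_singleton) auto
    show "F r \<in> borel_measurable (\<Pi>\<^sub>M e\<in>{r} \<times> UNIV. borel)"
      unfolding F_def[abs_def] by measurable
  qed
  also have "(\<lambda>i x. F i (restrict x ({i} \<times> UNIV))) = s"
    by (auto simp: fun_eq_iff F_def s_def a_eq rsq_def)
  finally have ind: "indep_vars (\<lambda>_. borel) s {i, k}" .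
  have "expectation (\<lambda>x. \<Prod>r\<in>{i, k}. s r x) = (\<Prod>r\<in>{i, k}. expectation (s r))"
    by (rule indep_vars_lebesgue_integral) (use ind in auto)
  then show ?thesis using ik by (simp add: expectation_s power2_eq_square)
qed

lemma sigma_ge: "\<sigma> \<ge> 1 / n"
proof -
  have "(1 / real n) \<le> s 0 x" if "rsq 0 x \<noteq> 0" for x
  proof -
    have "0 \<le> (\<Sum>j<n. (a 0 j x - 1 / n)\<^sup>2)" by (intro sum_nonneg) auto
    also have "\<dots> = s 0 x - 2 / n * (\<Sum>j<n. a 0 j x) + 1 / n"
    proof -
      have "(\<Sum>j<n. (a 0 j x - 1 / n)\<^sup>2) = (\<Sum>j<n. (a 0 j x)\<^sup>2 - 2 / n * a 0 j x + (1 / n)\<^sup>2)"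
        by (intro sum.cong) (auto simp: power2_diff)
      also have "\<dots> = s 0 x - 2 / n * (\<Sum>j<n. a 0 j x) + n * (1 / n)\<^sup>2"
        unfolding s_def sum.distrib sum_subtractf sum_distrib_left by simp
      finally show ?thesis using n_pos by (simp add: power2_eq_square)
    qed
    finally show ?thesis using sum_a_eq_1[OF that] by simp
  qed
  then have "expectation (\<lambda>_. 1 / real n) \<le> expectation (s 0)"
    using AE_rsq[of 0] by (intro integral_mono_AE) (auto elim!: eventually_mono)
  then show ?thesis by (simp add: \<sigma>_def prob_space)
qed

lemma theta_nonneg: "\<theta> \<ge> 0" unfolding \<theta>_def by simp

lemma expectation_q: "i \<noteq> k \<Longrightarrow> expectation (q i k) = \<sigma>\<^sup>2 / n"
proof -
  assume ik: "i \<noteq> k"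
  have "expectation (q i k) = (\<Sum>j<n. expectation (\<lambda>x. (a i j x)\<^sup>2 * (a k j x)\<^sup>2))"
    unfolding q_def[abs_def] by (rule expectation_sum) auto
  also have "\<dots> = (\<Sum>j<n. expectation (\<lambda>x. s i x * (a k j x)\<^sup>2) / n)"
    by (intro sum.cong refl expectation_a_sq) (use ik in \<open>auto simp: swap_inv_def a_colswap\<close>)
  also have "\<dots> = (\<Sum>j<n. expectation (\<lambda>x. (a k j x)\<^sup>2 * s i x) / n)" by (simp add: mult.commute)
  also have "\<dots> = (\<Sum>j<n. expectation (\<lambda>x. s k x * s i x) / n / n)"
    by (intro sum.cong refl arg_cong[of _ _ "\<lambda>z. z / real n"] expectation_a_sq) (auto simp: s_swap_inv)
  also have "\<dots> = \<sigma>\<^sup>2 / n" using ik n_pos by (simp add: expectation_s_s)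
  finally show ?thesis .
qed

lemma expectation_Q:
  assumes ik: "i \<noteq> k" and G: "bdd_rv N G" "swap_inv i G"
  shows "expectation (\<lambda>x. Q i k x * G x) = expectation G / n"
proof -
  have "expectation (\<lambda>x. Q i k x * G x) = (\<Sum>j<n. expectation (\<lambda>x. a i j x * (a k j x * G x)))"
    unfolding Q_def[abs_def] sum_distrib_right mult.assoc by (rule expectation_sum) (use G in auto)
  also have "\<dots> = (\<Sum>j<n. expectation (\<lambda>x. a k j x * G x) / n)"
    by (intro sum.cong refl expectation_a) (use ik G in \<open>auto simp: swap_inv_def a_colswap\<close>)
  also have "\<dots> = expectation (\<lambda>x. \<Sum>j<n. a k j x * G x) / n"
    by (subst expectation_sum) (use G in \<open>auto simp: sum_divide_distrib\<close>)
  also have "expectation (\<lambda>x. \<Sum>j<n. a k j x * G x) = expectation G"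
    by (rule expectation_cong_AE) (use G AE_rsq[of k] in \<open>auto simp: sum_a_eq_1 sum_distrib_right[symmetric] elim!: eventually_mono\<close>)
  finally show ?thesis .
qed

text \<open>Exchangeability reduces the second moment of \<open>Q\<close> to that of \<open>s i\<close> and \<open>s k\<close>: the diagonal part has mean
\<open>E (s i * s k) / n\<close>, the off-diagonal part has mean \<open>E ((1 - s i) * (1 - s k)) / (n * (n - 1))\<close>.\<close>

lemma expectation_Q_sq:
  assumes ik: "i \<noteq> k"
  shows "expectation (\<lambda>x. (Q i k x)\<^sup>2) = \<sigma>\<^sup>2 / n + (1 - \<sigma>)\<^sup>2 / (real n * (real n - 1))"
proof -
  have Z2: "(Z i e x)\<^sup>2 = a i (fst e) x * a i (snd e) x" for i e x
    unfolding Z_def a_def by (simp add: power_mult_distrib)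
  have sumZ: "(\<Sum>e\<in>offdiag {..<n}. (Z k e x)\<^sup>2) = (\<Sum>j<n. a k j x)\<^sup>2 - s k x" for k x
    unfolding Z2 square_sum_offdiag[OF finite_lessThan] s_def by simp
  have "expectation (\<lambda>x. (Q i k x)\<^sup>2) = expectation (\<lambda>x. q i k x + (\<Sum>e\<in>offdiag {..<n}. (Z i e x)\<^sup>2 * (Z k e x)\<^sup>2))"
    by (simp add: sum_Z_squares)
  also have "\<dots> = expectation (q i k) + (\<Sum>e\<in>offdiag {..<n}. expectation (\<lambda>x. (Z i e x)\<^sup>2 * (Z k e x)\<^sup>2))"
    by (subst Bochner_Integration.integral_add) (auto simp: expectation_sum bdd_rv_mult bdd_rv_power bdd_Z intro!: bdd_rv_integrable)
  also have "(\<Sum>e\<in>offdiag {..<n}. expectation (\<lambda>x. (Z i e x)\<^sup>2 * (Z k e x)\<^sup>2)) =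
      (\<Sum>e\<in>offdiag {..<n}. expectation (\<lambda>x. (1 - s i x) * (Z k e x)\<^sup>2) / (real n * (real n - 1)))"
    unfolding Z2[of i]
    by (intro sum.cong refl expectation_a_a) (use ik in \<open>auto simp: offdiag_def swap_inv_def a_colswap Z2\<close>)
  also have "\<dots> = expectation (\<lambda>x. \<Sum>e\<in>offdiag {..<n}. (1 - s i x) * (Z k e x)\<^sup>2) / (real n * (real n - 1))"
    by (subst expectation_sum) (auto simp: sum_divide_distrib)
  also have "expectation (\<lambda>x. \<Sum>e\<in>offdiag {..<n}. (1 - s i x) * (Z k e x)\<^sup>2) = expectation (\<lambda>x. (1 - s i x) * (1 - s k x))"
    by (rule expectation_cong_AE)
       (use AE_rsq[of k] in \<open>auto simp: sum_a_eq_1 sum_distrib_left[symmetric] sumZ elim!: eventually_mono\<close>)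
  also have "\<dots> = expectation (\<lambda>x. 1 - s i x - s k x + s i x * s k x)" by (simp add: algebra_simps)
  also have "\<dots> = 1 - \<sigma> - \<sigma> + \<sigma>\<^sup>2"
    using ik by (subst Bochner_Integration.integral_add Bochner_Integration.integral_diff;
        (fastforce simp: prob_space expectation_s expectation_s_s)?)+
  also have "\<dots> = (1 - \<sigma>)\<^sup>2" by (simp add: power2_eq_square algebra_simps)
  finally show ?thesis using ik by (simp add: expectation_q)
qed

text \<open>The exact value is \<open>(n * \<sigma> - 1)\<^sup>2 / (n - 1)\<close>, where \<open>n * \<sigma> \<ge> 1\<close>.\<close>

lemma expectation_Q_deviation:
  assumes ik: "i \<noteq> k"
  shows "expectation (\<lambda>x. (real n * Q i k x - 1)\<^sup>2) \<le> 2 * \<theta>"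
proof -
  have EQ: "expectation (Q i k) = 1 / n"
    using expectation_Q[OF ik, of "\<lambda>_. 1"] by (auto simp: swap_inv_def prob_space)
  have "expectation (\<lambda>x. (real n * Q i k x - 1)\<^sup>2) =
      expectation (\<lambda>x. (real n)\<^sup>2 * (Q i k x)\<^sup>2 - 2 * real n * Q i k x + 1)"
    by (simp add: power2_eq_square algebra_simps)
  also have "\<dots> = (real n)\<^sup>2 * expectation (\<lambda>x. (Q i k x)\<^sup>2) - 2 * real n * expectation (Q i k) + 1"
  proof -
    have 1: "integrable N (\<lambda>x. (real n)\<^sup>2 * (Q i k x)\<^sup>2)" "integrable N (\<lambda>x. 2 * real n * Q i k x)"
      "integrable N (\<lambda>x. (real n)\<^sup>2 * (Q i k x)\<^sup>2 - 2 * real n * Q i k x)" by auto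
    show ?thesis
      using 1 by (simp add: prob_space)
  qed
  also have "\<dots> = (real n)\<^sup>2 * (\<sigma>\<^sup>2 / n + (1 - \<sigma>)\<^sup>2 / (real n * (real n - 1))) - 1"
    unfolding expectation_Q_sq[OF ik] EQ using n_pos by simp
  also have "\<dots> = (real n * \<sigma> - 1)\<^sup>2 / (real n - 1)"
    using n2 by (simp add: power2_eq_square field_simps)
  also have "\<dots> \<le> (real n * \<sigma>)\<^sup>2 / (real n / 2)"
  proof (rule frac_le)
    have "1 \<le> real n * \<sigma>" using sigma_ge n_pos by (simp add: field_simps)
    then show "(real n * \<sigma> - 1)\<^sup>2 \<le> (real n * \<sigma>)\<^sup>2" by (intro power_mono) auto
  qed (use n2 in auto)
  also have "\<dots> = 2 * \<theta>" unfolding \<theta>_def using n_pos by (simp add: power2_eq_square field_simps)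
  finally show ?thesis .
qed

section \<open>Fourth moment of the truncated kernel\<close>

text \<open>Given the absolute values, the correlation of two rows is a sum with independent random signs, hence
sub-Gaussian with variance proxy \<open>Q i k\<close>. The signs of the entries of row \<open>i\<close> are averaged
one column at a time, each replacing \<open>exp z\<close> by \<open>exp (z\<^sup>2 / 2)\<close>; on the truncation event the result
is at most \<open>exp (n / 2 * (2 / n))\<close>. Both roots \<open>c\<close> of \<open>n\<close> are needed for even moments.\<close>

lemma expectation_cut_exp:
  assumes ik: "i \<noteq> k" and c: "c\<^sup>2 = real n"
  shows "expectation (\<lambda>x. cut i k x * exp (c * (\<Sum>j<n. y i j x * y k j x))) \<le> exp 1"
proof -
  define z where "z j x = c * (y i j x * y k j x)" for j x
  \<comment> \<open>The columns below \<open>m\<close> still carry their signs; those from \<open>m\<close> on are already averaged.\<close>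
  define F where "F m x = cut i k x * exp ((\<Sum>j<m. z j x) + (\<Sum>j\<in>{m..<n}. (z j x)\<^sup>2 / 2))" for m x
  have bz: "bdd_rv N (z j)" if "j < n" for j unfolding z_def[abs_def] using that by auto
  have step: "expectation (F (Suc m)) \<le> expectation (F m)" if m: "m < n" for m
  proof -
    define G where "G x = cut i k x * exp ((\<Sum>j<m. z j x) + (\<Sum>j\<in>{Suc m..<n}. (z j x)\<^sup>2 / 2))" for x
    have bG: "bdd_rv N G" unfolding G_def[abs_def] using m bz by auto
    have F1: "F (Suc m) x = G x * exp (z m x)" for x
      unfolding F_def G_def by (simp add: exp_add)
    have F0: "F m x = G x * exp ((z m x)\<^sup>2 / 2)" for x
      unfolding F_def G_def using m by (simp add: exp_add sum.atLeast_Suc_lessThan)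
    have zf: "z j (flip (i, m) x) = (if j = m then - z j x else z j x)" for j x
      using ik unfolding z_def by (simp add: y_flip)
    have Gf: "G (flip (i, m) x) = G x" for x
      unfolding G_def zf by (auto intro!: arg_cong2[where f = "(*)"] arg_cong2[where f = "(+)"] sum.cong)
    have "expectation (\<lambda>x. G x * exp (z m x)) = expectation (\<lambda>x. G (flip (i, m) x) * exp (z m (flip (i, m) x)))"
      by (rule expectation_flip[symmetric]) (use bG bz m in \<open>auto intro!: bdd_rv_measurable\<close>)
    then have e1: "expectation (\<lambda>x. G x * exp (z m x)) = expectation (\<lambda>x. G x * exp (- z m x))"
      by (simp add: Gf zf)
    have "2 * expectation (F (Suc m)) = expectation (\<lambda>x. G x * exp (z m x)) + expectation (\<lambda>x. G x * exp (- z m x))"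
      unfolding F1[abs_def] using e1 by simp
    also have "\<dots> = expectation (\<lambda>x. G x * exp (z m x) + G x * exp (- z m x))"
      by (rule Bochner_Integration.integral_add[symmetric]) (use bG bz m in auto)
    also have "\<dots> \<le> expectation (\<lambda>x. 2 * F m x)"
    proof (rule expectation_mono)
      show "bdd_rv N (\<lambda>x. G x * exp (z m x) + G x * exp (- z m x))" using bG bz m by auto
      show "bdd_rv N (\<lambda>x. 2 * F m x)" unfolding F0 using bG bz m by auto
      fix x
      have "G x \<ge> 0" unfolding G_def by simp
      then have "G x * (exp (z m x) + exp (- z m x)) \<le> G x * (2 * exp ((z m x)\<^sup>2 / 2))"
        by (intro mult_left_mono cosh_le_exp_square)
      then show "G x * exp (z m x) + G x * exp (- z m x) \<le> 2 * F m x"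
        unfolding F0 by (simp add: algebra_simps)
    qed
    finally show ?thesis by simp
  qed
  have "expectation (F m) \<le> expectation (F 0)" if "m \<le> n" for m
    using that by (induction m) (auto intro: order_trans[OF step])
  then have "expectation (F n) \<le> expectation (F 0)" by blast
  also have "\<dots> \<le> expectation (\<lambda>_. exp 1)"
  proof (rule expectation_mono)
    show "bdd_rv N (F 0)" unfolding F_def[abs_def] using bz by auto
    fix x
    have "(\<Sum>j\<in>{0..<n}. (z j x)\<^sup>2 / 2) = real n / 2 * Q i k x"
      unfolding z_def power_mult_distrib c Q_def a_def by (simp add: sum_distrib_left atLeast0LessThan)
    then have F0: "F 0 x = cut i k x * exp (real n / 2 * Q i k x)" unfolding F_def by simp
    show "F 0 x \<le> exp 1"
    proof (cases "Q i k x \<le> 2 / real n")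
      case True
      then have "real n / 2 * Q i k x \<le> 1" using n_pos by (simp add: field_simps)
      then show ?thesis unfolding F0 cut_def by simp
    qed (simp add: F0 cut_def)
  qed auto
  finally show ?thesis unfolding F_def z_def by (simp add: prob_space sum_distrib_left)
qed

text \<open>The bound for the fourth moment of \<open>n * H i k\<close> on the truncation event. That it is free of \<open>n\<close> and
\<open>p\<close> is what allows \<open>p\<close> to grow arbitrarily slowly.\<close>

definition K8 :: real where "K8 = 8 * (2 * fact 8 * exp 1 + 16)"

lemma expectation_cut_H4:
  assumes ik: "i \<noteq> k"
  shows "expectation (\<lambda>x. (real n * (cut i k x * H i k x)) ^ 4) \<le> K8"
proof -
  define R where "R x = (\<Sum>j<n. y i j x * y k j x)" for x
  define c where "c = sqrt (real n)"
  have c2: "c\<^sup>2 = real n" "(- c)\<^sup>2 = real n" unfolding c_def by auto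
  have bR: "bdd_rv N R" unfolding R_def[abs_def] by auto
  have "expectation (\<lambda>x. (real n * (cut i k x * H i k x)) ^ 4) \<le>
    expectation (\<lambda>x. 8 * (fact 8 * (cut i k x * exp (c * R x) + cut i k x * exp ((- c) * R x)) + 16))"
  proof (rule expectation_mono)
    fix x
    have HR: "H i k x = (R x)\<^sup>2 - Q i k x" using correlation_square[of i x k] unfolding R_def by simp
    show "(real n * (cut i k x * H i k x)) ^ 4 \<le> 8 * (fact 8 * (cut i k x * exp (c * R x) + cut i k x * exp ((- c) * R x)) + 16)"
    proof (cases "Q i k x \<le> 2 / real n")
      case True
      have four: "(u - v) ^ 4 \<le> 8 * (u ^ 4 + v ^ 4)" for u v :: real
      proof -
        have "(u - v)\<^sup>2 \<le> 2 * (u\<^sup>2 + v\<^sup>2)" using zero_le_power2[of "u + v"] by (simp add: power2_eq_square algebra_simps)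
        then have "((u - v)\<^sup>2)\<^sup>2 \<le> (2 * (u\<^sup>2 + v\<^sup>2))\<^sup>2" by (intro power_mono) auto
        also have "\<dots> \<le> 8 * (u ^ 4 + v ^ 4)"
          using zero_le_power2[of "u\<^sup>2 - v\<^sup>2"] by (simp add: power2_eq_square power4_eq_xxxx algebra_simps)
        finally show ?thesis by (simp flip: power_mult)
      qed
      have nQ: "real n * Q i k x \<le> 2" using True n_pos by (simp add: field_simps)
      have "(real n * (cut i k x * H i k x)) ^ 4 = ((c * R x)\<^sup>2 - real n * Q i k x) ^ 4"
      proof -
        have "real n * (cut i k x * H i k x) = (c * R x)\<^sup>2 - real n * Q i k x"
          using True unfolding cut_def HR power_mult_distrib c2 by (simp add: algebra_simps)
        then show ?thesis by simp
      qed
      also have "\<dots> \<le> 8 * (((c * R x)\<^sup>2) ^ 4 + (real n * Q i k x) ^ 4)" by (rule four)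
      also have "((c * R x)\<^sup>2) ^ 4 = (c * R x) ^ 8" by (simp flip: power_mult)
      also have "8 * ((c * R x) ^ 8 + (real n * Q i k x) ^ 4) \<le> 8 * (fact 8 * (exp (c * R x) + exp (- (c * R x))) + 2 ^ 4)"
        using nQ by (intro mult_left_mono add_mono power8_le_exp power_mono) auto
      finally show ?thesis using True by (simp add: cut_def)
    qed (simp add: cut_def)
  qed (use bR in auto)
  also have "\<dots> = 8 * (fact 8 * (expectation (\<lambda>x. cut i k x * exp (c * R x)) + expectation (\<lambda>x. cut i k x * exp ((- c) * R x))) + 16)"
  proof -
    have 1: "integrable N (\<lambda>x. cut i k x * exp (c * R x))" "integrable N (\<lambda>x. cut i k x * exp ((- c) * R x))"
      using bR by (auto intro!: bdd_rv_integrable simp del: mult_minus_left)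
    show ?thesis using 1 by (simp add: prob_space del: mult_minus_left)
  qed
  also have "\<dots> \<le> 8 * (fact 8 * (exp 1 + exp 1) + 16)"
    unfolding R_def using expectation_cut_exp[OF ik c2(1)] expectation_cut_exp[OF ik c2(2)]
    by (intro mult_left_mono add_mono) auto
  finally show ?thesis by (simp add: K8_def)
qed

section \<open>The truncated degenerate U-statistic\<close>

text \<open>The truncated kernel. Its scale is such that the variances of \<open>h i k\<close> add up to about \<open>1\<close> over all
unordered pairs of rows.\<close>

definition h :: "nat \<Rightarrow> nat \<Rightarrow> (nat \<times> nat \<Rightarrow> real) \<Rightarrow> real" where
  "h i k x = real n / real p * (cut i k x * H i k x)"

definition K4 :: real where "K4 = K8 / real p ^ 4"

text \<open>The bound for the mean of \<open>h\<close> along a four-cycle of rows, smaller than the bound \<open>K4\<close> for a general product by a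
factor of order \<open>\<theta>\<close>.\<close>

definition C4 :: real where "C4 = 32 * \<theta> / real p ^ 4"

definition S :: "nat \<Rightarrow> nat set \<Rightarrow> (nat \<times> nat \<Rightarrow> real) \<Rightarrow> real" where
  "S i A x = (\<Sum>k\<in>A. h i k x)"

text \<open>The off-diagonal part of the square of \<open>S i A\<close>.\<close>

definition U :: "nat \<Rightarrow> nat set \<Rightarrow> (nat \<times> nat \<Rightarrow> real) \<Rightarrow> real" where
  "U i A x = (S i A x)\<^sup>2 - (\<Sum>k\<in>A. (h i k x)\<^sup>2)"

lemma bdd_h [intro!]: "bdd_rv N (h i k)"
  unfolding h_def[abs_def] by (intro bdd_rv_mult bdd_rv_const bdd_cut bdd_H)

lemma bdd_S [intro!]: "bdd_rv N (S i A)"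
  unfolding S_def[abs_def] by auto

lemma bdd_U [intro!]: "bdd_rv N (U i A)"
  unfolding U_def[abs_def] by auto

lemma h_sym: "h i k x = h k i x"
  unfolding h_def by (simp add: cut_sym[of i] H_sym[of i])

lemma h_flip [simp]: "r \<noteq> i \<Longrightarrow> r \<noteq> k \<Longrightarrow> h i k (flip (r, l) x) = h i k x"
  by (simp add: h_def)

lemma S_flip [simp]: "r \<noteq> i \<Longrightarrow> r \<notin> A \<Longrightarrow> S i A (flip (r, l) x) = S i A x"
  unfolding S_def by (intro sum.cong refl h_flip) auto

lemma flip_inv_h: "r \<noteq> i \<Longrightarrow> r \<noteq> k \<Longrightarrow> flip_inv r (h i k)"
  by (simp add: flip_inv_def)

lemma flip_inv_mult: "flip_inv r f \<Longrightarrow> flip_inv r g \<Longrightarrow> flip_inv r (\<lambda>x. f x * g x)"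
  by (simp add: flip_inv_def)

lemma K8_pos: "K8 > 0" unfolding K8_def by (simp add: add_pos_pos)

lemma K4_nonneg: "K4 \<ge> 0" unfolding K4_def using K8_pos by simp

lemma C4_nonneg: "C4 \<ge> 0" unfolding C4_def using theta_nonneg by simp

text \<open>Degeneracy of the kernel.\<close>

lemma expectation_h_zero:
  assumes ik: "i \<noteq> k" and G: "bdd_rv N G" "flip_inv k G"
  shows "expectation (\<lambda>x. h i k x * G x) = 0"
proof -
  have "expectation (\<lambda>x. h i k x * G x) =
      expectation (\<lambda>x. \<Sum>e\<in>offdiag {..<n}. Z k e x * (real n / real p * cut i k x * Z i e x * G x))"
    unfolding h_def H_def by (simp add: sum_distrib_left sum_distrib_right mult_ac)
  also have "\<dots> = (\<Sum>e\<in>offdiag {..<n}. expectation (\<lambda>x. Z k e x * (real n / real p * cut i k x * Z i e x * G x)))"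
    by (rule expectation_sum) (use G in auto)
  also have "\<dots> = 0"
    using ik G by (intro sum.neutral ballI expectation_Z_zero) (auto simp: flip_inv_def)
  finally show ?thesis .
qed

lemma expectation_h_sq:
  assumes ik: "i \<noteq> k" and G: "bdd_rv N G" "flip_inv i G"
  shows "expectation (\<lambda>x. (h i k x)\<^sup>2 * G x) =
    expectation (\<lambda>x. 2 * (real n / real p)\<^sup>2 * cut i k x * ((Q i k x)\<^sup>2 - q i k x) * G x)"
proof -
  have "expectation (\<lambda>x. (h i k x)\<^sup>2 * G x) = expectation (\<lambda>x. (H i k x)\<^sup>2 * ((real n / real p)\<^sup>2 * cut i k x * G x))"
    unfolding h_def power_mult_distrib by (simp add: power2_eq_square mult_ac)
  also have "\<dots> = 2 * expectation (\<lambda>x. ((Q i k x)\<^sup>2 - q i k x) * ((real n / real p)\<^sup>2 * cut i k x * G x))"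
    using ik G by (intro expectation_H_sq) (auto simp: flip_inv_def)
  also have "\<dots> = expectation (\<lambda>x. 2 * (((Q i k x)\<^sup>2 - q i k x) * ((real n / real p)\<^sup>2 * cut i k x * G x)))"
    by simp
  finally show ?thesis by (simp only: mult_ac)
qed

lemma expectation_h4:
  assumes ik: "i \<noteq> k"
  shows "expectation (\<lambda>x. (h i k x) ^ 4) \<le> K4"
proof -
  have "expectation (\<lambda>x. (h i k x) ^ 4) = expectation (\<lambda>x. (1 / real p ^ 4) * (real n * (cut i k x * H i k x)) ^ 4)"
    unfolding h_def by (simp add: power_mult_distrib power_divide)
  also have "\<dots> = (1 / real p ^ 4) * expectation (\<lambda>x. (real n * (cut i k x * H i k x)) ^ 4)" by simp
  also have "\<dots> \<le> (1 / real p ^ 4) * K8"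
    by (intro mult_left_mono expectation_cut_H4 ik) auto
  finally show ?thesis by (simp add: K4_def)
qed

lemma four_product_le: "s * t * u * v \<le> (s ^ 4 + t ^ 4 + u ^ 4 + v ^ 4) / 4" for s t u v :: real
proof -
  have "2 * ((s * t) * (u * v)) \<le> (s * t)\<^sup>2 + (u * v)\<^sup>2"
    using sum_squares_bound[of "s * t" "u * v"] by simp
  moreover have "2 * (s\<^sup>2 * t\<^sup>2) \<le> (s\<^sup>2)\<^sup>2 + (t\<^sup>2)\<^sup>2" "2 * (u\<^sup>2 * v\<^sup>2) \<le> (u\<^sup>2)\<^sup>2 + (v\<^sup>2)\<^sup>2"
    using sum_squares_bound[of "s\<^sup>2" "t\<^sup>2"] sum_squares_bound[of "u\<^sup>2" "v\<^sup>2"] by simp_all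
  ultimately show ?thesis by (simp add: power_mult_distrib flip: power_mult)
qed

lemma expectation_h_product:
  assumes "i1 \<noteq> k1" "i2 \<noteq> k2" "i3 \<noteq> k3" "i4 \<noteq> k4"
  shows "expectation (\<lambda>x. h i1 k1 x * h i2 k2 x * h i3 k3 x * h i4 k4 x) \<le> K4"
proof -
  have "expectation (\<lambda>x. h i1 k1 x * h i2 k2 x * h i3 k3 x * h i4 k4 x) \<le>
     expectation (\<lambda>x. ((h i1 k1 x) ^ 4 + (h i2 k2 x) ^ 4 + (h i3 k3 x) ^ 4 + (h i4 k4 x) ^ 4) / 4)"
    by (rule expectation_mono) (auto simp only: intro!: four_product_le bdd_h bdd_rv_mult bdd_rv_add bdd_rv_power bdd_rv_divide)
  also have "\<dots> = (expectation (\<lambda>x. (h i1 k1 x) ^ 4) + expectation (\<lambda>x. (h i2 k2 x) ^ 4) +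
      expectation (\<lambda>x. (h i3 k3 x) ^ 4) + expectation (\<lambda>x. (h i4 k4 x) ^ 4)) / 4"
  proof -
    have "integrable N (\<lambda>x. (h i k x) ^ 4)" for i k by auto
    then show ?thesis by simp
  qed
  also have "\<dots> \<le> (K4 + K4 + K4 + K4) / 4"
    using assms by (intro divide_right_mono add_mono expectation_h4) auto
  finally show ?thesis by simp
qed

lemma expectation_S_sq:
  assumes A: "finite A" "i \<notin> A" and G: "bdd_rv N G" "\<And>k. k \<in> A \<Longrightarrow> flip_inv k G"
  shows "expectation (\<lambda>x. (S i A x)\<^sup>2 * G x) = (\<Sum>k\<in>A. expectation (\<lambda>x. (h i k x)\<^sup>2 * G x))"
proof -
  have "expectation (\<lambda>x. (S i A x)\<^sup>2 * G x) = expectation (\<lambda>x. \<Sum>k\<in>A. \<Sum>l\<in>A. h i k x * (h i l x * G x))"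
    unfolding S_def power2_eq_square sum_product by (simp add: sum_distrib_right mult.assoc)
  also have "\<dots> = (\<Sum>k\<in>A. \<Sum>l\<in>A. expectation (\<lambda>x. h i k x * (h i l x * G x)))"
    using G by (subst expectation_sum; (intro sum.cong refl expectation_sum)?) auto
  also have "\<dots> = (\<Sum>k\<in>A. expectation (\<lambda>x. (h i k x)\<^sup>2 * G x))"
  proof (rule sum.cong[OF refl])
    fix k assume k: "k \<in> A"
    have "(\<Sum>l\<in>A. expectation (\<lambda>x. h i k x * (h i l x * G x))) = (\<Sum>l\<in>{k}. expectation (\<lambda>x. h i k x * (h i l x * G x)))"
    proof (rule sum.mono_neutral_right)
      show "\<forall>l\<in>A - {k}. expectation (\<lambda>x. h i k x * (h i l x * G x)) = 0"
        using A G k by (auto intro!: expectation_h_zero flip_inv_mult flip_inv_h)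
    qed (use A k in auto)
    then show "(\<Sum>l\<in>A. expectation (\<lambda>x. h i k x * (h i l x * G x))) = expectation (\<lambda>x. (h i k x)\<^sup>2 * G x)"
      by (simp add: power2_eq_square mult.assoc)
  qed
  finally show ?thesis .
qed

lemma fourth_power_add_le: "(u + v) ^ 4 \<le> u ^ 4 + 4 * (v * u ^ 3) + 8 * (u\<^sup>2 * v\<^sup>2) + 3 * v ^ 4" for u v :: real
proof -
  have "0 \<le> 2 * v\<^sup>2 * (u - v)\<^sup>2" by simp
  then show ?thesis by (simp add: power2_eq_square power3_eq_cube power4_eq_xxxx algebra_simps)
qed

text \<open>Summands are added one at a time. The term linear in the new summand vanishes by degeneracy, and the
cubic one is absorbed into its neighbours, which yields the rate of independent summands.\<close>

lemma expectation_S4: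
  assumes "finite A" "i \<notin> A"
  shows "expectation (\<lambda>x. (S i A x) ^ 4) \<le> 8 * (real (card A))\<^sup>2 * K4"
  using assms
proof (induction A rule: finite_induct)
  case empty
  then show ?case by (simp add: S_def)
next
  case (insert k A)
  have ik: "i \<noteq> k" "i \<notin> A" using insert by auto
  let ?m = "real (card A)"
  have S2h2: "expectation (\<lambda>x. (S i A x)\<^sup>2 * (h i k x)\<^sup>2) \<le> ?m * K4"
  proof -
    have "expectation (\<lambda>x. (S i A x)\<^sup>2 * (h i k x)\<^sup>2) = (\<Sum>l\<in>A. expectation (\<lambda>x. (h i l x)\<^sup>2 * (h i k x)\<^sup>2))"
    proof (rule expectation_S_sq)
      fix l assume "l \<in> A"
      then have "l \<noteq> i" "l \<noteq> k" using insert ik by auto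
      then show "flip_inv l (\<lambda>x. (h i k x)\<^sup>2)" by (simp add: flip_inv_def)
    qed (use insert ik in auto)
    also have "\<dots> \<le> (\<Sum>l\<in>A. K4)"
    proof (rule sum_mono)
      fix l assume "l \<in> A"
      then show "expectation (\<lambda>x. (h i l x)\<^sup>2 * (h i k x)\<^sup>2) \<le> K4"
        using expectation_h_product[of i l i l i k i k] ik by (auto simp: power2_eq_square mult_ac)
    qed
    finally show ?thesis by simp
  qed
  have zero: "expectation (\<lambda>x. h i k x * (S i A x) ^ 3) = 0"
    using insert ik by (intro expectation_h_zero) (auto simp: flip_inv_def)
  have "expectation (\<lambda>x. (S i (insert k A) x) ^ 4) = expectation (\<lambda>x. (S i A x + h i k x) ^ 4)"
    using insert by (simp add: S_def add.commute)
  also have "\<dots> \<le> expectation (\<lambda>x. (S i A x) ^ 4 + 4 * (h i k x * (S i A x) ^ 3) + 8 * ((S i A x)\<^sup>2 * (h i k x)\<^sup>2) + 3 * (h i k x) ^ 4)"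
    by (rule expectation_mono) (auto intro: fourth_power_add_le)
  also have "\<dots> = expectation (\<lambda>x. (S i A x) ^ 4) + 4 * expectation (\<lambda>x. h i k x * (S i A x) ^ 3)
      + 8 * expectation (\<lambda>x. (S i A x)\<^sup>2 * (h i k x)\<^sup>2) + 3 * expectation (\<lambda>x. (h i k x) ^ 4)"
  proof -
    have "integrable N (\<lambda>x. (S i A x) ^ 4)" "integrable N (\<lambda>x. h i k x * (S i A x) ^ 3)"
      "integrable N (\<lambda>x. (S i A x)\<^sup>2 * (h i k x)\<^sup>2)" "integrable N (\<lambda>x. (h i k x) ^ 4)" by auto
    then show ?thesis by simp
  qed
  also have "\<dots> \<le> 8 * ?m\<^sup>2 * K4 + 4 * 0 + 8 * (?m * K4) + 3 * K4"
    using insert.IH ik(2) S2h2 zero expectation_h4[OF ik(1)] by (intro add_mono mult_left_mono) auto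
  also have "\<dots> \<le> 8 * (?m + 1)\<^sup>2 * K4"
  proof -
    have "8 * (?m + 1)\<^sup>2 * K4 - (8 * ?m\<^sup>2 * K4 + 4 * 0 + 8 * (?m * K4) + 3 * K4) = (8 * ?m + 5) * K4"
      by (simp add: power2_eq_square algebra_simps)
    moreover have "\<dots> \<ge> 0" using K4_nonneg by simp
    ultimately show ?thesis by linarith
  qed
  also have "?m + 1 = real (card (insert k A))" using insert by simp
  finally show ?case .
qed

lemma expectation_U_sq:
  assumes A: "finite A" "i \<notin> A"
  shows "expectation (\<lambda>x. (U i A x)\<^sup>2) \<le> 18 * (real (card A))\<^sup>2 * K4"
proof -
  let ?m = "real (card A)"
  have "expectation (\<lambda>x. (U i A x)\<^sup>2) \<le> expectation (\<lambda>x. 2 * (S i A x) ^ 4 + 2 * ?m * (\<Sum>k\<in>A. (h i k x) ^ 4))"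
  proof (rule expectation_mono)
    fix x
    have "(\<Sum>k\<in>A. (h i k x)\<^sup>2)\<^sup>2 \<le> ?m * (\<Sum>k\<in>A. ((h i k x)\<^sup>2)\<^sup>2)"
      using sum_squared_le_sum_of_squares[of "\<lambda>k. (h i k x)\<^sup>2" A] by (simp add: mult.commute)
    then have 1: "(\<Sum>k\<in>A. (h i k x)\<^sup>2)\<^sup>2 \<le> ?m * (\<Sum>k\<in>A. (h i k x) ^ 4)" by (simp flip: power_mult)
    have "(U i A x)\<^sup>2 \<le> 2 * ((S i A x)\<^sup>2)\<^sup>2 + 2 * (\<Sum>k\<in>A. (h i k x)\<^sup>2)\<^sup>2"
      using zero_le_power2[of "(S i A x)\<^sup>2 + (\<Sum>k\<in>A. (h i k x)\<^sup>2)"] unfolding U_def power2_sum power2_diff by linarith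
    then show "(U i A x)\<^sup>2 \<le> 2 * (S i A x) ^ 4 + 2 * ?m * (\<Sum>k\<in>A. (h i k x) ^ 4)"
      using 1 by (simp flip: power_mult)
  qed auto
  also have "\<dots> = 2 * expectation (\<lambda>x. (S i A x) ^ 4) + 2 * ?m * (\<Sum>k\<in>A. expectation (\<lambda>x. (h i k x) ^ 4))"
  proof -
    have "integrable N (\<lambda>x. (S i A x) ^ 4)" "integrable N (\<lambda>x. \<Sum>k\<in>A. (h i k x) ^ 4)"
      "expectation (\<lambda>x. \<Sum>k\<in>A. (h i k x) ^ 4) = (\<Sum>k\<in>A. expectation (\<lambda>x. (h i k x) ^ 4))"
      by (auto intro!: expectation_sum)
    then show ?thesis by simp
  qed
  also have "\<dots> \<le> 2 * (8 * ?m\<^sup>2 * K4) + 2 * ?m * (\<Sum>k\<in>A. K4)"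
    using A by (intro add_mono mult_left_mono expectation_S4 sum_mono expectation_h4) auto
  also have "\<dots> = 18 * ?m\<^sup>2 * K4" by (simp add: power2_eq_square)
  finally show ?thesis .
qed

text \<open>After \<open>expectation_H_cycle\<close>, the four rows split into the pairs \<open>i, k\<close> and \<open>i', l\<close>, which are
separated by \<open>2 * u * v \<le> u\<^sup>2 + v\<^sup>2\<close>. For either pair the remaining sum is at most \<open>q\<^sup>2\<close>, and on the
truncation event \<open>q\<^sup>2 \<le> 4 / n\<^sup>2 * q\<close>, where \<open>q\<close> has mean \<open>\<theta> / n\<^sup>2\<close>.\<close>

lemma expectation_h_cycle:
  assumes d: "distinct [i, i', k, l]"
  shows "expectation (\<lambda>x. h i k x * h i l x * h i' k x * h i' l x) \<le> C4"
proof -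
  define G where "G x = cut i k x * cut i l x * cut i' k x * cut i' l x" for x
  have bG: "bdd_rv N G" unfolding G_def[abs_def] by auto
  have G_inv: "flip_inv r G" for r unfolding G_def flip_inv_def by simp
  have sum_A: "(\<Sum>e\<in>offdiag {..<n}. expectation (\<lambda>x. (Z r e x * Z m e x) ^ 4 * cut r m x)) \<le> 4 * \<theta> / real n ^ 4"
    if rm: "r \<noteq> m" for r m
  proof -
    have "(\<Sum>e\<in>offdiag {..<n}. expectation (\<lambda>x. (Z r e x * Z m e x) ^ 4 * cut r m x)) =
        expectation (\<lambda>x. \<Sum>e\<in>offdiag {..<n}. (Z r e x * Z m e x) ^ 4 * cut r m x)"
      by (rule expectation_sum[symmetric]) auto
    also have "\<dots> \<le> expectation (\<lambda>x. 4 / (real n)\<^sup>2 * q r m x)"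
    proof (rule expectation_mono)
      fix x
      have Z4: "(Z r e x * Z m e x) ^ 4 = ((a r (fst e) x)\<^sup>2 * (a m (fst e) x)\<^sup>2) * ((a r (snd e) x)\<^sup>2 * (a m (snd e) x)\<^sup>2)" for e
        unfolding Z_def a_def power_mult_distrib by (simp add: mult_ac flip: power_mult)
      have "(\<Sum>e\<in>offdiag {..<n}. (Z r e x * Z m e x) ^ 4) \<le> (q r m x)\<^sup>2"
        unfolding Z4 q_def square_sum_offdiag[OF finite_lessThan] by (simp add: sum_nonneg)
      then have "(\<Sum>e\<in>offdiag {..<n}. (Z r e x * Z m e x) ^ 4 * cut r m x) \<le> (q r m x)\<^sup>2 * cut r m x"
        unfolding sum_distrib_right[symmetric] by (intro mult_right_mono) auto
      also have "\<dots> \<le> (q r m x * (Q r m x)\<^sup>2) * cut r m x"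
        unfolding power2_eq_square[of "q r m x"] by (intro mult_right_mono mult_left_mono q_le_Q) auto
      also have "\<dots> = (cut r m x * (Q r m x)\<^sup>2) * q r m x" by simp
      also have "\<dots> \<le> 4 / (real n)\<^sup>2 * q r m x"
        by (intro mult_right_mono cut_Q_le) auto
      finally show "(\<Sum>e\<in>offdiag {..<n}. (Z r e x * Z m e x) ^ 4 * cut r m x) \<le> 4 / (real n)\<^sup>2 * q r m x" .
    qed auto
    also have "\<dots> = 4 * \<theta> / real n ^ 4"
      using expectation_q[OF rm] n_pos by (simp add: \<theta>_def power2_eq_square power4_eq_xxxx)
    finally show ?thesis .
  qed
  have "expectation (\<lambda>x. h i k x * h i l x * h i' k x * h i' l x) =
     expectation (\<lambda>x. (real n / real p) ^ 4 * (H i k x * H i l x * H i' k x * H i' l x * G x))"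
    unfolding h_def G_def by (simp add: power4_eq_xxxx mult_ac)
  also have "\<dots> = (real n / real p) ^ 4 * (8 * (\<Sum>e\<in>offdiag {..<n}. expectation (\<lambda>x. (Z i e x * Z k e x)\<^sup>2 * (Z i' e x * Z l e x)\<^sup>2 * G x)))"
    using expectation_H_cycle[OF d bG G_inv] by simp
  also have "\<dots> \<le> (real n / real p) ^ 4 * (8 * (\<Sum>e\<in>offdiag {..<n}.
      (expectation (\<lambda>x. (Z i e x * Z k e x) ^ 4 * cut i k x) + expectation (\<lambda>x. (Z i' e x * Z l e x) ^ 4 * cut i' l x)) / 2))"
  proof (intro mult_left_mono sum_mono)
    fix e assume e: "e \<in> offdiag {..<n}"
    have "expectation (\<lambda>x. (Z i e x * Z k e x)\<^sup>2 * (Z i' e x * Z l e x)\<^sup>2 * G x) \<le>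
        expectation (\<lambda>x. ((Z i e x * Z k e x) ^ 4 * cut i k x + (Z i' e x * Z l e x) ^ 4 * cut i' l x) / 2)"
    proof (rule expectation_mono)
      fix x
      let ?A = "(Z i e x * Z k e x)\<^sup>2" and ?B = "(Z i' e x * Z l e x)\<^sup>2"
      have G1: "G x \<le> cut i k x" "G x \<le> cut i' l x" "G x \<ge> 0"
        unfolding G_def cut_def by auto
      have "?A * ?B \<le> (?A\<^sup>2 + ?B\<^sup>2) / 2" using sum_squares_bound[of ?A ?B] by simp
      then have "?A * ?B * G x \<le> (?A\<^sup>2 + ?B\<^sup>2) / 2 * G x" using G1 by (intro mult_right_mono) auto
      also have "\<dots> = (?A\<^sup>2 * G x + ?B\<^sup>2 * G x) / 2" by (simp add: algebra_simps add_divide_distrib)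
      also have "\<dots> \<le> (?A\<^sup>2 * cut i k x + ?B\<^sup>2 * cut i' l x) / 2"
        using G1 by (intro divide_right_mono add_mono mult_left_mono) auto
      finally show "?A * ?B * G x \<le> ((Z i e x * Z k e x) ^ 4 * cut i k x + (Z i' e x * Z l e x) ^ 4 * cut i' l x) / 2"
        by (simp flip: power_mult)
    qed (use e bG in auto)
    also have "\<dots> = (expectation (\<lambda>x. (Z i e x * Z k e x) ^ 4 * cut i k x) + expectation (\<lambda>x. (Z i' e x * Z l e x) ^ 4 * cut i' l x)) / 2"
    proof -
      have "integrable N (\<lambda>x. (Z r e x * Z m e x) ^ 4 * cut r m x)" for r m using e by auto
      then show ?thesis by simp
    qed
    finally show "expectation (\<lambda>x. (Z i e x * Z k e x)\<^sup>2 * (Z i' e x * Z l e x)\<^sup>2 * G x) \<le> \<dots>" .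
  qed auto
  also have "\<dots> = (real n / real p) ^ 4 * (4 * ((\<Sum>e\<in>offdiag {..<n}. expectation (\<lambda>x. (Z i e x * Z k e x) ^ 4 * cut i k x)) +
      (\<Sum>e\<in>offdiag {..<n}. expectation (\<lambda>x. (Z i' e x * Z l e x) ^ 4 * cut i' l x))))"
    by (simp add: sum.distrib sum_divide_distrib[symmetric])
  also have "\<dots> \<le> (real n / real p) ^ 4 * (4 * (4 * \<theta> / real n ^ 4 + 4 * \<theta> / real n ^ 4))"
    using d by (intro mult_left_mono add_mono sum_A) auto
  also have "\<dots> = C4" unfolding C4_def using n_pos p_pos by (simp add: power_divide)
  finally show ?thesis .
qed

lemma U_eq: "finite A \<Longrightarrow> U i A x = (\<Sum>e\<in>offdiag A. h i (fst e) x * h i (snd e) x)"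
  unfolding U_def S_def by (simp add: square_sum_offdiag)

lemma card_offdiag_le: "finite A \<Longrightarrow> real (card (offdiag A)) \<le> (real (card A))\<^sup>2"
proof -
  assume A: "finite A"
  have "card (offdiag A) \<le> card (A \<times> A)" by (rule card_mono) (use A in \<open>auto simp: offdiag_def\<close>)
  then have "real (card (offdiag A)) \<le> real (card (A \<times> A))" by (simp only: of_nat_le_iff)
  then show ?thesis by (simp add: card_cartesian_product power2_eq_square)
qed

text \<open>A row of \<open>A\<close> that occurs in only one of the four factors makes the mean vanish. Hence both products
run over the same two rows, and the four factors form a cycle.\<close>

lemma expectation_U_U_disjoint:
  assumes A: "finite A" "i \<notin> A" "i' \<notin> A" and ii: "i \<noteq> i'"
  shows "expectation (\<lambda>x. U i A x * U i' A x) \<le> 2 * (real (card A))\<^sup>2 * C4"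
proof -
  let ?F = "\<lambda>e e' x. h i (fst e) x * h i (snd e) x * (h i' (fst e') x * h i' (snd e') x)"
  \<comment> \<open>Only \<open>e'\<close> equal to \<open>e\<close> or its transpose contributes.\<close>
  have inner: "(\<Sum>e'\<in>offdiag A. expectation (?F e e')) \<le> 2 * C4" if e: "e \<in> offdiag A" for e
  proof -
    obtain k l where kl: "e = (k, l)" by (cases e)
    have e': "k \<in> A" "l \<in> A" "k \<noteq> l" using e kl by (auto simp: offdiag_def)
    have ne: "k \<noteq> i" "i \<noteq> k" "l \<noteq> i" "i \<noteq> l" "k \<noteq> i'" "l \<noteq> i'" using A e' by auto
    have zero: "expectation (?F e e') = 0" if e'': "e' \<in> offdiag A - {e, prod.swap e}" for e'
    proof -
      obtain k' l' where kl': "e' = (k', l')" by (cases e')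
      have m: "k' \<in> A" "l' \<in> A" "k' \<noteq> l'" using e'' kl' by (auto simp: offdiag_def)
      have ne': "k' \<noteq> i'" "l' \<noteq> i'" using A m by auto
      show ?thesis
      proof (cases "k = k' \<or> k = l'")
        case False
        have "expectation (\<lambda>x. h i k x * (h i l x * h i' k' x * h i' l' x)) = 0"
          using ne ne' e' m False by (intro expectation_h_zero) (auto simp: flip_inv_def)
        then show ?thesis by (simp add: kl kl' mult_ac)
      next
        case True
        then have "l \<noteq> k'" "l \<noteq> l'" using e' m e'' kl kl' by auto
        then have "expectation (\<lambda>x. h i l x * (h i k x * h i' k' x * h i' l' x)) = 0"
          using ne ne' e' m by (intro expectation_h_zero) (auto simp: flip_inv_def)
        then show ?thesis by (simp add: kl kl' mult_ac)
      qed
    qed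
    have bd: "expectation (?F e e') \<le> C4" if "e' \<in> {e, prod.swap e}" for e'
    proof -
      have "?F e e' x = h i k x * h i l x * h i' k x * h i' l x" for x
        using that by (auto simp: kl mult_ac)
      then show ?thesis using expectation_h_cycle[of i i' k l] ne ii e' by simp
    qed
    have "(\<Sum>e'\<in>offdiag A. expectation (?F e e')) = (\<Sum>e'\<in>{e, prod.swap e}. expectation (?F e e'))"
    proof (rule sum.mono_neutral_right)
      show "{e, prod.swap e} \<subseteq> offdiag A" using e by (auto simp: offdiag_def)
    qed (use zero A in auto)
    also have "\<dots> \<le> of_nat (card {e, prod.swap e}) * C4"
      by (rule sum_bounded_above) (use bd in auto)
    also have "\<dots> \<le> 2 * C4"
      using C4_nonneg by (intro mult_right_mono) (auto simp: card_insert_if)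
    finally show ?thesis .
  qed
  have "expectation (\<lambda>x. U i A x * U i' A x) = expectation (\<lambda>x. \<Sum>e\<in>offdiag A. \<Sum>e'\<in>offdiag A. ?F e e' x)"
    by (simp add: U_eq[OF A(1)] sum_product)
  also have "\<dots> = (\<Sum>e\<in>offdiag A. \<Sum>e'\<in>offdiag A. expectation (?F e e'))"
    by (subst expectation_sum; (intro sum.cong refl expectation_sum)?) auto
  also have "\<dots> \<le> (\<Sum>e\<in>offdiag A. 2 * C4)" by (rule sum_mono) (rule inner)
  also have "\<dots> = real (card (offdiag A)) * (2 * C4)" by simp
  also have "\<dots> \<le> (real (card A))\<^sup>2 * (2 * C4)"
    using C4_nonneg by (intro mult_right_mono card_offdiag_le A) auto
  finally show ?thesis by simp
qed

text \<open>At least one of the two rows in a term of \<open>U i' A\<close> differs from the row summed over in \<open>S i A\<close>, and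
occurs only once.\<close>

lemma expectation_h_S_U_zero:
  assumes A: "finite A" "i \<notin> A" "i' \<notin> A" and ii: "i \<noteq> i'"
  shows "expectation (\<lambda>x. h i i' x * S i A x * U i' A x) = 0"
proof -
  have "expectation (\<lambda>x. h i i' x * S i A x * U i' A x) =
     expectation (\<lambda>x. \<Sum>k\<in>A. \<Sum>e\<in>offdiag A. h i i' x * h i k x * (h i' (fst e) x * h i' (snd e) x))"
    unfolding U_eq[OF A(1)] S_def by (simp only: mult.assoc sum_product) (simp only: sum_distrib_left mult.assoc)
  also have "\<dots> = (\<Sum>k\<in>A. \<Sum>e\<in>offdiag A. expectation (\<lambda>x. h i i' x * h i k x * (h i' (fst e) x * h i' (snd e) x)))"
    by (subst expectation_sum; (intro sum.cong refl expectation_sum)?) auto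
  also have "\<dots> = 0"
  proof (intro sum.neutral ballI)
    fix k e assume k: "k \<in> A" and e: "e \<in> offdiag A"
    obtain k' l' where kl': "e = (k', l')" by (cases e)
    have m: "k' \<in> A" "l' \<in> A" "k' \<noteq> l'" using e kl' by (auto simp: offdiag_def)
    have ne: "k' \<noteq> i'" "i' \<noteq> k'" "k' \<noteq> i" "l' \<noteq> i'" "i' \<noteq> l'" "l' \<noteq> i" "k \<noteq> i" "i \<noteq> k" using A k m by auto
    show "expectation (\<lambda>x. h i i' x * h i k x * (h i' (fst e) x * h i' (snd e) x)) = 0"
    proof (cases "k' = k")
      case False
      have "expectation (\<lambda>x. h i' k' x * (h i i' x * h i k x * h i' l' x)) = 0"
        using ne ii m False by (intro expectation_h_zero) (auto simp: flip_inv_def)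
      then show ?thesis by (simp add: kl' mult_ac)
    next
      case True
      have "expectation (\<lambda>x. h i' l' x * (h i i' x * h i k x * h i' k' x)) = 0"
        using ne ii m True by (intro expectation_h_zero) (auto simp: flip_inv_def)
      then show ?thesis by (simp add: kl' mult_ac)
    qed
  qed
  finally show ?thesis .
qed

text \<open>The two sums must run over the same row, which leaves one sum over \<open>A\<close>.\<close>

lemma expectation_h_S_S:
  assumes A: "finite A" "i \<notin> A" "i' \<notin> A" and ii: "i \<noteq> i'"
  shows "expectation (\<lambda>x. (h i i' x)\<^sup>2 * S i A x * S i' A x) \<le> real (card A) * K4"
proof -
  have "expectation (\<lambda>x. (h i i' x)\<^sup>2 * S i A x * S i' A x) =
     expectation (\<lambda>x. \<Sum>k\<in>A. \<Sum>l\<in>A. h i i' x * h i i' x * h i k x * h i' l x)"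
    unfolding S_def power2_eq_square by (simp only: mult.assoc sum_product) (simp only: sum_distrib_left mult.assoc)
  also have "\<dots> = (\<Sum>k\<in>A. \<Sum>l\<in>A. expectation (\<lambda>x. h i i' x * h i i' x * h i k x * h i' l x))"
    by (subst expectation_sum; (intro sum.cong refl expectation_sum)?) auto
  also have "\<dots> \<le> (\<Sum>k\<in>A. K4)"
  proof (rule sum_mono)
    fix k assume k: "k \<in> A"
    have "(\<Sum>l\<in>A. expectation (\<lambda>x. h i i' x * h i i' x * h i k x * h i' l x)) =
       (\<Sum>l\<in>{k}. expectation (\<lambda>x. h i i' x * h i i' x * h i k x * h i' l x))"
    proof (rule sum.mono_neutral_right)
      show "\<forall>l\<in>A - {k}. expectation (\<lambda>x. h i i' x * h i i' x * h i k x * h i' l x) = 0"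
      proof
        fix l assume l: "l \<in> A - {k}"
        have "k \<noteq> i" "i \<noteq> k" "k \<noteq> i'" "k \<noteq> l" using A k l by auto
        then have "expectation (\<lambda>x. h i k x * (h i i' x * h i i' x * h i' l x)) = 0"
          using ii by (intro expectation_h_zero) (auto simp: flip_inv_def)
        then show "expectation (\<lambda>x. h i i' x * h i i' x * h i k x * h i' l x) = 0" by (simp add: mult_ac)
      qed
    qed (use A k in auto)
    also have "\<dots> \<le> K4" using expectation_h_product[of i i' i i' i k i' k] A ii k by auto
    finally show "(\<Sum>l\<in>A. expectation (\<lambda>x. h i i' x * h i i' x * h i k x * h i' l x)) \<le> K4" .
  qed
  finally show ?thesis by simp
qed

lemma U_insert: "finite A \<Longrightarrow> r \<notin> A \<Longrightarrow> U i (insert r A) x = U i A x + 2 * (h i r x * S i A x)"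
  unfolding U_def S_def by (simp add: power2_sum)

text \<open>Splitting off the rows \<open>i\<close> and \<open>i'\<close> from each other's sums leaves a product of sums over the
remaining rows, two mixed terms that vanish, and a term with \<open>(h i i')\<^sup>2\<close>.\<close>

lemma expectation_U_U:
  assumes i: "i < p" "i' < p" and ii: "i \<noteq> i'"
  shows "expectation (\<lambda>x. U i ({..<p} - {i}) x * U i' ({..<p} - {i'}) x) \<le> 2 * (real p)\<^sup>2 * C4 + 4 * real p * K4"
proof -
  define A where "A = {..<p} - {i, i'}"
  have A: "finite A" "i \<notin> A" "i' \<notin> A" unfolding A_def by auto
  have "card A \<le> card {..<p}" unfolding A_def by (intro card_mono) auto
  then have cA: "real (card A) \<le> real p" by simp
  have B: "{..<p} - {i} = insert i' A" "{..<p} - {i'} = insert i A" unfolding A_def using i ii by auto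
  have "expectation (\<lambda>x. U i ({..<p} - {i}) x * U i' ({..<p} - {i'}) x) =
    expectation (\<lambda>x. U i A x * U i' A x + 2 * (h i i' x * S i A x * U i' A x)
       + 2 * (h i' i x * S i' A x * U i A x) + 4 * ((h i i' x)\<^sup>2 * S i A x * S i' A x))"
    unfolding B U_insert[OF A(1,3)] U_insert[OF A(1,2)] h_sym[of i' i]
    by (simp add: algebra_simps power2_eq_square)
  also have "\<dots> = expectation (\<lambda>x. U i A x * U i' A x) + 2 * expectation (\<lambda>x. h i i' x * S i A x * U i' A x)
       + 2 * expectation (\<lambda>x. h i' i x * S i' A x * U i A x) + 4 * expectation (\<lambda>x. (h i i' x)\<^sup>2 * S i A x * S i' A x)"
  proof -
    have "integrable N (\<lambda>x. U i A x * U i' A x)" "integrable N (\<lambda>x. h i i' x * S i A x * U i' A x)"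
      "integrable N (\<lambda>x. h i' i x * S i' A x * U i A x)" "integrable N (\<lambda>x. (h i i' x)\<^sup>2 * S i A x * S i' A x)" by auto
    then show ?thesis by simp
  qed
  also have "\<dots> \<le> 2 * (real (card A))\<^sup>2 * C4 + 2 * 0 + 2 * 0 + 4 * (real (card A) * K4)"
    using A ii by (intro add_mono mult_left_mono expectation_U_U_disjoint expectation_h_S_S
        eq_refl[OF expectation_h_S_U_zero]) auto
  also have "\<dots> \<le> 2 * (real p)\<^sup>2 * C4 + 2 * 0 + 2 * 0 + 4 * (real p * K4)"
    using cA C4_nonneg K4_nonneg by (intro add_mono mult_left_mono mult_right_mono power_mono) auto
  finally show ?thesis by simp
qed

text \<open>Each mean in the expansion belongs to four edges between rows. Of those that do not vanish,
the ones with at most three distinct rows contribute \<open>K8 / p\<close>, the four-cycles contribute \<open>\<theta>\<close>.\<close>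

lemma expectation_sum_U_sq:
  "expectation (\<lambda>x. (\<Sum>i<p. U i ({..<p} - {i}) x)\<^sup>2) \<le> 22 * K8 / real p + 64 * \<theta>"
proof -
  let ?U = "\<lambda>i. U i ({..<p} - {i})"
  have diag: "expectation (\<lambda>x. ?U i x * ?U i x) \<le> 18 * (real p)\<^sup>2 * K4" for i
  proof -
    have "card ({..<p} - {i}) \<le> card {..<p}" by (intro card_mono) auto
    then have cA: "real (card ({..<p} - {i})) \<le> real p" by simp
    have "expectation (\<lambda>x. (?U i x)\<^sup>2) \<le> 18 * (real (card ({..<p} - {i})))\<^sup>2 * K4"
      by (rule expectation_U_sq) auto
    also have "\<dots> \<le> 18 * (real p)\<^sup>2 * K4"
      using cA K4_nonneg by (intro mult_left_mono mult_right_mono power_mono) auto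
    finally show ?thesis by (simp add: power2_eq_square)
  qed
  have "expectation (\<lambda>x. (\<Sum>i<p. ?U i x)\<^sup>2) = expectation (\<lambda>x. \<Sum>i<p. \<Sum>i'<p. ?U i x * ?U i' x)"
    by (simp add: power2_eq_square sum_product)
  also have "\<dots> = (\<Sum>i<p. \<Sum>i'<p. expectation (\<lambda>x. ?U i x * ?U i' x))"
    by (subst expectation_sum; (intro sum.cong refl expectation_sum)?) auto
  also have "\<dots> \<le> (\<Sum>i<p. 18 * (real p)\<^sup>2 * K4 + real p * (2 * (real p)\<^sup>2 * C4 + 4 * real p * K4))"
  proof (rule sum_mono)
    fix i assume i: "i \<in> {..<p}"
    have "(\<Sum>i'<p. expectation (\<lambda>x. ?U i x * ?U i' x)) =
       expectation (\<lambda>x. ?U i x * ?U i x) + (\<Sum>i'\<in>{..<p} - {i}. expectation (\<lambda>x. ?U i x * ?U i' x))"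
      using i by (intro sum.remove) auto
    also have "\<dots> \<le> 18 * (real p)\<^sup>2 * K4 + (\<Sum>i'\<in>{..<p} - {i}. 2 * (real p)\<^sup>2 * C4 + 4 * real p * K4)"
      using i by (intro add_mono diag sum_mono expectation_U_U) auto
    also have "(\<Sum>i'\<in>{..<p} - {i}. 2 * (real p)\<^sup>2 * C4 + 4 * real p * K4) \<le> (\<Sum>i'<p. 2 * (real p)\<^sup>2 * C4 + 4 * real p * K4)"
      using C4_nonneg K4_nonneg by (intro sum_mono2) auto
    finally show "(\<Sum>i'<p. expectation (\<lambda>x. ?U i x * ?U i' x)) \<le> 18 * (real p)\<^sup>2 * K4 + real p * (2 * (real p)\<^sup>2 * C4 + 4 * real p * K4)"
      by simp
  qed
  also have "\<dots> = 22 * (real p ^ 3 * K4) + 2 * (real p ^ 4 * C4)"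
    by (simp add: power2_eq_square power3_eq_cube power4_eq_xxxx algebra_simps)
  also have "real p ^ 3 * K4 = K8 / real p" unfolding K4_def using p_pos
    by (simp add: power3_eq_cube power4_eq_xxxx)
  also have "real p ^ 4 * C4 = 32 * \<theta>" unfolding C4_def using p_pos by simp
  finally show ?thesis by simp
qed

section \<open>Normal approximation of the trace statistic\<close>

definition D :: "nat \<Rightarrow> (nat \<times> nat \<Rightarrow> real) \<Rightarrow> real" where
  "D i = S i ({..<p} - {i})"

definition W :: "(nat \<times> nat \<Rightarrow> real) \<Rightarrow> real" where
  "W x = 1 / 2 * (\<Sum>i<p. D i x)"

text \<open>The conditional second moment of \<open>h i k\<close> given the absolute values.\<close>

definition m :: "nat \<Rightarrow> nat \<Rightarrow> (nat \<times> nat \<Rightarrow> real) \<Rightarrow> real" where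
  "m i k x = 2 * (real n / real p)\<^sup>2 * cut i k x * ((Q i k x)\<^sup>2 - q i k x)"

lemma bdd_D [intro!]: "bdd_rv N (D i)" unfolding D_def by auto

lemma bdd_W [intro!]: "bdd_rv N W" unfolding W_def[abs_def] by auto

lemma bdd_m [intro!]: "bdd_rv N (m i k)" unfolding m_def[abs_def]
  by (intro bdd_rv_mult bdd_rv_diff bdd_rv_power bdd_rv_const bdd_cut bdd_Q bdd_q)

lemma m_sym: "m i k x = m k i x"
  unfolding m_def by (simp add: cut_sym[of i] Q_sym[of i] q_sym[of i])

lemma m_flip [simp]: "m i k (flip e x) = m i k x"
  unfolding m_def by simp

lemma m_nonneg: "m i k x \<ge> 0"
  unfolding m_def using q_le_Q[of i k x] by (intro mult_nonneg_nonneg) auto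

lemma m_le: "m i k x \<le> 8 / (real p)\<^sup>2"
proof -
  have "m i k x \<le> 2 * (real n / real p)\<^sup>2 * (cut i k x * (Q i k x)\<^sup>2)"
    unfolding m_def mult.assoc by (intro mult_left_mono) auto
  also have "\<dots> \<le> 2 * (real n / real p)\<^sup>2 * (4 / (real n)\<^sup>2)"
    by (intro mult_left_mono cut_Q_le) auto
  also have "\<dots> = 8 / (real p)\<^sup>2" using n_pos by (simp add: power_divide)
  finally show ?thesis .
qed

lemma expectation_h_sq_m:
  assumes ik: "i \<noteq> k" and G: "bdd_rv N G" "flip_inv i G"
  shows "expectation (\<lambda>x. (h i k x)\<^sup>2 * G x) = expectation (\<lambda>x. m i k x * G x)"
  unfolding m_def by (rule expectation_h_sq[OF assms])

text \<open>Every term involving row \<open>i\<close> occurs twice in \<open>\<Sum>r<p. D r x\<close>, once in \<open>D i\<close> and once in another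
\<open>D r\<close>. What remains does not depend on row \<open>i\<close>.\<close>

lemma W_minus_D: "i < p \<Longrightarrow> W x - D i x = 1 / 2 * (\<Sum>r\<in>{..<p} - {i}. S r ({..<p} - {i, r}) x)"
proof -
  assume i: "i < p"
  have "(\<Sum>r<p. D r x) = D i x + (\<Sum>r\<in>{..<p} - {i}. D r x)"
    using i by (intro sum.remove) auto
  also have "(\<Sum>r\<in>{..<p} - {i}. D r x) = (\<Sum>r\<in>{..<p} - {i}. h i r x + S r ({..<p} - {i, r}) x)"
  proof (rule sum.cong[OF refl])
    fix r assume r: "r \<in> {..<p} - {i}"
    have eq: "{..<p} - {r} = insert i ({..<p} - {i, r})" using r i by auto
    have "D r x = h r i x + S r ({..<p} - {i, r}) x"
      unfolding D_def S_def eq by (rule sum.insert) auto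
    then show "D r x = h i r x + S r ({..<p} - {i, r}) x"
      by (simp only: h_sym[of i r])
  qed
  also have "\<dots> = D i x + (\<Sum>r\<in>{..<p} - {i}. S r ({..<p} - {i, r}) x)"
    unfolding sum.distrib by (simp add: D_def S_def)
  finally show ?thesis unfolding W_def by (simp add: field_simps)
qed

lemma expectation_D_zero:
  assumes "bdd_rv N G" "flip_inv i G"
  shows "expectation (\<lambda>x. D i x * G x) = 0"
proof -
  have "expectation (\<lambda>x. D i x * G x) = (\<Sum>k\<in>{..<p} - {i}. expectation (\<lambda>x. h k i x * G x))"
    unfolding D_def S_def sum_distrib_right h_sym[of i] by (rule expectation_sum) (use assms in auto)
  also have "\<dots> = 0"
    by (intro sum.neutral ballI expectation_h_zero) (use assms in auto)
  finally show ?thesis .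
qed

lemma orthogonality_D:
  assumes i: "i < p"
  shows "(\<integral>x. complex_of_real (D i x) * iexp (t * (W x - D i x)) \<partial>N) = 0"
proof -
  have inv: "W (flip (i, j) x) - D i (flip (i, j) x) = W x - D i x" for j x
    unfolding W_minus_D[OF i] by (intro arg_cong2[where f = "(*)"] sum.cong refl S_flip) auto
  have bdd: "bdd_rv N (\<lambda>x. t * (W x - D i x))" by auto
  note [measurable] = bdd_rv_measurable[OF bdd]
  have int: "integrable N (\<lambda>x. complex_of_real (D i x) * iexp (t * (W x - D i x)))"
  proof (rule bdd_rv_integrable_cplx)
    show "(\<lambda>x. iexp (t * (W x - D i x))) \<in> borel_measurable N" by measurable
  qed auto
  have re: "Re (complex_of_real u * iexp v) = u * cos v" and im: "Im (complex_of_real u * iexp v) = u * sin v"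
    for u v :: real by (simp_all add: Re_exp Im_exp)
  have "Re (\<integral>x. complex_of_real (D i x) * iexp (t * (W x - D i x)) \<partial>N) =
      expectation (\<lambda>x. D i x * cos (t * (W x - D i x)))"
    by (subst integral_Re[OF int, symmetric], subst re) (rule refl)
  also have "\<dots> = 0"
    by (rule expectation_D_zero) (auto simp: flip_inv_def inv)
  finally have 1: "Re (\<integral>x. complex_of_real (D i x) * iexp (t * (W x - D i x)) \<partial>N) = 0" .
  have "Im (\<integral>x. complex_of_real (D i x) * iexp (t * (W x - D i x)) \<partial>N) =
      expectation (\<lambda>x. D i x * sin (t * (W x - D i x)))"
    by (subst integral_Im[OF int, symmetric], subst im) (rule refl)
  also have "\<dots> = 0"
    by (rule expectation_D_zero) (auto simp: flip_inv_def inv)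
  finally have 2: "Im (\<integral>x. complex_of_real (D i x) * iexp (t * (W x - D i x)) \<partial>N) = 0" .
  show ?thesis using 1 2 by (simp add: complex_eq_iff)
qed

text \<open>Interpolation between the second and the fourth moment, of orders \<open>1 / p\<close> and \<open>1 / p\<^sup>2\<close>.\<close>

lemma expectation_D3:
  assumes i: "i < p"
  shows "expectation (\<lambda>x. \<bar>D i x\<bar> ^ 3) \<le> (4 + 4 * K8) / (real p * sqrt (real p))"
proof -
  \<comment> \<open>With this weight both terms of the interpolation have the order \<open>p powr (- 3 / 2)\<close>.\<close>
  define \<eta> where "\<eta> = 1 / sqrt (real p)"
  have \<eta>: "\<eta> > 0" unfolding \<eta>_def using p_pos by simp
  have card: "real (card ({..<p} - {i})) \<le> real p"
    using card_mono[of "{..<p}" "{..<p} - {i}"] by auto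
  have D2: "expectation (\<lambda>x. (D i x)\<^sup>2) \<le> 8 / real p"
  proof -
    have "expectation (\<lambda>x. (D i x)\<^sup>2 * 1) = (\<Sum>k\<in>{..<p} - {i}. expectation (\<lambda>x. (h i k x)\<^sup>2 * 1))"
      unfolding D_def by (rule expectation_S_sq) (auto simp: flip_inv_def)
    also have "\<dots> \<le> (\<Sum>k\<in>{..<p} - {i}. 8 / (real p)\<^sup>2)"
    proof (rule sum_mono)
      fix k assume k: "k \<in> {..<p} - {i}"
      have "expectation (\<lambda>x. (h i k x)\<^sup>2 * 1) = expectation (\<lambda>x. m i k x * 1)"
        using k by (intro expectation_h_sq_m) (auto simp: flip_inv_def)
      also have "\<dots> \<le> expectation (\<lambda>_. 8 / (real p)\<^sup>2)"
        by (rule expectation_mono) (auto simp: m_le)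
      finally show "expectation (\<lambda>x. (h i k x)\<^sup>2 * 1) \<le> 8 / (real p)\<^sup>2" by (simp add: prob_space)
    qed
    also have "\<dots> = real (card ({..<p} - {i})) * (8 / (real p)\<^sup>2)" by simp
    also have "\<dots> \<le> real p * (8 / (real p)\<^sup>2)"
      using card by (rule mult_right_mono) auto
    finally show ?thesis using p_pos by (simp add: power2_eq_square)
  qed
  have D4: "expectation (\<lambda>x. (D i x) ^ 4) \<le> 8 * K8 / (real p)\<^sup>2"
  proof -
    have "expectation (\<lambda>x. (D i x) ^ 4) \<le> 8 * (real (card ({..<p} - {i})))\<^sup>2 * K4"
      unfolding D_def by (rule expectation_S4) auto
    also have "\<dots> \<le> 8 * (real p)\<^sup>2 * K4"
      using card K4_nonneg by (intro mult_right_mono mult_left_mono power_mono) auto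
    also have "\<dots> = 8 * K8 / (real p)\<^sup>2"
      unfolding K4_def using p_pos by (simp add: power2_eq_square power4_eq_xxxx)
    finally show ?thesis .
  qed
  have "expectation (\<lambda>x. \<bar>D i x\<bar> ^ 3) \<le> expectation (\<lambda>x. \<eta> / 2 * (D i x)\<^sup>2 + 1 / (2 * \<eta>) * (D i x) ^ 4)"
  proof (rule expectation_mono)
    fix x
    let ?d = "\<bar>D i x\<bar>"
    have "0 \<le> ?d\<^sup>2 * (?d - \<eta>)\<^sup>2 / (2 * \<eta>)" using \<eta> by simp
    also have "\<dots> = \<eta> / 2 * ?d\<^sup>2 + 1 / (2 * \<eta>) * ?d ^ 4 - ?d ^ 3"
      using \<eta> by (simp add: power2_eq_square power3_eq_cube power4_eq_xxxx field_simps)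
    finally show "?d ^ 3 \<le> \<eta> / 2 * (D i x)\<^sup>2 + 1 / (2 * \<eta>) * (D i x) ^ 4"
      by simp
  qed auto
  also have "\<dots> = \<eta> / 2 * expectation (\<lambda>x. (D i x)\<^sup>2) + 1 / (2 * \<eta>) * expectation (\<lambda>x. (D i x) ^ 4)"
  proof -
    have "integrable N (\<lambda>x. (D i x)\<^sup>2)" "integrable N (\<lambda>x. (D i x) ^ 4)" by auto
    then show ?thesis by simp
  qed
  also have "\<dots> \<le> \<eta> / 2 * (8 / real p) + 1 / (2 * \<eta>) * (8 * K8 / (real p)\<^sup>2)"
    using \<eta> by (intro add_mono mult_left_mono D2 D4) auto
  also have "\<dots> = (4 + 4 * K8) / (real p * sqrt (real p))"
  proof -
    have "\<eta> / 2 * (8 / real p) = 4 / (real p * sqrt (real p))" unfolding \<eta>_def by simp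
    moreover have "1 / (2 * \<eta>) * (8 * K8 / (real p)\<^sup>2) = 4 * K8 * (sqrt (real p) / (real p)\<^sup>2)"
      unfolding \<eta>_def by simp
    moreover have "sqrt (real p) / (real p)\<^sup>2 = 1 / (real p * sqrt (real p))"
    proof -
      have "sqrt (real p) * (real p * sqrt (real p)) = (real p)\<^sup>2"
        using real_sqrt_mult_self[of "real p"] by (simp add: power2_eq_square mult_ac)
      then show ?thesis using p_pos by (simp add: divide_simps)
    qed
    ultimately show ?thesis by (simp add: add_divide_distrib)
  qed
  finally show ?thesis .
qed

text \<open>Outside the truncation event \<open>n * Q i k > 2\<close>, so \<open>n * Q i k\<close> is at most twice its deviation from \<open>1\<close>.\<close>

lemma cut_compl_Q_le: "(1 - cut i k x) * (real n * Q i k x)\<^sup>2 \<le> 4 * (real n * Q i k x - 1)\<^sup>2"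
proof (cases "Q i k x \<le> 2 / real n")
  case False
  then have "real n * Q i k x > 2" using n_pos by (simp add: field_simps)
  then have "(real n * Q i k x)\<^sup>2 \<le> (2 * (real n * Q i k x - 1))\<^sup>2" by (intro power_mono) auto
  also have "\<dots> = 4 * (real n * Q i k x - 1)\<^sup>2" unfolding power_mult_distrib by simp
  finally show ?thesis using False by (simp add: cut_def)
qed (simp add: cut_def)

definition \<beta> :: real where "\<beta> = 11 * \<theta> + 2 * sqrt (2 * \<theta>)"

lemma expectation_m_deviation:
  assumes ik: "i \<noteq> k"
  shows "expectation (\<lambda>x. \<bar>m i k x - 2 / (real p)\<^sup>2\<bar>) \<le> 2 / (real p)\<^sup>2 * \<beta>"
proof -
  define u where "u x = real n * Q i k x - 1" for x
  have bu: "bdd_rv N u" unfolding u_def[abs_def] by auto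
  have u2: "expectation (\<lambda>x. (u x)\<^sup>2) \<le> 2 * \<theta>" unfolding u_def by (rule expectation_Q_deviation[OF ik])
  have u1: "expectation (\<lambda>x. \<bar>u x\<bar>) \<le> sqrt (2 * \<theta>)"
    by (rule expectation_abs_le_sqrt[OF bu u2])
  have "expectation (\<lambda>x. \<bar>m i k x - 2 / (real p)\<^sup>2\<bar>) \<le>
     expectation (\<lambda>x. 2 / (real p)\<^sup>2 * (5 * (u x)\<^sup>2 + 2 * \<bar>u x\<bar> + (real n)\<^sup>2 * q i k x))"
  proof (rule expectation_mono)
    fix x
    let ?c = "cut i k x"
    have "m i k x - 2 / (real p)\<^sup>2 = 2 / (real p)\<^sup>2 * (?c * ((real n * Q i k x)\<^sup>2 - (real n)\<^sup>2 * q i k x) - 1)"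
      unfolding m_def power_mult_distrib by (simp add: power_divide algebra_simps diff_divide_distrib)
    also have "?c * ((real n * Q i k x)\<^sup>2 - (real n)\<^sup>2 * q i k x) - 1 =
       (u x)\<^sup>2 + 2 * u x - (1 - ?c) * (real n * Q i k x)\<^sup>2 - ?c * ((real n)\<^sup>2 * q i k x)"
      unfolding u_def by (simp add: power2_eq_square algebra_simps)
    finally have eq: "m i k x - 2 / (real p)\<^sup>2 = 2 / (real p)\<^sup>2 * ((u x)\<^sup>2 + 2 * u x - (1 - ?c) * (real n * Q i k x)\<^sup>2 - ?c * ((real n)\<^sup>2 * q i k x))" .
    have "\<bar>m i k x - 2 / (real p)\<^sup>2\<bar> = 2 / (real p)\<^sup>2 * \<bar>(u x)\<^sup>2 + 2 * u x - (1 - ?c) * (real n * Q i k x)\<^sup>2 - ?c * ((real n)\<^sup>2 * q i k x)\<bar>"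
      unfolding eq abs_mult by simp
    also have "\<dots> \<le> 2 / (real p)\<^sup>2 * (5 * (u x)\<^sup>2 + 2 * \<bar>u x\<bar> + (real n)\<^sup>2 * q i k x)"
    proof (rule mult_left_mono)
      have 1: "(1 - ?c) * (real n * Q i k x)\<^sup>2 \<le> 4 * (u x)\<^sup>2" unfolding u_def by (rule cut_compl_Q_le)
      have 2: "0 \<le> (1 - ?c) * (real n * Q i k x)\<^sup>2" by (intro mult_nonneg_nonneg) auto
      have 3: "?c * ((real n)\<^sup>2 * q i k x) \<le> 1 * ((real n)\<^sup>2 * q i k x)" by (intro mult_right_mono) auto
      have 4: "0 \<le> ?c * ((real n)\<^sup>2 * q i k x)" by (intro mult_nonneg_nonneg) auto
      have 5: "0 \<le> (u x)\<^sup>2" by simp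
      show "\<bar>(u x)\<^sup>2 + 2 * u x - (1 - ?c) * (real n * Q i k x)\<^sup>2 - ?c * ((real n)\<^sup>2 * q i k x)\<bar> \<le>
         5 * (u x)\<^sup>2 + 2 * \<bar>u x\<bar> + (real n)\<^sup>2 * q i k x"
        using 1 2 3 4 5 by linarith
    qed auto
    finally show "\<bar>m i k x - 2 / (real p)\<^sup>2\<bar> \<le> 2 / (real p)\<^sup>2 * (5 * (u x)\<^sup>2 + 2 * \<bar>u x\<bar> + (real n)\<^sup>2 * q i k x)" .
  qed (use bu in auto)
  also have "\<dots> = 2 / (real p)\<^sup>2 * (5 * expectation (\<lambda>x. (u x)\<^sup>2) + 2 * expectation (\<lambda>x. \<bar>u x\<bar>) + (real n)\<^sup>2 * expectation (q i k))"
  proof -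
    have "integrable N (\<lambda>x. (u x)\<^sup>2)" "integrable N (\<lambda>x. \<bar>u x\<bar>)" "integrable N (q i k)" using bu by auto
    then show ?thesis by simp
  qed
  also have "(real n)\<^sup>2 * expectation (q i k) = \<theta>"
    unfolding expectation_q[OF ik] \<theta>_def using n_pos by (simp add: power2_eq_square)
  also have "2 / (real p)\<^sup>2 * (5 * expectation (\<lambda>x. (u x)\<^sup>2) + 2 * expectation (\<lambda>x. \<bar>u x\<bar>) + \<theta>) \<le>
      2 / (real p)\<^sup>2 * (5 * (2 * \<theta>) + 2 * sqrt (2 * \<theta>) + \<theta>)"
    by (intro mult_left_mono add_mono u1 u2) auto
  finally show ?thesis unfolding \<beta>_def by simp
qed

text \<open>The squares \<open>(h i k)\<^sup>2\<close>, centred by their conditional means, are uncorrelated for different pairs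
of rows.\<close>

lemma expectation_rho:
  "expectation (\<lambda>x. (\<Sum>e\<in>offdiag {..<p}. (h (fst e) (snd e) x)\<^sup>2 - m (fst e) (snd e) x)\<^sup>2) \<le> (4 * K8 + 256) / (real p)\<^sup>2"
proof -
  define f where "f i k x = (h i k x)\<^sup>2 - m i k x" for i k x
  have "expectation (\<lambda>x. (\<Sum>e\<in>offdiag {..<p}. f (fst e) (snd e) x)\<^sup>2) \<le> 2 * (real p)\<^sup>2 * ((2 * K8 + 128) / real p ^ 4)"
  proof (rule pair_sum_second_moment)
    show bf: "bdd_rv N (f i k)" for i k unfolding f_def[abs_def] by auto
    show "f i k x = f k i x" for i k x unfolding f_def by (simp add: h_sym[of i] m_sym[of i])
    show "0 \<le> (2 * K8 + 128) / real p ^ 4" using K8_pos by simp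
    show "expectation (\<lambda>x. f i k x * f i' k' x) = 0"
      if "i \<noteq> k" "i' \<noteq> k'" "i \<noteq> i'" "i \<noteq> k'" for i k i' k'
    proof -
      have inv: "flip_inv i (f i' k')" using that by (simp add: flip_inv_def f_def)
      have "expectation (\<lambda>x. f i k x * f i' k' x) = expectation (\<lambda>x. (h i k x)\<^sup>2 * f i' k' x - m i k x * f i' k' x)"
        by (simp add: f_def[of i k] left_diff_distrib)
      also have "\<dots> = expectation (\<lambda>x. (h i k x)\<^sup>2 * f i' k' x) - expectation (\<lambda>x. m i k x * f i' k' x)"
        by (rule Bochner_Integration.integral_diff) (use bf in auto)
      finally show ?thesis using expectation_h_sq_m[OF that(1) bf inv] by simp
    qed
    show "expectation (\<lambda>x. (f i k x)\<^sup>2) \<le> (2 * K8 + 128) / real p ^ 4" if ik: "i \<noteq> k" for i k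
    proof -
      have "expectation (\<lambda>x. (f i k x)\<^sup>2) \<le> expectation (\<lambda>x. 2 * (h i k x) ^ 4 + 128 / real p ^ 4)"
      proof (rule expectation_mono)
        fix x
        have "(m i k x)\<^sup>2 \<le> (8 / (real p)\<^sup>2)\<^sup>2" using m_nonneg m_le by (intro power_mono)
        then have "2 * (m i k x)\<^sup>2 \<le> 128 / real p ^ 4" by (simp add: power_divide flip: power_mult)
        moreover have "(f i k x)\<^sup>2 \<le> 2 * ((h i k x)\<^sup>2)\<^sup>2 + 2 * (m i k x)\<^sup>2"
          using zero_le_power2[of "(h i k x)\<^sup>2 + m i k x"] unfolding f_def power2_sum power2_diff by linarith
        ultimately show "(f i k x)\<^sup>2 \<le> 2 * (h i k x) ^ 4 + 128 / real p ^ 4" by (simp flip: power_mult)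
      qed (use bf in auto)
      also have "\<dots> = 2 * expectation (\<lambda>x. (h i k x) ^ 4) + 128 / real p ^ 4"
      proof -
        have "integrable N (\<lambda>x. (h i k x) ^ 4)" by auto
        then show ?thesis by (simp add: prob_space)
      qed
      also have "\<dots> \<le> 2 * K4 + 128 / real p ^ 4" using expectation_h4[OF ik] by simp
      finally show ?thesis by (simp add: K4_def add_divide_distrib)
    qed
  qed
  also have "2 * (real p)\<^sup>2 * ((2 * K8 + 128) / real p ^ 4) = (4 * K8 + 256) / (real p)\<^sup>2"
    using p_pos by (simp add: power2_eq_square power4_eq_xxxx field_simps)
  finally show ?thesis unfolding f_def .
qed

definition \<delta> :: real where
  "\<delta> = 1 / 2 * sqrt (22 * K8 / real p + 64 * \<theta>) + 1 / 2 * sqrt ((4 * K8 + 256) / (real p)\<^sup>2) + \<beta> + 1 / real p"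

text \<open>The sum of the \<open>(D i)\<^sup>2\<close> splits into the off-diagonal terms \<open>U\<close>, the fluctuation of the squares of \<open>h\<close>
around their conditional means \<open>m\<close>, and the deviation of \<open>m\<close> from the constant \<open>2 / p\<^sup>2\<close>. The error
\<open>1 / p\<close> comes from the \<open>p\<close> missing diagonal terms.\<close>

lemma expectation_V_deviation:
  "expectation (\<lambda>x. \<bar>1 / 2 * (\<Sum>i<p. (D i x)\<^sup>2) - 1\<bar>) \<le> \<delta>"
proof -
  define UU where "UU x = (\<Sum>i<p. U i ({..<p} - {i}) x)" for x
  define RR where "RR x = (\<Sum>e\<in>offdiag {..<p}. (h (fst e) (snd e) x)\<^sup>2 - m (fst e) (snd e) x)" for x
  define MM where "MM x = (\<Sum>e\<in>offdiag {..<p}. \<bar>m (fst e) (snd e) x - 2 / (real p)\<^sup>2\<bar>)" for x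
  have bUU: "bdd_rv N UU" unfolding UU_def[abs_def] by auto
  have bRR: "bdd_rv N RR" unfolding RR_def[abs_def] by auto
  have bMM: "bdd_rv N MM" unfolding MM_def[abs_def] by auto
  have "expectation (\<lambda>x. \<bar>1 / 2 * (\<Sum>i<p. (D i x)\<^sup>2) - 1\<bar>) \<le>
    expectation (\<lambda>x. 1 / 2 * \<bar>UU x\<bar> + 1 / 2 * \<bar>RR x\<bar> + 1 / 2 * MM x + 1 / real p)"
  proof (rule expectation_mono)
    fix x
    have "(\<Sum>i<p. (D i x)\<^sup>2) = (\<Sum>i<p. U i ({..<p} - {i}) x + (\<Sum>k\<in>{..<p} - {i}. (h i k x)\<^sup>2))"
      unfolding U_def D_def by simp
    also have "\<dots> = UU x + (\<Sum>e\<in>offdiag {..<p}. (h (fst e) (snd e) x)\<^sup>2)"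
      unfolding sum.distrib UU_def sum_offdiag[symmetric] ..
    also have "(\<Sum>e\<in>offdiag {..<p}. (h (fst e) (snd e) x)\<^sup>2) = RR x + (\<Sum>e\<in>offdiag {..<p}. m (fst e) (snd e) x - 2 / (real p)\<^sup>2) + (\<Sum>e\<in>offdiag {..<p}. 2 / (real p)\<^sup>2)"
      unfolding RR_def by (simp add: sum.distrib sum_subtractf)
    also have "(\<Sum>e\<in>offdiag {..<p}. 2 / (real p)\<^sup>2) = 2 - 2 / real p"
      using p_pos by (simp add: card_offdiag power2_eq_square field_simps)
    finally have eq: "1 / 2 * (\<Sum>i<p. (D i x)\<^sup>2) - 1 =
        1 / 2 * UU x + 1 / 2 * RR x + 1 / 2 * (\<Sum>e\<in>offdiag {..<p}. m (fst e) (snd e) x - 2 / (real p)\<^sup>2) - 1 / real p"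
      by (simp add: add_divide_distrib diff_divide_distrib)
    have "\<bar>\<Sum>e\<in>offdiag {..<p}. m (fst e) (snd e) x - 2 / (real p)\<^sup>2\<bar> \<le> MM x"
      unfolding MM_def by (rule sum_abs)
    moreover have "1 / real p \<ge> 0" by simp
    ultimately show "\<bar>1 / 2 * (\<Sum>i<p. (D i x)\<^sup>2) - 1\<bar> \<le> 1 / 2 * \<bar>UU x\<bar> + 1 / 2 * \<bar>RR x\<bar> +
        1 / 2 * MM x + 1 / real p"
      unfolding eq by linarith
  qed (use bUU bRR bMM in auto)
  also have "\<dots> = 1 / 2 * expectation (\<lambda>x. \<bar>UU x\<bar>) + 1 / 2 * expectation (\<lambda>x. \<bar>RR x\<bar>) +
      1 / 2 * (\<Sum>e\<in>offdiag {..<p}. expectation (\<lambda>x. \<bar>m (fst e) (snd e) x - 2 / (real p)\<^sup>2\<bar>)) + 1 / real p"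
  proof -
    have "integrable N (\<lambda>x. \<bar>UU x\<bar>)" "integrable N (\<lambda>x. \<bar>RR x\<bar>)"
      "integrable N (\<lambda>x. MM x)" using bUU bRR bMM by auto
    moreover have "expectation (\<lambda>x. MM x) =
       (\<Sum>e\<in>offdiag {..<p}. expectation (\<lambda>x. \<bar>m (fst e) (snd e) x - 2 / (real p)\<^sup>2\<bar>))"
      unfolding MM_def by (rule expectation_sum) auto
    ultimately show ?thesis by (simp add: prob_space)
  qed
  also have "\<dots> \<le> 1 / 2 * sqrt (22 * K8 / real p + 64 * \<theta>) + 1 / 2 * sqrt ((4 * K8 + 256) / (real p)\<^sup>2) +
      1 / 2 * (\<Sum>e\<in>offdiag {..<p}. 2 / (real p)\<^sup>2 * \<beta>) + 1 / real p"
  proof (intro add_mono mult_left_mono sum_mono order_refl)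
    show "expectation (\<lambda>x. \<bar>UU x\<bar>) \<le> sqrt (22 * K8 / real p + 64 * \<theta>)"
      by (rule expectation_abs_le_sqrt[OF bUU]) (unfold UU_def, rule expectation_sum_U_sq)
    show "expectation (\<lambda>x. \<bar>RR x\<bar>) \<le> sqrt ((4 * K8 + 256) / (real p)\<^sup>2)"
      by (rule expectation_abs_le_sqrt[OF bRR]) (unfold RR_def, rule expectation_rho)
    show "expectation (\<lambda>x. \<bar>m (fst e) (snd e) x - 2 / (real p)\<^sup>2\<bar>) \<le> 2 / (real p)\<^sup>2 * \<beta>"
      if "e \<in> offdiag {..<p}" for e
      using that by (intro expectation_m_deviation) (auto simp: offdiag_def)
  qed auto
  also have "1 / 2 * (\<Sum>e\<in>offdiag {..<p}. 2 / (real p)\<^sup>2 * \<beta>) \<le> \<beta>"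
  proof -
    have "\<beta> \<ge> 0" unfolding \<beta>_def using theta_nonneg by simp
    have "1 / 2 * (\<Sum>e\<in>offdiag {..<p}. 2 / (real p)\<^sup>2 * \<beta>) = (real p - 1) / real p * \<beta>"
      using p_pos by (simp add: card_offdiag power2_eq_square)
    also have "\<dots> \<le> 1 * \<beta>"
      using p_pos \<open>\<beta> \<ge> 0\<close> by (intro mult_right_mono) auto
    finally show ?thesis by simp
  qed
  finally show ?thesis unfolding \<delta>_def by simp
qed

lemma cf_W:
  "cmod ((\<integral>x. iexp (t * W x) \<partial>N) - exp (- t\<^sup>2 / 2)) \<le> t\<^sup>2 * \<delta> + \<bar>t\<bar> ^ 3 * ((1 + K8) / sqrt (real p))"
proof -
  have "cmod ((\<integral>x. iexp (t * W x) \<partial>N) - exp (- t\<^sup>2 / 2)) \<le>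
    t\<^sup>2 * expectation (\<lambda>x. \<bar>1 / 2 * (\<Sum>i<p. (D i x)\<^sup>2) - 1\<bar>) +
    \<bar>t\<bar> ^ 3 / 2 * (\<bar>1 / 2\<bar> * (\<Sum>i<p. expectation (\<lambda>x. \<bar>D i x\<bar> ^ 3)))"
  proof (rule cf_normal_approximation)
    show "W x = 1 / 2 * (\<Sum>i<p. D i x)" for x by (rule W_def)
    show "(\<integral>x. complex_of_real (D i x) * iexp (t * (W x - D i x)) \<partial>N) = 0" if "i \<in> {..<p}" for i t
      using that by (intro orthogonality_D) auto
  qed auto
  also have "\<dots> \<le> t\<^sup>2 * \<delta> + \<bar>t\<bar> ^ 3 / 2 * (\<bar>1 / 2\<bar> * (\<Sum>i<p. (4 + 4 * K8) / (real p * sqrt (real p))))"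
    by (intro add_mono mult_left_mono sum_mono expectation_V_deviation expectation_D3) auto
  also have "(\<Sum>i<p. (4 + 4 * K8) / (real p * sqrt (real p))) = (4 + 4 * K8) / sqrt (real p)"
    using p_pos by simp
  also have "\<bar>t\<bar> ^ 3 / 2 * (\<bar>1 / 2\<bar> * ((4 + 4 * K8) / sqrt (real p))) = \<bar>t\<bar> ^ 3 * ((1 + K8) / sqrt (real p))"
  proof -
    have eq: "(4 + 4 * K8) / sqrt (real p) = 4 * ((1 + K8) / sqrt (real p))" by (simp add: add_divide_distrib)
    have "\<bar>t\<bar> ^ 3 / 2 * (\<bar>1 / 2\<bar> * (4 * X)) = \<bar>t\<bar> ^ 3 * X" for X :: real by simp
    then show ?thesis unfolding eq .
  qed
  finally show ?thesis .
qed

definition T :: "(nat \<times> nat \<Rightarrow> real) \<Rightarrow> real" where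
  "T x = real n / (2 * real p) * (\<Sum>e\<in>offdiag {..<p}. Q (fst e) (snd e) x - 1 / real n + H (fst e) (snd e) x)"

lemma bdd_T [intro!]: "bdd_rv N T"
  unfolding T_def[abs_def] by (intro bdd_rv_mult bdd_rv_sum bdd_rv_add bdd_rv_diff bdd_rv_const bdd_Q bdd_H)

text \<open>The part of \<open>H\<close> removed by truncation is itself a degenerate kernel, and its conditional variance is
dominated by the squared deviation of \<open>n * Q\<close> from \<open>1\<close>.\<close>

lemma expectation_cut_remainder:
  "expectation (\<lambda>x. (\<Sum>e\<in>offdiag {..<p}. (1 - cut (fst e) (snd e) x) * H (fst e) (snd e) x)\<^sup>2) \<le> 2 * (real p)\<^sup>2 * (16 * \<theta> / (real n)\<^sup>2)"
proof -
  define f where "f i k x = (1 - cut i k x) * H i k x" for i k x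
  have "expectation (\<lambda>x. (\<Sum>e\<in>offdiag {..<p}. f (fst e) (snd e) x)\<^sup>2) \<le> 2 * (real p)\<^sup>2 * (16 * \<theta> / (real n)\<^sup>2)"
  proof (rule pair_sum_second_moment)
    show bf: "bdd_rv N (f i k)" for i k unfolding f_def[abs_def] by auto
    show "f i k x = f k i x" for i k x unfolding f_def by (simp add: H_sym[of i] cut_sym[of i])
    show "0 \<le> 16 * \<theta> / (real n)\<^sup>2" using theta_nonneg by simp
    show "expectation (\<lambda>x. f i k x * f i' k' x) = 0"
      if "i \<noteq> k" "i' \<noteq> k'" "i \<noteq> i'" "i \<noteq> k'" for i k i' k'
    proof -
      have "expectation (\<lambda>x. f i k x * f i' k' x) =
        expectation (\<lambda>x. \<Sum>e\<in>offdiag {..<n}. Z i e x * ((1 - cut i k x) * Z k e x * f i' k' x))"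
        unfolding f_def[of i k] H_def by (simp add: sum_distrib_left sum_distrib_right mult_ac)
      also have "\<dots> = (\<Sum>e\<in>offdiag {..<n}. expectation (\<lambda>x. Z i e x * ((1 - cut i k x) * Z k e x * f i' k' x)))"
        by (rule expectation_sum) (use bf in auto)
      also have "\<dots> = 0"
        by (intro sum.neutral ballI expectation_Z_zero) (use that bf in \<open>auto simp: flip_inv_def f_def\<close>)
      finally show ?thesis .
    qed
    show "expectation (\<lambda>x. (f i k x)\<^sup>2) \<le> 16 * \<theta> / (real n)\<^sup>2" if ik: "i \<noteq> k" for i k
    proof -
      have "expectation (\<lambda>x. (f i k x)\<^sup>2) = expectation (\<lambda>x. (H i k x)\<^sup>2 * (1 - cut i k x)\<^sup>2)"
        unfolding f_def by (simp add: power_mult_distrib mult.commute)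
      also have "\<dots> = 2 * expectation (\<lambda>x. ((Q i k x)\<^sup>2 - q i k x) * (1 - cut i k x)\<^sup>2)"
        using ik by (intro expectation_H_sq) (auto simp: flip_inv_def)
      also have "\<dots> \<le> 2 * expectation (\<lambda>x. 4 / (real n)\<^sup>2 * (real n * Q i k x - 1)\<^sup>2)"
      proof (intro mult_left_mono expectation_mono)
        fix x
        have "(1 - cut i k x)\<^sup>2 = 1 - cut i k x" by (simp add: cut_def)
        then have "((Q i k x)\<^sup>2 - q i k x) * (1 - cut i k x)\<^sup>2 \<le> (Q i k x)\<^sup>2 * (1 - cut i k x)"
          by (simp add: mult_right_mono)
        also have "\<dots> = 1 / (real n)\<^sup>2 * ((1 - cut i k x) * (real n * Q i k x)\<^sup>2)"
          using n_pos by (simp add: power_mult_distrib)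
        also have "\<dots> \<le> 1 / (real n)\<^sup>2 * (4 * (real n * Q i k x - 1)\<^sup>2)"
          by (intro mult_left_mono cut_compl_Q_le) auto
        finally show "((Q i k x)\<^sup>2 - q i k x) * (1 - cut i k x)\<^sup>2 \<le> 4 / (real n)\<^sup>2 * (real n * Q i k x - 1)\<^sup>2" by simp
      qed auto
      also have "\<dots> = 8 / (real n)\<^sup>2 * expectation (\<lambda>x. (real n * Q i k x - 1)\<^sup>2)" by simp
      also have "\<dots> \<le> 8 / (real n)\<^sup>2 * (2 * \<theta>)"
        by (intro mult_left_mono expectation_Q_deviation ik) auto
      finally show ?thesis by simp
    qed
  qed
  then show ?thesis unfolding f_def .
qed

text \<open>Here orthogonality of different pairs comes from exchangeability instead of signs: given all other rows,
\<open>Q i k\<close> has mean \<open>1 / n\<close>.\<close>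

lemma expectation_Q_remainder:
  "expectation (\<lambda>x. (\<Sum>e\<in>offdiag {..<p}. Q (fst e) (snd e) x - 1 / real n)\<^sup>2) \<le> 2 * (real p)\<^sup>2 * (2 * \<theta> / (real n)\<^sup>2)"
proof -
  define f where "f i k x = Q i k x - 1 / real n" for i k x
  have "expectation (\<lambda>x. (\<Sum>e\<in>offdiag {..<p}. f (fst e) (snd e) x)\<^sup>2) \<le> 2 * (real p)\<^sup>2 * (2 * \<theta> / (real n)\<^sup>2)"
  proof (rule pair_sum_second_moment)
    show bf: "bdd_rv N (f i k)" for i k unfolding f_def[abs_def] by auto
    show "f i k x = f k i x" for i k x unfolding f_def by (simp add: Q_sym[of i])
    show "0 \<le> 2 * \<theta> / (real n)\<^sup>2" using theta_nonneg by simp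
    show "expectation (\<lambda>x. f i k x * f i' k' x) = 0"
      if "i \<noteq> k" "i' \<noteq> k'" "i \<noteq> i'" "i \<noteq> k'" for i k i' k'
    proof -
      have inv: "swap_inv i (f i' k')" using that by (auto simp: swap_inv_def f_def Q_def a_colswap)
      have "expectation (\<lambda>x. f i k x * f i' k' x) = expectation (\<lambda>x. Q i k x * f i' k' x - 1 / real n * f i' k' x)"
        unfolding f_def[of i k] by (simp only: left_diff_distrib)
      also have "\<dots> = expectation (\<lambda>x. Q i k x * f i' k' x) - expectation (\<lambda>x. 1 / real n * f i' k' x)"
        by (rule Bochner_Integration.integral_diff) (use bf in auto)
      also have "\<dots> = 0" using expectation_Q[OF that(1) bf inv] by simp
      finally show ?thesis .
    qed
    show "expectation (\<lambda>x. (f i k x)\<^sup>2) \<le> 2 * \<theta> / (real n)\<^sup>2" if ik: "i \<noteq> k" for i k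
    proof -
      have "(f i k x)\<^sup>2 = 1 / (real n)\<^sup>2 * (real n * Q i k x - 1)\<^sup>2" for x
      proof -
        have "f i k x = 1 / real n * (real n * Q i k x - 1)" unfolding f_def using n_pos by (simp add: field_simps)
        then show ?thesis by (simp add: power_mult_distrib power_divide)
      qed
      then have "expectation (\<lambda>x. (f i k x)\<^sup>2) = 1 / (real n)\<^sup>2 * expectation (\<lambda>x. (real n * Q i k x - 1)\<^sup>2)" by simp
      also have "\<dots> \<le> 1 / (real n)\<^sup>2 * (2 * \<theta>)"
        by (intro mult_left_mono expectation_Q_deviation ik) auto
      finally show ?thesis by simp
    qed
  qed
  then show ?thesis unfolding f_def .
qed

lemma expectation_T_W: "expectation (\<lambda>x. \<bar>T x - W x\<bar>) \<le> 4 * sqrt \<theta>"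
proof -
  define A where "A x = (\<Sum>e\<in>offdiag {..<p}. (1 - cut (fst e) (snd e) x) * H (fst e) (snd e) x)" for x
  define B where "B x = (\<Sum>e\<in>offdiag {..<p}. Q (fst e) (snd e) x - 1 / real n)" for x
  let ?c = "real n / (2 * real p)"
  have bA: "bdd_rv N A" unfolding A_def[abs_def] by auto
  have bB: "bdd_rv N B" unfolding B_def[abs_def] by auto
  have c0: "?c \<ge> 0" by simp
  have "expectation (\<lambda>x. \<bar>T x - W x\<bar>) \<le> expectation (\<lambda>x. ?c * \<bar>A x\<bar> + ?c * \<bar>B x\<bar>)"
  proof (rule expectation_mono)
    fix x
    have "W x = 1 / 2 * (\<Sum>e\<in>offdiag {..<p}. h (fst e) (snd e) x)"
      using sum_offdiag[of "\<lambda>i k. h i k x" p] unfolding W_def D_def S_def by simp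
    also have "\<dots> = ?c * (\<Sum>e\<in>offdiag {..<p}. cut (fst e) (snd e) x * H (fst e) (snd e) x)"
      unfolding h_def by (simp add: sum_distrib_left)
    finally have "T x - W x = ?c * (A x + B x)"
      unfolding T_def A_def B_def by (simp add: sum.distrib sum_subtractf left_diff_distrib right_diff_distrib distrib_left)
    then have "\<bar>T x - W x\<bar> = ?c * \<bar>A x + B x\<bar>" using c0 by (simp only: abs_mult abs_of_nonneg)
    also have "\<dots> \<le> ?c * (\<bar>A x\<bar> + \<bar>B x\<bar>)" using c0 by (intro mult_left_mono) auto
    finally show "\<bar>T x - W x\<bar> \<le> ?c * \<bar>A x\<bar> + ?c * \<bar>B x\<bar>" by (simp only: distrib_left)
  qed (use bA bB in auto)
  also have "\<dots> = ?c * expectation (\<lambda>x. \<bar>A x\<bar>) + ?c * expectation (\<lambda>x. \<bar>B x\<bar>)"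
  proof -
    have "integrable N (\<lambda>x. \<bar>A x\<bar>)" "integrable N (\<lambda>x. \<bar>B x\<bar>)" using bA bB by auto
    then show ?thesis by simp
  qed
  also have "\<dots> \<le> ?c * sqrt (2 * (real p)\<^sup>2 * (16 * \<theta> / (real n)\<^sup>2)) + ?c * sqrt (2 * (real p)\<^sup>2 * (2 * \<theta> / (real n)\<^sup>2))"
    using c0 expectation_abs_le_sqrt[OF bA expectation_cut_remainder[folded A_def]]
      expectation_abs_le_sqrt[OF bB expectation_Q_remainder[folded B_def]]
    by (intro add_mono mult_left_mono)
  also have "?c * sqrt (2 * (real p)\<^sup>2 * (16 * \<theta> / (real n)\<^sup>2)) = sqrt 8 * sqrt \<theta>"
  proof -
    have "2 * (real p)\<^sup>2 * (16 * \<theta> / (real n)\<^sup>2) = (2 * real p / real n)\<^sup>2 * (8 * \<theta>)"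
      by (simp add: power_divide power_mult_distrib)
    then have "sqrt (2 * (real p)\<^sup>2 * (16 * \<theta> / (real n)\<^sup>2)) = 2 * real p / real n * (sqrt 8 * sqrt \<theta>)"
      by (simp only: real_sqrt_mult real_sqrt_abs) simp
    then show ?thesis using n_pos p_pos by simp
  qed
  also have "?c * sqrt (2 * (real p)\<^sup>2 * (2 * \<theta> / (real n)\<^sup>2)) = sqrt \<theta>"
  proof -
    have "2 * (real p)\<^sup>2 * (2 * \<theta> / (real n)\<^sup>2) = (2 * real p / real n)\<^sup>2 * \<theta>"
      by (simp add: power_divide power_mult_distrib)
    then have "sqrt (2 * (real p)\<^sup>2 * (2 * \<theta> / (real n)\<^sup>2)) = 2 * real p / real n * sqrt \<theta>"
      by (simp only: real_sqrt_mult real_sqrt_abs) simp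
    then show ?thesis using n_pos p_pos by simp
  qed
  also have "sqrt 8 * sqrt \<theta> + sqrt \<theta> \<le> 4 * sqrt \<theta>"
  proof -
    have "sqrt 8 \<le> 3" by (rule real_le_lsqrt) auto
    then have "sqrt 8 * sqrt \<theta> \<le> 3 * sqrt \<theta>" using theta_nonneg by (intro mult_right_mono) auto
    then show ?thesis by simp
  qed
  finally show ?thesis .
qed

lemma cf_T:
  "cmod ((\<integral>x. iexp (t * T x) \<partial>N) - exp (- t\<^sup>2 / 2)) \<le>
    t\<^sup>2 * \<delta> + \<bar>t\<bar> ^ 3 * ((1 + K8) / sqrt (real p)) + \<bar>t\<bar> * (4 * sqrt \<theta>)"
proof -
  note [measurable] = bdd_rv_measurable[OF bdd_T] bdd_rv_measurable[OF bdd_W]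
  have int: "integrable N (\<lambda>x. iexp (t * T x))" "integrable N (\<lambda>x. iexp (t * W x))"
    by (auto intro!: integrable_const_bound[where B = 1])
  have "cmod ((\<integral>x. iexp (t * T x) \<partial>N) - (\<integral>x. iexp (t * W x) \<partial>N)) = cmod (\<integral>x. iexp (t * T x) - iexp (t * W x) \<partial>N)"
    using int by simp
  also have "\<dots> \<le> expectation (\<lambda>x. \<bar>t\<bar> * \<bar>T x - W x\<bar>)"
  proof (rule norm_expectation_le)
    show "integrable N (\<lambda>x. \<bar>t\<bar> * \<bar>T x - W x\<bar>)" by auto
    fix x
    have 1: "iexp (t * T x) = iexp (t * W x) * iexp (t * (T x - W x))"
      by (simp add: exp_add[symmetric] algebra_simps)
    have "iexp (t * T x) - iexp (t * W x) = iexp (t * W x) * (iexp (t * (T x - W x)) - (\<Sum>k\<le>0. (\<i> * (t * (T x - W x)))^k / fact k))"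
      unfolding 1 by (simp add: algebra_simps)
    also have "cmod \<dots> \<le> 1 * (\<bar>t * (T x - W x)\<bar> ^ Suc 0 / fact (Suc 0))"
      unfolding norm_mult using iexp_approx1[of "t * (T x - W x)" 0] by simp
    finally show "cmod (iexp (t * T x) - iexp (t * W x)) \<le> \<bar>t\<bar> * \<bar>T x - W x\<bar>" by (simp add: abs_mult)
  qed (use int in auto)
  also have "\<dots> = \<bar>t\<bar> * expectation (\<lambda>x. \<bar>T x - W x\<bar>)" by simp
  also have "\<dots> \<le> \<bar>t\<bar> * (4 * sqrt \<theta>)" by (intro mult_left_mono expectation_T_W) auto
  finally have 1: "cmod ((\<integral>x. iexp (t * T x) \<partial>N) - (\<integral>x. iexp (t * W x) \<partial>N)) \<le> \<bar>t\<bar> * (4 * sqrt \<theta>)" .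
  show ?thesis
    using norm_triangle_le[OF add_mono[OF 1 cf_W[of t]]] by simp
qed

end

section \<open>Moments of a regularly varying tail\<close>

text \<open>A dyadic decomposition: between \<open>2 ^ k * x0\<close> and \<open>2 ^ Suc k * x0\<close> the integrand is at most
\<open>(2 ^ Suc k * x0) powr s\<close>, while the probability of exceeding \<open>2 ^ k * x0\<close> is at most \<open>\<rho> ^ k\<close>.\<close>

lemma integrable_powr_of_doubling_tail:
  fixes M :: "real measure" and s x0 \<rho> :: real
  assumes M: "prob_space M" and sets: "sets M = sets borel" and x0: "x0 > 0" and s: "s > 0"
    and \<rho>: "0 \<le> \<rho>" "2 powr s * \<rho> < 1"
    and doubling: "\<And>x. x \<ge> x0 \<Longrightarrow> measure M {z. \<bar>z\<bar> > 2 * x} \<le> \<rho> * measure M {z::real. \<bar>z\<bar> > x}"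
  shows "integrable M (\<lambda>z. \<bar>z\<bar> powr s)"
proof -
  interpret prob_space M by (rule M)
  have sp: "space M = UNIV" using sets_eq_imp_space_eq[OF sets] by simp
  have [measurable]: "(\<lambda>z. \<bar>z\<bar> powr s) \<in> borel_measurable M"
    by (simp add: measurable_cong_sets[OF sets refl])
  define A where "A k = {z::real. \<bar>z\<bar> > 2 ^ k * x0}" for k
  have [measurable]: "A k \<in> sets M" for k unfolding A_def using sets by simp
  have tail: "measure M (A k) \<le> \<rho> ^ k" for k
  proof (induction k)
    case (Suc k)
    have "1 * x0 \<le> 2 ^ k * x0" using x0 by (intro mult_right_mono) auto
    then have "measure M (A (Suc k)) \<le> \<rho> * measure M (A k)"
      using doubling[of "2 ^ k * x0"] by (simp add: A_def mult.assoc)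
    also have "\<dots> \<le> \<rho> * \<rho> ^ k" using Suc \<rho>(1) by (rule mult_left_mono)
    finally show ?case by simp
  qed simp
  define c where "c k = (2 ^ Suc k * x0) powr s" for k :: nat
  have c: "c k = (2 * x0) powr s * (2 powr s) ^ k" for k
  proof -
    have "c k = (2 * x0) powr s * (2 ^ k) powr s"
      unfolding c_def using x0 by (simp add: powr_mult mult_ac)
    also have "(2 ^ k) powr s = (2 powr s) ^ k"
      by (simp add: powr_powr powr_realpow[symmetric] mult.commute)
    finally show ?thesis .
  qed
  have pw: "ennreal (\<bar>z\<bar> powr s) \<le> ennreal (x0 powr s) + (\<Sum>k. ennreal (c k) * indicator (A k) z)" for z
  proof (cases "\<bar>z\<bar> \<le> x0")
    case True
    then have "ennreal (\<bar>z\<bar> powr s) \<le> ennreal (x0 powr s)" using s by (intro ennreal_leI powr_mono2) auto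
    then show ?thesis by (rule order_trans) simp
  next
    case False
    have "\<exists>k. \<bar>z\<bar> \<le> 2 ^ k * x0"
    proof -
      obtain k :: nat where "\<bar>z\<bar> / x0 < 2 ^ k" using real_arch_pow[of 2 "\<bar>z\<bar> / x0"] by auto
      then show ?thesis using x0 by (intro exI[of _ k]) (simp add: pos_divide_less_eq)
    qed
    then obtain k where k: "\<bar>z\<bar> \<le> 2 ^ k * x0" "\<And>j. j < k \<Longrightarrow> \<not> \<bar>z\<bar> \<le> 2 ^ j * x0"
      using exists_least_iff[of "\<lambda>k. \<bar>z\<bar> \<le> 2 ^ k * x0"] by auto
    have "k \<noteq> 0" using False k(1) by (cases k) auto
    then obtain j where j: "k = Suc j" by (cases k) auto
    have "ennreal (\<bar>z\<bar> powr s) \<le> ennreal (c j)"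
      unfolding c_def using s k(1) j by (intro ennreal_leI powr_mono2) auto
    also have "\<dots> = ennreal (c j) * indicator (A j) z"
      using k(2)[of j] j by (simp add: A_def)
    also have "\<dots> = (\<Sum>k\<in>{j}. ennreal (c k) * indicator (A k) z)"
      by (simp only: sum.insert sum.empty finite.emptyI empty_iff not_False_eq_True add_0_right)
    also have "\<dots> \<le> (\<Sum>k. ennreal (c k) * indicator (A k) z)"
      by (rule sum_le_suminf) auto
    finally show ?thesis by (simp add: add_increasing)
  qed
  have "(\<integral>\<^sup>+z. ennreal (\<bar>z\<bar> powr s) \<partial>M) \<le> (\<integral>\<^sup>+z. ennreal (x0 powr s) + (\<Sum>k. ennreal (c k) * indicator (A k) z) \<partial>M)"
    by (rule nn_integral_mono) (rule pw)
  also have "\<dots> = ennreal (x0 powr s) + (\<Sum>k. ennreal (c k) * emeasure M (A k))"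
    by (subst nn_integral_add) (auto simp: nn_integral_suminf nn_integral_cmult_indicator emeasure_space_1)
  also have "(\<Sum>k. ennreal (c k) * emeasure M (A k)) \<le> (\<Sum>k. ennreal ((2 * x0) powr s * (2 powr s * \<rho>) ^ k))"
  proof (rule suminf_le)
    fix k
    have "ennreal (c k) * emeasure M (A k) = ennreal (c k * measure M (A k))"
      by (simp add: emeasure_eq_measure ennreal_mult' c_def)
    also have "\<dots> \<le> ennreal ((2 * x0) powr s * (2 powr s * \<rho>) ^ k)"
      unfolding c power_mult_distrib mult.assoc using tail[of k]
      by (intro ennreal_leI mult_left_mono) auto
    finally show "ennreal (c k) * emeasure M (A k) \<le> ennreal ((2 * x0) powr s * (2 powr s * \<rho>) ^ k)" .
  qed auto
  also have "(\<Sum>k. ennreal ((2 * x0) powr s * (2 powr s * \<rho>) ^ k)) = ennreal (\<Sum>k. (2 * x0) powr s * (2 powr s * \<rho>) ^ k)"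
    using \<rho> by (intro suminf_ennreal2 summable_mult summable_geometric) auto
  finally have "(\<integral>\<^sup>+z. ennreal (\<bar>z\<bar> powr s) \<partial>M) < \<infinity>"
    by (auto simp: less_top[symmetric] top_unique add_left_mono)
  then show ?thesis
    by (intro integrableI_bounded) auto
qed

text \<open>Slow variation at the factor \<open>2\<close> alone bounds the ratio of the tail at \<open>2 * x\<close> and at \<open>x\<close> by
\<open>2 powr (\<eta> - \<alpha>)\<close> eventually, for any \<open>\<eta> > 0\<close>. With \<open>\<eta> = (\<alpha> - s) / 2\<close> the dyadic sum converges.\<close>

lemma integrable_powr_of_regular_tail:
  fixes \<mu> :: "real measure"
  assumes "prob_space \<mu>" and sets: "sets \<mu> = sets borel"
    and slow: "slowly_varying L" and s: "0 < s" "s < \<alpha>"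
    and tail: "\<And>x. x > 0 \<Longrightarrow> measure \<mu> {z. \<bar>z\<bar> > x} = x powr (- \<alpha>) * L x"
  shows "integrable \<mu> (\<lambda>z. \<bar>z\<bar> powr s)"
proof -
  define \<eta> where "\<eta> = (\<alpha> - s) / 2"
  have \<eta>: "\<eta> > 0" unfolding \<eta>_def using s by simp
  obtain b where b: "\<forall>x\<ge>b. L x > 0" using slow unfolding slowly_varying_def by blast
  have "((\<lambda>x. L (2 * x) / L x) \<longlongrightarrow> 1) at_top" using slow unfolding slowly_varying_def by simp
  moreover have "1 < 2 powr \<eta>" using \<eta> by simp
  ultimately have "\<forall>\<^sub>F x in at_top. L (2 * x) / L x < 2 powr \<eta>" by (rule order_tendstoD)
  then obtain x1 where x1: "\<And>x. x \<ge> x1 \<Longrightarrow> L (2 * x) / L x < 2 powr \<eta>"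
    unfolding eventually_at_top_linorder by blast
  define x0 where "x0 = max (max x1 b) 1"
  show ?thesis
  proof (rule integrable_powr_of_doubling_tail[where ?x0.0 = x0 and \<rho> = "2 powr (\<eta> - \<alpha>)"])
    have "2 powr s * 2 powr (\<eta> - \<alpha>) = 2 powr (- \<eta>)"
    proof -
      have "s + (\<eta> - \<alpha>) = - \<eta>" unfolding \<eta>_def by (simp add: field_simps)
      then show ?thesis by (simp only: powr_add[symmetric])
    qed
    then show "2 powr s * 2 powr (\<eta> - \<alpha>) < 1" using \<eta> by (simp add: powr_less_one)
    fix x assume x: "x0 \<le> x"
    then have x': "x > 0" "x \<ge> x1" "x \<ge> b" unfolding x0_def by auto
    have "L (2 * x) \<le> 2 powr \<eta> * L x"
      using x1[OF x'(2)] b x'(3) by (simp add: pos_divide_less_eq less_imp_le)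
    then have "(2 * x) powr (- \<alpha>) * L (2 * x) \<le> (2 * x) powr (- \<alpha>) * (2 powr \<eta> * L x)"
      by (intro mult_left_mono) auto
    also have "\<dots> = 2 powr (\<eta> - \<alpha>) * (x powr (- \<alpha>) * L x)"
    proof -
      have "(2 * x) powr (- \<alpha>) = 2 powr (- \<alpha>) * x powr (- \<alpha>)" using x' by (simp add: powr_mult)
      moreover have "2 powr (\<eta> - \<alpha>) = 2 powr \<eta> * 2 powr (- \<alpha>)" by (simp flip: powr_add)
      ultimately show ?thesis by simp
    qed
    finally show "measure \<mu> {z. \<bar>z\<bar> > 2 * x} \<le> 2 powr (\<eta> - \<alpha>) * measure \<mu> {z. \<bar>z\<bar> > x}"
      using x' by (simp add: tail)
  qed (use assms(1) s sets in \<open>auto simp: x0_def\<close>)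
qed

context correlation_array
begin

lemma expectation_exp_rsq: "expectation (\<lambda>x. exp (- rsq i x)) = (\<integral>z. exp (- z\<^sup>2) \<partial>\<mu>) ^ n"
proof -
  have ind: "indep_vars (\<lambda>_. borel) (\<lambda>e x. exp (- (x e)\<^sup>2)) (Pair i ` {..<n})"
    by (rule indep_vars_compose2[where Y = "\<lambda>e z. exp (- z\<^sup>2)" and M' = "\<lambda>_. borel"])
       (auto intro: indep_vars_subset[OF indep_coords])
  have bdd: "bdd_rv N (\<lambda>x. exp (- (x e)\<^sup>2))" for e
    by (rule bdd_rvI[where B = 1]) auto
  have "expectation (\<lambda>x. exp (- rsq i x)) = expectation (\<lambda>x. \<Prod>e\<in>Pair i ` {..<n}. exp (- (x e)\<^sup>2))"
    unfolding rsq_def by (simp add: prod.reindex inj_on_def exp_sum sum_negf[symmetric])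
  also have "\<dots> = (\<Prod>e\<in>Pair i ` {..<n}. expectation (\<lambda>x. exp (- (x e)\<^sup>2)))"
    by (rule indep_vars_lebesgue_integral) (use ind bdd in auto)
  also have "\<dots> = (\<Prod>e\<in>Pair i ` {..<n}. (\<integral>z. exp (- z\<^sup>2) \<partial>\<mu>))"
    by (intro prod.cong refl expectation_coord) measurable
  also have "\<dots> = (\<integral>z. exp (- z\<^sup>2) \<partial>\<mu>) ^ n" by (simp add: card_image inj_on_def)
  finally show ?thesis .
qed

text \<open>If the squared row norm is at least \<open>c * n\<close>, then \<open>(a 0 0)\<^sup>2 \<le> a 0 0 powr (\<gamma> / 2)\<close> is bounded by the \<open>\<gamma>\<close>-th power of the
entry; the opposite event has exponentially small probability by Chernoff's inequality, since its
indicator is at most \<open>exp (c * n - rsq 0 x)\<close>.\<close>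

lemma sigma_le:
  assumes int: "integrable \<mu> (\<lambda>z. \<bar>z\<bar> powr \<gamma>)" and \<gamma>: "0 < \<gamma>" "\<gamma> \<le> 4" and c: "c > 0"
  shows "\<sigma> \<le> real n * ((\<integral>z. \<bar>z\<bar> powr \<gamma> \<partial>\<mu>) / (c * real n) powr (\<gamma> / 2) + (exp c * (\<integral>z. exp (- z\<^sup>2) \<partial>\<mu>)) ^ n)"
proof -
  have int': "integrable N (\<lambda>x. \<bar>x (0, 0)\<bar> powr \<gamma>)"
  proof -
    have "integrable (distr N borel (\<lambda>x. x (0, 0))) (\<lambda>z. \<bar>z\<bar> powr \<gamma>)" using int by (simp only: distr_coord)
    then show ?thesis by (subst (asm) integrable_distr_eq) auto
  qed
  have bexp: "bdd_rv N (\<lambda>x. exp (c * real n) * exp (- rsq 0 x))"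
    by (intro bdd_rv_mult bdd_rv_const bdd_rvI[where B = 1]) auto
  have pw: "(a 0 0 x)\<^sup>2 \<le> \<bar>x (0, 0)\<bar> powr \<gamma> / (c * real n) powr (\<gamma> / 2) + exp (c * real n) * exp (- rsq 0 x)" for x
  proof (cases "rsq 0 x < c * real n")
    case True
    have "(a 0 0 x)\<^sup>2 \<le> 1" using a_le_1[of 0 0 x] n2 by (simp add: power_le_one)
    also have "1 \<le> exp (c * real n - rsq 0 x)" using True by simp
    also have "\<dots> = exp (c * real n) * exp (- rsq 0 x)" by (simp flip: exp_add)
    finally show ?thesis by (simp add: add_increasing)
  next
    case False
    have cn: "c * real n > 0" using c n_pos by simp
    have a1: "0 \<le> a 0 0 x" "a 0 0 x \<le> 1" using a_le_1[of 0 0 x] n2 by auto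
    have "(a 0 0 x)\<^sup>2 \<le> a 0 0 x powr (\<gamma> / 2)"
    proof (cases "a 0 0 x = 0")
      case False
      then have "(a 0 0 x)\<^sup>2 = a 0 0 x powr 2" using a1 by (simp add: powr_numeral)
      also have "\<dots> \<le> a 0 0 x powr (\<gamma> / 2)" using \<gamma> a1 False by (intro powr_mono') auto
      finally show ?thesis .
    qed simp
    also have "\<dots> \<le> ((x (0, 0))\<^sup>2 / (c * real n)) powr (\<gamma> / 2)"
    proof (rule powr_mono2)
      show "a 0 0 x \<le> (x (0, 0))\<^sup>2 / (c * real n)"
        unfolding a_eq using False cn by (intro divide_left_mono) auto
    qed (use \<gamma> in auto)
    also have "\<dots> = ((x (0, 0))\<^sup>2) powr (\<gamma> / 2) / (c * real n) powr (\<gamma> / 2)"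
      using cn by (simp add: powr_divide)
    also have "((x (0, 0))\<^sup>2) powr (\<gamma> / 2) = \<bar>x (0, 0)\<bar> powr \<gamma>"
    proof (cases "x (0, 0) = 0")
      case False
      then have "(x (0, 0))\<^sup>2 = \<bar>x (0, 0)\<bar> powr 2" by (simp add: powr_numeral)
      then show ?thesis by (simp only: powr_powr) simp
    qed simp
    finally show ?thesis by (simp add: add_increasing2)
  qed
  have "\<sigma> = real n * expectation (\<lambda>x. (a 0 0 x)\<^sup>2 * 1)"
    using n2 by (subst expectation_a_sq) (auto simp: swap_inv_def \<sigma>_def)
  also have "expectation (\<lambda>x. (a 0 0 x)\<^sup>2 * 1) \<le>
      expectation (\<lambda>x. \<bar>x (0, 0)\<bar> powr \<gamma> / (c * real n) powr (\<gamma> / 2) + exp (c * real n) * exp (- rsq 0 x))"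
    using pw int' bexp n2 by (intro integral_mono) auto
  also have "\<dots> = expectation (\<lambda>x. \<bar>x (0, 0)\<bar> powr \<gamma>) / (c * real n) powr (\<gamma> / 2) + exp (c * real n) * expectation (\<lambda>x. exp (- rsq 0 x))"
    using Bochner_Integration.integral_add[OF integrable_divide_zero[OF int'] bdd_rv_integrable[OF bexp], of "(c * real n) powr (\<gamma> / 2)"]
    by (simp only: integral_divide_zero integral_mult_right_zero)
  also have "expectation (\<lambda>x. \<bar>x (0, 0)\<bar> powr \<gamma>) = (\<integral>z. \<bar>z\<bar> powr \<gamma> \<partial>\<mu>)"
    by (rule expectation_coord) measurable
  also have "exp (c * real n) * expectation (\<lambda>x. exp (- rsq 0 x)) = (exp c * (\<integral>z. exp (- z\<^sup>2) \<partial>\<mu>)) ^ n"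
    unfolding expectation_exp_rsq by (simp add: power_mult_distrib mult.commute flip: exp_of_nat_mult)
  finally show ?thesis by (simp add: mult_left_mono)
qed

end

context symmetric_array
begin

lemma integral_exp_neg_square: "0 < (\<integral>z. exp (- z\<^sup>2) \<partial>\<mu>)" "(\<integral>z. exp (- z\<^sup>2) \<partial>\<mu>) < 1"
proof -
  interpret mu: prob_space \<mu> by (rule prob_mu)
  have [measurable]: "(\<lambda>z::real. exp (- z\<^sup>2)) \<in> borel_measurable \<mu>"
    by (simp add: measurable_cong_sets[OF sets_mu refl])
  have int: "integrable \<mu> (\<lambda>z. exp (- z\<^sup>2))"
    by (rule mu.integrable_const_bound[where B = 1]) auto
  show "0 < (\<integral>z. exp (- z\<^sup>2) \<partial>\<mu>)"
    by (rule mu.integral_less_AE_space[of "\<lambda>_. 0", simplified]) (use int in \<open>auto simp: mu.emeasure_space_1\<close>)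
  have "AE z in \<mu>. z \<noteq> 0"
    using AE_not_in[of "{0}" \<mu>] null_mu by (auto simp: null_sets_def sets_mu mu.emeasure_eq_measure)
  then have "AE z in \<mu>. exp (- z\<^sup>2) < 1" by eventually_elim simp
  then have "(\<integral>z. exp (- z\<^sup>2) \<partial>\<mu>) < (\<integral>z. 1 \<partial>\<mu>)"
    using int by (intro mu.integral_less_AE_space) (auto simp: mu.emeasure_space_1)
  then show "(\<integral>z. exp (- z\<^sup>2) \<partial>\<mu>) < 1" by (simp add: mu.prob_space)
qed

text \<open>With \<open>c\<close> half of the exponent \<open>- ln r\<close>, the bound of \<open>sigma_le\<close> is of the order
\<open>n powr (1 - \<gamma> / 2)\<close>, and \<open>n * (n powr (1 - \<gamma> / 2))\<^sup>2 = n powr (3 - \<gamma>)\<close> vanishes in the limit for \<open>\<gamma> > 3\<close>.\<close>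

lemma theta_tendsto_0:
  assumes int: "integrable \<mu> (\<lambda>z. \<bar>z\<bar> powr \<gamma>)" and \<gamma>: "3 < \<gamma>" "\<gamma> \<le> 4"
  shows "(\<lambda>n. correlation_array.\<theta> \<mu> n) \<longlonglongrightarrow> 0"
proof -
  define r where "r = (\<integral>z. exp (- z\<^sup>2) \<partial>\<mu>)"
  define A where "A = (\<integral>z. \<bar>z\<bar> powr \<gamma> \<partial>\<mu>)"
  define c where "c = - ln r / 2"
  have r: "0 < r" "r < 1" using integral_exp_neg_square unfolding r_def by auto
  have c: "c > 0" unfolding c_def using r by simp
  have "exp c * r = exp (ln r / 2)"
  proof -
    have "exp c * r = exp c * exp (ln r)" using r by simp
    also have "\<dots> = exp (ln r / 2)" unfolding c_def by (simp flip: exp_add)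
    finally show ?thesis .
  qed
  moreover define d where "d = exp (ln r / 2)"
  ultimately have ecr: "exp c * r = d" by simp
  have d: "0 < d" "d < 1" unfolding d_def using r by auto
  define B where "B n = real n * (real n * (A / (c * real n) powr (\<gamma> / 2) + d ^ n))\<^sup>2" for n :: nat
  have "(\<lambda>n. (real n powr (3/2) * (A / (c * real n) powr (\<gamma> / 2) + d ^ n))\<^sup>2) \<longlonglongrightarrow> 0\<^sup>2"
  proof (rule tendsto_power)
    have 1: "(\<lambda>n. real n powr (3/2) * (A / (c * real n) powr (\<gamma> / 2))) \<longlonglongrightarrow> 0"
    proof -
      have "(\<lambda>n. A / c powr (\<gamma> / 2) * real n powr (3/2 - \<gamma> / 2)) \<longlonglongrightarrow> A / c powr (\<gamma> / 2) * 0"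
        using \<gamma> by (intro tendsto_mult tendsto_const tendsto_neg_powr filterlim_real_sequentially) auto
      moreover have "A / c powr (\<gamma> / 2) * real n powr (3/2 - \<gamma> / 2) = real n powr (3/2) * (A / (c * real n) powr (\<gamma> / 2))" for n
        using c by (simp add: powr_diff powr_mult)
      ultimately show ?thesis by simp
    qed
    have 2: "(\<lambda>n. real n powr (3/2) * d ^ n) \<longlonglongrightarrow> 0" using d by real_asymp
    show "(\<lambda>n. real n powr (3/2) * (A / (c * real n) powr (\<gamma> / 2) + d ^ n)) \<longlonglongrightarrow> 0"
      using tendsto_add[OF 1 2] by (simp add: distrib_left)
  qed
  moreover have "\<forall>\<^sub>F n in sequentially. (real n powr (3/2) * (A / (c * real n) powr (\<gamma> / 2) + d ^ n))\<^sup>2 = B n"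
    using eventually_gt_at_top[of 0]
  proof eventually_elim
    case (elim n)
    have "(real n powr (3/2))\<^sup>2 = real n ^ 3"
    proof -
      have "(real n powr (3/2))\<^sup>2 = real n powr (3/2 + 3/2)" unfolding power2_eq_square powr_add ..
      also have "3/2 + 3/2 = (3::real)" by simp
      also have "real n powr 3 = real n ^ 3" using elim by (simp add: powr_numeral)
      finally show ?thesis .
    qed
    then show ?case unfolding B_def power_mult_distrib by (simp add: power2_eq_square power3_eq_cube)
  qed
  ultimately have "B \<longlonglongrightarrow> 0" by (simp add: tendsto_cong)
  then show ?thesis
  proof (rule Lim_null_comparison[rotated])
    show "\<forall>\<^sub>F n in sequentially. norm (correlation_array.\<theta> \<mu> n) \<le> B n"
      using eventually_ge_at_top[of 2]
    proof eventually_elim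
      case (elim n)
      interpret correlation_array \<mu> n 2 by unfold_locales (use elim in auto)
      have s0: "\<sigma> \<ge> 0" using sigma_ge n_pos by (meson divide_nonneg_pos order_trans zero_le_one)
      have "\<sigma> \<le> real n * (A / (c * real n) powr (\<gamma> / 2) + d ^ n)"
        using sigma_le[OF int _ \<gamma>(2) c] \<gamma> unfolding A_def r_def[symmetric] ecr by simp
      then have "\<sigma>\<^sup>2 \<le> (real n * (A / (c * real n) powr (\<gamma> / 2) + d ^ n))\<^sup>2"
        using s0 by (intro power_mono)
      then show ?case using theta_nonneg by (simp add: \<theta>_def B_def mult_left_mono)
    qed
  qed
qed

end

section \<open>The central limit theorem\<close>

lemma mat_trace_sample_correlation_square:
  "mat_trace (sample_correlation_mat p n x ^\<^sub>m 2) =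
    (\<Sum>i<p. \<Sum>k<p. (\<Sum>j<n. x i j / sqrt (\<Sum>l<n. (x i l)\<^sup>2) * (x k j / sqrt (\<Sum>l<n. (x k l)\<^sup>2)))\<^sup>2)"
proof -
  define R where "R = sample_correlation_mat p n x"
  define c where "c i k = (\<Sum>j<n. x i j / sqrt (\<Sum>l<n. (x i l)\<^sup>2) * (x k j / sqrt (\<Sum>l<n. (x k l)\<^sup>2)))" for i k
  have dims: "R \<in> carrier_mat p p"
    unfolding R_def sample_correlation_mat_def self_normalized_mat_def
    by (rule mult_carrier_mat[where n = n]) simp_all
  have entry: "R $$ (i, k) = c i k" if "i < p" "k < p" for i k
    using that unfolding R_def sample_correlation_mat_def self_normalized_mat_def c_def
    by (simp add: scalar_prod_def atLeast0LessThan)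
  have sym: "c i k = c k i" for i k unfolding c_def by (simp add: mult.commute)
  have "R ^\<^sub>m 2 = R * R" using dims by (simp add: numeral_2_eq_2)
  then have "mat_trace (R ^\<^sub>m 2) = (\<Sum>i<p. \<Sum>k<p. c i k * c k i)"
    using dims entry unfolding mat_trace_def by (simp add: scalar_prod_def atLeast0LessThan)
  then show ?thesis unfolding R_def[symmetric] c_def[symmetric]
    by (simp add: sym[of k i for i k] power2_eq_square flip: c_def)
qed

definition statistic :: "nat \<Rightarrow> nat \<Rightarrow> (nat \<times> nat \<Rightarrow> real) \<Rightarrow> real" where
  "statistic p n x = (mat_trace (sample_correlation_mat p n (\<lambda>i j. x (i, j)) ^\<^sub>m 2) - centering p n) / (2 * real p / real n)"

lemma statistic_measurable:
  "statistic p n \<in> borel_measurable (\<Pi>\<^sub>M e\<in>{..<p} \<times> {..<n}. borel)"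
proof -
  have 1: "(\<lambda>x. x (i, j)) \<in> borel_measurable (\<Pi>\<^sub>M e\<in>{..<p} \<times> {..<n}. (borel :: real measure))"
    if "i < p" "j < n" for i j
    using that by (intro measurable_component_singleton) auto
  have 2: "(\<lambda>x. x (i, j) / sqrt (\<Sum>l<n. (x (i, l))\<^sup>2)) \<in> borel_measurable (\<Pi>\<^sub>M e\<in>{..<p} \<times> {..<n}. (borel :: real measure))"
    if "i < p" "j < n" for i j
    using that 1
    by (intro borel_measurable_divide borel_measurable_sqrt borel_measurable_sum borel_measurable_power) auto
  show ?thesis
    unfolding statistic_def[abs_def] mat_trace_sample_correlation_square
    by (intro borel_measurable_divide borel_measurable_diff borel_measurable_const
        borel_measurable_sum borel_measurable_power borel_measurable_times 2) auto
qed

lemma statistic_restrict: "statistic p n (restrict x ({..<p} \<times> {..<n})) = statistic p n x"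
  unfolding statistic_def mat_trace_sample_correlation_square by simp

context correlation_array
begin

text \<open>The diagonal entries of the correlation matrix are \<open>1\<close> unless a row vanishes, which is a null event.\<close>

lemma statistic_eq_T: "AE x in N. statistic p n x = T x"
proof -
  have "AE x in N. \<forall>i\<in>{..<p}. rsq i x \<noteq> 0"
    by (subst AE_finite_all) (auto intro: AE_rsq)
  then show ?thesis
  proof eventually_elim
    case (elim x)
    have "mat_trace (sample_correlation_mat p n (\<lambda>i j. x (i, j)) ^\<^sub>m 2) = (\<Sum>i<p. \<Sum>k<p. (\<Sum>j<n. y i j x * y k j x)\<^sup>2)"
      unfolding mat_trace_sample_correlation_square y_def rsq_def ..
    also have "\<dots> = (\<Sum>i<p. 1 + (\<Sum>k\<in>{..<p} - {i}. Q i k x + H i k x))"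
    proof (rule sum.cong[OF refl])
      fix i assume i: "i \<in> {..<p}"
      have "(\<Sum>j<n. y i j x * y i j x) = 1"
        using sum_a_eq_1[of i x] elim i by (simp add: a_def power2_eq_square)
      moreover have "(\<Sum>k<p. (\<Sum>j<n. y i j x * y k j x)\<^sup>2) =
          (\<Sum>j<n. y i j x * y i j x)\<^sup>2 + (\<Sum>k\<in>{..<p} - {i}. (\<Sum>j<n. y i j x * y k j x)\<^sup>2)"
        using i by (intro sum.remove) auto
      ultimately show "(\<Sum>k<p. (\<Sum>j<n. y i j x * y k j x)\<^sup>2) = 1 + (\<Sum>k\<in>{..<p} - {i}. Q i k x + H i k x)"
        by (simp add: correlation_square)
    qed
    also have "\<dots> = real p + (\<Sum>e\<in>offdiag {..<p}. Q (fst e) (snd e) x + H (fst e) (snd e) x)"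
      using sum_offdiag[of "\<lambda>i k. Q i k x + H i k x" p] by (simp add: sum.distrib)
    also have "(\<Sum>e\<in>offdiag {..<p}. Q (fst e) (snd e) x + H (fst e) (snd e) x) =
        (\<Sum>e\<in>offdiag {..<p}. Q (fst e) (snd e) x - 1 / real n + H (fst e) (snd e) x) + real p * (real p - 1) / real n"
      by (simp add: sum.distrib sum_subtractf card_offdiag)
    finally show ?case
      unfolding statistic_def T_def centering_def by simp
  qed
qed

text \<open>Data arrays on arbitrary probability spaces have the same joint law as the corresponding block of the
infinite array.\<close>

lemma cf_statistic:
  assumes "prob_space P" and indep: "prob_space.indep_vars P (\<lambda>_. borel) (\<lambda>(i, j). X i j) ({..<p} \<times> {..<n})"
    and ident: "\<And>i j. i < p \<Longrightarrow> j < n \<Longrightarrow> distr P borel (X i j) = \<mu>"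
  shows "(\<integral>\<omega>. iexp (t * statistic p n (\<lambda>(i, j). X i j \<omega>)) \<partial>P) = (\<integral>x. iexp (t * T x) \<partial>N)"
proof -
  interpret P: prob_space P by fact
  define I where "I = {..<p} \<times> {..<n}"
  have "(0, 0) \<in> I" unfolding I_def using n2 p2 by auto
  then have I: "I \<noteq> {}" by blast
  have X: "(\<lambda>(i, j). X i j) e \<in> borel_measurable P" if "e \<in> I" for e
    using indep that unfolding P.indep_vars_def I_def by blast
  have XI: "(\<lambda>\<omega>. \<lambda>e\<in>I. (\<lambda>(i, j). X i j) e \<omega>) \<in> measurable P (\<Pi>\<^sub>M e\<in>I. borel)"
    by (rule measurable_restrict) (use X in auto)
  have NI: "(\<lambda>x. \<lambda>e\<in>I. x e) \<in> measurable N (\<Pi>\<^sub>M e\<in>I. borel)"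
    by (rule measurable_restrict) auto
  have law: "distr P (\<Pi>\<^sub>M e\<in>I. borel) (\<lambda>\<omega>. \<lambda>e\<in>I. (\<lambda>(i, j). X i j) e \<omega>) =
      distr N (\<Pi>\<^sub>M e\<in>I. borel) (\<lambda>x. \<lambda>e\<in>I. x e)"
  proof -
    have "distr P (\<Pi>\<^sub>M e\<in>I. borel) (\<lambda>\<omega>. \<lambda>e\<in>I. (\<lambda>(i, j). X i j) e \<omega>) = (\<Pi>\<^sub>M e\<in>I. distr P borel ((\<lambda>(i, j). X i j) e))"
      using P.indep_vars_iff_distr_eq_PiM'[OF I, of "\<lambda>(i, j). X i j" "\<lambda>_. borel"] X indep[folded I_def] by simp
    also have "\<dots> = (\<Pi>\<^sub>M e\<in>I. distr N borel (\<lambda>x. x e))"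
      by (intro PiM_cong refl) (auto simp: I_def ident distr_coord)
    also have "\<dots> = distr N (\<Pi>\<^sub>M e\<in>I. borel) (\<lambda>x. \<lambda>e\<in>I. x e)"
      using indep_vars_iff_distr_eq_PiM'[OF I, of "\<lambda>e x. x e" "\<lambda>_. borel"] indep_vars_subset[OF indep_coords, of I] by simp
    finally show ?thesis .
  qed
  have g: "(\<lambda>x. iexp (t * statistic p n x)) \<in> borel_measurable (\<Pi>\<^sub>M e\<in>I. borel)"
  proof -
    note [measurable] = statistic_measurable[of p n, folded I_def]
    show ?thesis by measurable
  qed
  have "(\<integral>\<omega>. iexp (t * statistic p n (\<lambda>(i, j). X i j \<omega>)) \<partial>P) =
     (\<integral>\<omega>. iexp (t * statistic p n (\<lambda>e\<in>I. (\<lambda>(i, j). X i j) e \<omega>)) \<partial>P)"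
  proof -
    have "statistic p n (\<lambda>e\<in>I. (\<lambda>(i, j). X i j) e \<omega>) = statistic p n (\<lambda>(i, j). X i j \<omega>)" for \<omega>
      unfolding I_def using statistic_restrict[of p n "\<lambda>e. (\<lambda>(i, j). X i j) e \<omega>"] by (simp add: case_prod_unfold)
    then show ?thesis by simp
  qed
  also have "\<dots> = (\<integral>x. iexp (t * statistic p n x) \<partial>distr P (\<Pi>\<^sub>M e\<in>I. borel) (\<lambda>\<omega>. \<lambda>e\<in>I. (\<lambda>(i, j). X i j) e \<omega>))"
    by (rule integral_distr[OF XI g, symmetric])
  also have "\<dots> = (\<integral>x. iexp (t * statistic p n (\<lambda>e\<in>I. x e)) \<partial>N)"
    unfolding law by (rule integral_distr[OF NI g])
  also have "\<dots> = (\<integral>x. iexp (t * T x) \<partial>N)"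
  proof (rule integral_cong_AE)
    show "(\<lambda>x. iexp (t * statistic p n (\<lambda>e\<in>I. x e))) \<in> borel_measurable N"
      using measurable_compose[OF NI g] by simp
    show "(\<lambda>x. iexp (t * T x)) \<in> borel_measurable N"
    proof -
      note [measurable] = bdd_rv_measurable[OF bdd_T]
      show ?thesis by measurable
    qed
    show "AE x in N. iexp (t * statistic p n (\<lambda>e\<in>I. x e)) = iexp (t * T x)"
      using statistic_eq_T
    proof eventually_elim
      case (elim x)
      have "statistic p n (\<lambda>e\<in>I. x e) = statistic p n x" unfolding I_def by (rule statistic_restrict)
      then show ?case using elim by simp
    qed
  qed
  finally show ?thesis .
qed

end

theorem corollary3p2:
  fixes P :: "'b measure" and \<xi> :: "'b \<Rightarrow> real"
    and M :: "nat \<Rightarrow> 'a measure" and X :: "nat \<Rightarrow> nat \<Rightarrow> nat \<Rightarrow> 'a \<Rightarrow> real"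
    and p :: "nat \<Rightarrow> nat" and \<alpha> :: real and L :: "real \<Rightarrow> real"
  assumes "prob_space P" and "\<xi> \<in> borel_measurable P"
    and nondegenerate: "\<not> (\<exists>c. AE \<omega> in P. \<xi> \<omega> = c)"
    and symmetric: "distr P borel (\<lambda>\<omega>. - \<xi> \<omega>) = distr P borel \<xi>"
    and no_atom_at_0: "measure P {\<omega> \<in> space P. \<xi> \<omega> = 0} = 0"
    and alpha: "3 < \<alpha>" "\<alpha> < 4"
    and slow: "slowly_varying L"
    and tail: "\<And>x. x > 0 \<Longrightarrow>
      measure P {\<omega> \<in> space P. \<bar>\<xi> \<omega>\<bar> > x} = x powr (- \<alpha>) * L x"
    and prob: "\<And>n. prob_space (M n)"
    and indep: "\<And>n. prob_space.indep_vars (M n) (\<lambda>_. borel) (\<lambda>(i, j). X n i j)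
      ({..<p n} \<times> {..<n})"
    and ident: "\<And>n i j. i < p n \<Longrightarrow> j < n \<Longrightarrow> distr (M n) borel (X n i j) = distr P borel \<xi>"
    and p_tendsto: "filterlim p at_top sequentially"
  shows "weak_conv_m
    (\<lambda>n. distr (M n) borel
      (\<lambda>\<omega>. (mat_trace (sample_correlation_mat (p n) n (\<lambda>i j. X n i j \<omega>) ^\<^sub>m 2) - centering (p n) n)
            / (2 * real (p n) / real n)))
    std_normal_distribution"
proof -
  interpret P: prob_space P by fact
  note [measurable] = \<open>\<xi> \<in> borel_measurable P\<close>
  define \<mu> where "\<mu> = distr P borel \<xi>"
  have prob_mu: "prob_space \<mu>" unfolding \<mu>_def by (rule P.prob_space_distr) measurable
  have sets_mu: "sets \<mu> = sets borel" unfolding \<mu>_def by simp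
  interpret symmetric_array \<mu>
  proof (rule symmetric_array.intro)
    show "prob_space \<mu>" by (rule prob_mu)
    show "sets \<mu> = sets borel" by (rule sets_mu)
    show "distr \<mu> borel uminus = \<mu>"
      unfolding \<mu>_def using symmetric by (subst distr_distr) (auto simp: comp_def)
    show "measure \<mu> {0} = 0"
      unfolding \<mu>_def using no_atom_at_0 by (subst measure_distr) (auto simp: vimage_def Int_def conj_commute)
  qed
  \<comment> \<open>Any exponent strictly between \<open>3\<close> and \<open>\<alpha>\<close> would serve.\<close>
  define \<gamma> where "\<gamma> = (3 + \<alpha>) / 2"
  have \<gamma>: "3 < \<gamma>" "\<gamma> \<le> 4" "0 < \<gamma>" "\<gamma> < \<alpha>" unfolding \<gamma>_def using alpha by auto
  have "integrable \<mu> (\<lambda>z. \<bar>z\<bar> powr \<gamma>)"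
  proof (rule integrable_powr_of_regular_tail[OF prob_mu sets_mu slow \<gamma>(3,4)])
    fix x :: real assume x: "x > 0"
    have "measure \<mu> {z. \<bar>z\<bar> > x} = measure P {\<omega> \<in> space P. \<bar>\<xi> \<omega>\<bar> > x}"
      unfolding \<mu>_def by (subst measure_distr) (auto simp: vimage_def Int_def conj_commute)
    then show "measure \<mu> {z. \<bar>z\<bar> > x} = x powr (- \<alpha>) * L x" using tail[OF x] by simp
  qed
  then have theta: "(\<lambda>n. correlation_array.\<theta> \<mu> n) \<longlonglongrightarrow> 0" by (rule theta_tendsto_0[OF _ \<gamma>(1,2)])
  define F where "F n \<omega> = statistic (p n) n (\<lambda>(i, j). X n i j \<omega>)" for n \<omega>
  have F_measurable: "F n \<in> borel_measurable (M n)" for n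
  proof -
    interpret Mn: prob_space "M n" by (rule prob)
    have X: "X n i j \<in> borel_measurable (M n)" if "i < p n" "j < n" for i j
      using indep[of n] that unfolding Mn.indep_vars_def by auto
    have "(\<lambda>\<omega>. \<lambda>e\<in>{..<p n} \<times> {..<n}. X n (fst e) (snd e) \<omega>) \<in> measurable (M n) (\<Pi>\<^sub>M e\<in>{..<p n} \<times> {..<n}. borel)"
      by (rule measurable_restrict) (use X in auto)
    from measurable_compose[OF this statistic_measurable]
    have "(\<lambda>\<omega>. statistic (p n) n (\<lambda>e\<in>{..<p n} \<times> {..<n}. X n (fst e) (snd e) \<omega>)) \<in> borel_measurable (M n)" .
    then show ?thesis
      unfolding statistic_restrict F_def[abs_def] by (simp add: case_prod_unfold)
  qed
  have "weak_conv_m (\<lambda>n. distr (M n) borel (F n)) std_normal_distribution"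
  proof (rule levy_continuity)
    fix n
    interpret Mn: prob_space "M n" by (rule prob)
    show "real_distribution (distr (M n) borel (F n))"
      by (rule Mn.real_distribution_distr) (rule F_measurable)
  next
    show "real_distribution std_normal_distribution" by (rule real_dist_normal_dist)
  next
    fix t :: real
    define K :: real where "K = 8 * (2 * fact 8 * exp 1 + 16)"
    define b where "b n = t\<^sup>2 * (1 / 2 * sqrt (22 * K / real (p n) + 64 * correlation_array.\<theta> \<mu> n) +
        1 / 2 * sqrt ((4 * K + 256) / (real (p n))\<^sup>2) + (11 * correlation_array.\<theta> \<mu> n + 2 * sqrt (2 * correlation_array.\<theta> \<mu> n)) + 1 / real (p n))
        + \<bar>t\<bar> ^ 3 * ((1 + K) / sqrt (real (p n))) + \<bar>t\<bar> * (4 * sqrt (correlation_array.\<theta> \<mu> n))" for n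
    have p_inf: "filterlim (\<lambda>n. real (p n)) at_top sequentially"
      by (rule filterlim_compose[OF filterlim_real_sequentially p_tendsto])
    have inv: "(\<lambda>n. c / real (p n)) \<longlonglongrightarrow> 0" for c
      by (rule tendsto_divide_0[OF tendsto_const filterlim_at_top_imp_at_infinity[OF p_inf]])
    have inv2: "(\<lambda>n. c / (real (p n))\<^sup>2) \<longlonglongrightarrow> 0" for c
      using tendsto_mult[OF inv[of c] inv[of 1]] by (simp add: power2_eq_square)
    have inv_sqrt: "(\<lambda>n. c / sqrt (real (p n))) \<longlonglongrightarrow> 0" for c
      by (rule tendsto_divide_0[OF tendsto_const filterlim_at_top_imp_at_infinity
            [OF filterlim_compose[OF sqrt_at_top p_inf]]])
    have "b \<longlonglongrightarrow> t\<^sup>2 * (1 / 2 * sqrt (0 + 64 * 0) + 1 / 2 * sqrt 0 + (11 * 0 + 2 * sqrt (2 * 0)) + 0) +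
        \<bar>t\<bar> ^ 3 * 0 + \<bar>t\<bar> * (4 * sqrt 0)"
      unfolding b_def by (intro tendsto_intros theta inv inv2 inv_sqrt)
    then have b0: "b \<longlonglongrightarrow> 0" by simp
    have "\<forall>\<^sub>F n in sequentially. norm (char (distr (M n) borel (F n)) t - char std_normal_distribution t) \<le> b n"
      using eventually_ge_at_top[of 2] filterlim_at_top[THEN iffD1, OF p_tendsto, rule_format, of 2]
    proof eventually_elim
      case (elim n)
      interpret arr: correlation_array \<mu> n "p n" by unfold_locales (use elim in auto)
      have "char (distr (M n) borel (F n)) t = (\<integral>\<omega>. iexp (t * F n \<omega>) \<partial>M n)"
        unfolding char_def using F_measurable by (subst integral_distr) auto
      also have "\<dots> = (\<integral>x. iexp (t * arr.T x) \<partial>N)"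
        unfolding F_def by (rule arr.cf_statistic[OF prob indep]) (simp add: ident \<mu>_def)
      finally have "char (distr (M n) borel (F n)) t - char std_normal_distribution t =
          (\<integral>x. iexp (t * arr.T x) \<partial>N) - exp (- t\<^sup>2 / 2)"
        by (simp add: char_std_normal_distribution)
      then show ?case
        using arr.cf_T[of t] unfolding arr.\<delta>_def arr.\<beta>_def arr.K8_def b_def K_def by simp
    qed
    then have "(\<lambda>n. char (distr (M n) borel (F n)) t - char std_normal_distribution t) \<longlonglongrightarrow> 0"
      by (rule Lim_null_comparison) (rule b0)
    then show "(\<lambda>n. char (distr (M n) borel (F n)) t) \<longlonglongrightarrow> char std_normal_distribution t"
      by (rule LIM_zero_cancel)
  qed
  then show ?thesis unfolding F_def[abs_def] statistic_def by simp
qed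

end
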